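(* Let $k$ be a field of characteristic $0$ and let $H_c$ be an infinitesimal Cherednik algebra of $\mathfrak{gl}_2$ over $k$ (with $V=k^2\oplus (k^2)^*$). Let $\mathfrak{Z}(B)$ denote the center of an algebra $B$. Set $$b=y_1x-x_1y,\qquad d=\tau(y_1x-x_1y)-\bigl(2e\,y_1y+h(y_1x+x_1y)-2f\,x_1x\bigr).$$ Then $\mathfrak{Z}(H_c)$ is isomorphic to the polynomial algebra in two variables over $k$; more precisely, it is freely generated as a commutative $k$-algebra by two elements whose leading terms in $\mathrm{gr}(H_c)=\mathfrak{U}(\mathfrak{gl}_2\ltimes V)$, with respect to the filtration on $H_c$, are $b$ and $d$ respectively. Moreover, $\mathrm{gr}(\mathfrak{Z}(H_c))=\mathfrak{Z}(\mathrm{gr}(H_c))$.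
   Context: $\mathfrak{U}(\cdot)$ denotes the universal enveloping algebra. Let $\mathfrak g=\mathfrak{gl}_2=\mathfrak{sl}_2\oplus k\tau$ over $k$, where $\tau$ is the identity matrix and $e,f,h$ is the standard basis of $\mathfrak{sl}_2$ ($[h,e]=2e$, $[h,f]=-2f$, $[e,f]=h$). Let $V=k^2\oplus(k^2)^*$ with the natural action of $\mathfrak g$, with bases $k^2=kx\oplus ky$ and $(k^2)^*=kx_1\oplus ky_1$ such that $[e,x]=0,\ [f,x]=y,\ [e,y]=x,\ [f,y]=0,\ [h,x]=x,\ [h,y]=-y,\ [\tau,x]=x,\ [\tau,y]=y$, and $[e,x_1]=0,\ [f,x_1]=y_1,\ [e,y_1]=x_1,\ [f,y_1]=0,\ [h,x_1]=x_1,\ [h,y_1]=-y_1,\ [\tau,x_1]=-x_1,\ [\tau,y_1]=-y_1$. Let $\gamma:V\otimes V\to\mathfrak{U}\mathfrak g$ be a $\mathfrak g$-invariant (i.e. $\mathfrak g$-equivariant for the adjoint action on $\mathfrak{U}\mathfrak g$) skew-symmetric pairing with $\gamma(v,w)=0$ whenever $v,w\in k^2$ or $v,w\in(k^2)^*$. Let $H_\gamma$ be the quotient of $\mathfrak{U}\mathfrak g\ltimes TV$ ($TV$ the tensor algebra) by the relations $[v,w]=\gamma(v,w)$ for $v,w\in V$. It is filtered by $\deg(\alpha)=0$ for $\alpha\in\mathfrak{U}\mathfrak g$ and $\deg(v)=1$ for $v\in V$, and there is a natural surjective graded algebra homomorphism $\mathfrak{U}(\mathfrak g\ltimes V)\to\mathrm{gr}(H_\gamma)$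 (here $V$ is an abelian ideal in $\mathfrak g\ltimes V$). $H_\gamma$ is called an infinitesimal Cherednik algebra of $\mathfrak{gl}_2$ if this map is an isomorphism; one then identifies $\mathrm{gr}(H_\gamma)=\mathfrak{U}(\mathfrak g\ltimes V)$. For such $H_\gamma$ there exists $c\in\mathfrak{Z}(\mathfrak{U}\mathfrak g)$ such that $y_1x-x_1y-c$ is central in $H_\gamma$; this $c$ determines $\gamma$, and $H_\gamma$ is denoted $H_c$. The center $\mathfrak{Z}(H_c)$ carries the induced filtration, so that $\mathrm{gr}(\mathfrak{Z}(H_c))\subset\mathrm{gr}(H_c)$. *)

theory Defs
  imports "HOL-Algebra.Algebraic_Closure_Type" "HOL-Library.Poly_Mapping" "HOL-Library.Product_Plus"
begin

section \<open>Free associative algebras and algebras given by relations\<close>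

text \<open>
  The free monoid on \<open>'b\<close>, written additively, so that the convolution product of
  \<open>Poly_Mapping\<close> makes \<open>'b word \<Rightarrow>\<^sub>0 'k\<close> the free associative \<open>'k\<close>-algebra on \<open>'b\<close>,
  i.e. the tensor algebra of the vector space \<open>'b \<Rightarrow>\<^sub>0 'k\<close> with basis \<open>'b\<close>.
\<close>

datatype 'b word = Word (letters: "'b list")

instantiation word :: (type) monoid_add
begin

definition zero_word :: "'b word" where "zero_word = Word []"

definition plus_word :: "'b word \<Rightarrow> 'b word \<Rightarrow> 'b word"
  where "plus_word u v = Word (letters u @ letters v)"

instance
  by standard (simp_all add: zero_word_def plus_word_def)

end

text \<open>The linear map between spaces with given bases that is induced by a map of the bases.\<close>

definition push :: "('a \<Rightarrow> 'b) \<Rightarrow> ('a \<Rightarrow>\<^sub>0 'k) \<Rightarrow> ('b \<Rightarrow>\<^sub>0 'k::comm_ring_1)"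
  where "push f p = (\<Sum>a\<in>Poly_Mapping.keys p. Poly_Mapping.single (f a) (Poly_Mapping.lookup p a))"

definition scale :: "'k \<Rightarrow> ('a \<Rightarrow>\<^sub>0 'k) \<Rightarrow> ('a \<Rightarrow>\<^sub>0 'k::comm_ring_1)"
  where "scale r = Poly_Mapping.map ((*) r)"

text \<open>The bilinear extension of a map given on bases.\<close>

definition bilin :: "('a \<Rightarrow> 'b \<Rightarrow> ('c \<Rightarrow>\<^sub>0 'k)) \<Rightarrow> ('a \<Rightarrow>\<^sub>0 'k) \<Rightarrow> ('b \<Rightarrow>\<^sub>0 'k) \<Rightarrow> ('c \<Rightarrow>\<^sub>0 'k::comm_ring_1)"
  where "bilin B x y = (\<Sum>a\<in>Poly_Mapping.keys x. \<Sum>b\<in>Poly_Mapping.keys y.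
           scale (Poly_Mapping.lookup x a * Poly_Mapping.lookup y b) (B a b))"

abbreviation free_algebra :: "('b word \<Rightarrow>\<^sub>0 'k::comm_ring_1) ring"
  where "free_algebra \<equiv> ring_of_type_algebra"

definition vec :: "('b \<Rightarrow>\<^sub>0 'k) \<Rightarrow> ('b word \<Rightarrow>\<^sub>0 'k::comm_ring_1)"
  where "vec = push (\<lambda>b. Word [b])"

definition gen :: "'b \<Rightarrow> ('b word \<Rightarrow>\<^sub>0 'k::comm_ring_1)"
  where "gen b = Poly_Mapping.single (Word [b]) 1"

text \<open>\<open>presented R\<close> is the free algebra modulo the two-sided ideal generated by \<open>R\<close>, and
  \<open>cls R\<close> is the projection onto it. Its elements are cosets, that is, sets of representatives.\<close>

definition presented :: "('b word \<Rightarrow>\<^sub>0 'k::comm_ring_1) set \<Rightarrow> ('b word \<Rightarrow>\<^sub>0 'k) set ring"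
  where "presented R = free_algebra Quot (Idl\<^bsub>free_algebra\<^esub> R)"

definition cls :: "('b word \<Rightarrow>\<^sub>0 'k::comm_ring_1) set \<Rightarrow> ('b word \<Rightarrow>\<^sub>0 'k) \<Rightarrow> ('b word \<Rightarrow>\<^sub>0 'k) set"
  where "cls R p = (Idl\<^bsub>free_algebra\<^esub> R) +>\<^bsub>free_algebra\<^esub> p"

definition scal :: "('b word \<Rightarrow>\<^sub>0 'k::comm_ring_1) set \<Rightarrow> 'k \<Rightarrow> ('b word \<Rightarrow>\<^sub>0 'k) set"
  where "scal R r = cls R (Poly_Mapping.single 0 r)"

text \<open>The value of a noncommutative polynomial \<open>p\<close> in an algebra \<open>A\<close> at the elements \<open>g b\<close>,
  where \<open>s\<close> is the structure map of \<open>A\<close>, sending a scalar to its multiple of the unit.\<close>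

definition word_eval ::
  "('a, 'm) ring_scheme \<Rightarrow> ('k \<Rightarrow> 'a) \<Rightarrow> ('b \<Rightarrow> 'a) \<Rightarrow> ('b word \<Rightarrow>\<^sub>0 'k::comm_ring_1) \<Rightarrow> 'a"
  where "word_eval A s g p = finsum A
           (\<lambda>w. s (Poly_Mapping.lookup p w) \<otimes>\<^bsub>A\<^esub> foldr (\<lambda>b a. g b \<otimes>\<^bsub>A\<^esub> a) (letters w) \<one>\<^bsub>A\<^esub>)
           (Poly_Mapping.keys p)"

section \<open>Universal enveloping algebras\<close>

text \<open>A Lie algebra with basis \<open>'b\<close> is given by the brackets of its basis elements.\<close>

definition env_rels :: "('b \<Rightarrow> 'b \<Rightarrow> ('b \<Rightarrow>\<^sub>0 'k)) \<Rightarrow> ('b word \<Rightarrow>\<^sub>0 'k::comm_ring_1) set"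
  where "env_rels br = {vec x * vec y - vec y * vec x - vec (bilin br x y) | x y. True}"

text \<open>The semidirect product with a module, given by the action on its basis elements, which
  becomes an abelian ideal.\<close>

fun semidirect ::
  "('g \<Rightarrow> 'g \<Rightarrow> ('g \<Rightarrow>\<^sub>0 'k)) \<Rightarrow> ('g \<Rightarrow> 'v \<Rightarrow> ('v \<Rightarrow>\<^sub>0 'k)) \<Rightarrow>
     'g + 'v \<Rightarrow> 'g + 'v \<Rightarrow> ('g + 'v \<Rightarrow>\<^sub>0 'k::comm_ring_1)"
  where
    "semidirect br act (Inl a) (Inl b) = push Inl (br a b)"
  | "semidirect br act (Inl a) (Inr v) = push Inr (act a v)"
  | "semidirect br act (Inr v) (Inl a) = - push Inr (act a v)"
  | "semidirect br act (Inr v) (Inr w) = 0"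

section \<open>Centers, filtrations and associated graded rings\<close>

definition center :: "('a, 'm) ring_scheme \<Rightarrow> 'a set"
  where "center R = {z \<in> carrier R. \<forall>a \<in> carrier R. z \<otimes>\<^bsub>R\<^esub> a = a \<otimes>\<^bsub>R\<^esub> z}"

definition center_ring :: "('a, 'm) ring_scheme \<Rightarrow> ('a, 'm) ring_scheme"
  where "center_ring R = R\<lparr>carrier := center R\<rparr>"

text \<open>A filtration is indexed by the natural numbers; its part of degree \<open>-1\<close> is zero.\<close>

definition prev :: "('a, 'm) ring_scheme \<Rightarrow> (nat \<Rightarrow> 'a set) \<Rightarrow> nat \<Rightarrow> 'a set"
  where "prev R F n = (case n of 0 \<Rightarrow> {\<zero>\<^bsub>R\<^esub>} | Suc m \<Rightarrow> F m)"

text \<open>The direct sum of the quotients \<open>F n / F (n - 1)\<close>: an element \<open>u\<close> has as its component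
  of degree \<open>n\<close> a coset \<open>u n\<close> of \<open>F (n - 1)\<close> in \<open>F n\<close>, almost all of them zero. In the product,
  the component of degree \<open>n\<close> is the coset of the sum of the products of representatives
  of \<open>u i\<close> and \<open>v (n - i)\<close>.\<close>

definition gr :: "('a, 'm) ring_scheme \<Rightarrow> (nat \<Rightarrow> 'a set) \<Rightarrow> (nat \<Rightarrow> 'a set) ring"
  where "gr R F =
    \<lparr>carrier = {u. (\<forall>n. \<exists>a \<in> F n. u n = prev R F n +>\<^bsub>R\<^esub> a) \<and> finite {n. u n \<noteq> prev R F n}},
     monoid.mult = (\<lambda>u v n. {r \<oplus>\<^bsub>R\<^esub> finsum R (\<lambda>i. x i \<otimes>\<^bsub>R\<^esub> y (n - i)) {..n} | x y r.
               (\<forall>i. x i \<in> u i) \<and> (\<forall>i. y i \<in> v i) \<and> r \<in> prev R F n}),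
     monoid.one = (\<lambda>n. if n = 0 then prev R F 0 +>\<^bsub>R\<^esub> \<one>\<^bsub>R\<^esub> else prev R F n),
     ring.zero = prev R F,
     ring.add = (\<lambda>u v n. u n <+>\<^bsub>R\<^esub> v n)\<rparr>"

definition gr_class :: "('a, 'm) ring_scheme \<Rightarrow> (nat \<Rightarrow> 'a set) \<Rightarrow> nat \<Rightarrow> 'a \<Rightarrow> nat \<Rightarrow> 'a set"
  where "gr_class R F n a = (\<lambda>m. if m = n then prev R F n +>\<^bsub>R\<^esub> a else prev R F m)"

definition leading_term :: "('a, 'm) ring_scheme \<Rightarrow> (nat \<Rightarrow> 'a set) \<Rightarrow> 'a \<Rightarrow> nat \<Rightarrow> 'a set"
  where "leading_term R F a = gr_class R F (LEAST n. a \<in> F n) a"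

text \<open>For a subring \<open>S\<close> with the induced filtration, \<open>gr S\<close> as a subset of \<open>gr R\<close>.\<close>

definition gr_sub :: "('a, 'm) ring_scheme \<Rightarrow> (nat \<Rightarrow> 'a set) \<Rightarrow> 'a set \<Rightarrow> (nat \<Rightarrow> 'a set) set"
  where "gr_sub R F S =
    {u \<in> carrier (gr R F). \<forall>n. \<exists>a \<in> S \<inter> F n. u n = prev R F n +>\<^bsub>R\<^esub> a}"

section \<open>Polynomials in two variables\<close>

text \<open>The monoid algebra of the additive monoid of exponents \<open>(i, j)\<close>.\<close>

abbreviation poly2_ring :: "((nat \<times> nat) \<Rightarrow>\<^sub>0 'k::comm_ring_1) ring"
  where "poly2_ring \<equiv> ring_of_type_algebra"

definition poly2_eval ::
  "('a, 'm) ring_scheme \<Rightarrow> ('k \<Rightarrow> 'a) \<Rightarrow> 'a \<Rightarrow> 'a \<Rightarrow> ((nat \<times> nat) \<Rightarrow>\<^sub>0 'k::comm_ring_1) \<Rightarrow> 'a"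
  where "poly2_eval A s z\<^sub>1 z\<^sub>2 p = finsum A
           (\<lambda>(i, j). s (Poly_Mapping.lookup p (i, j)) \<otimes>\<^bsub>A\<^esub>
                     (z\<^sub>1 [^]\<^bsub>A\<^esub> (i::nat) \<otimes>\<^bsub>A\<^esub> z\<^sub>2 [^]\<^bsub>A\<^esub> (j::nat)))
           (Poly_Mapping.keys p)"

section \<open>The Lie algebra \<open>gl\<^sub>2\<close> and the module \<open>V\<close>\<close>

datatype gl2 = Ge | Gf | Gh | Gt

datatype vb = Vx | Vy | Vx1 | Vy1

fun gl2_br :: "gl2 \<Rightarrow> gl2 \<Rightarrow> (gl2 \<Rightarrow>\<^sub>0 'k::comm_ring_1)"
  where
    "gl2_br Gh Ge = Poly_Mapping.single Ge 2"
  | "gl2_br Ge Gh = Poly_Mapping.single Ge (-2)"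
  | "gl2_br Gh Gf = Poly_Mapping.single Gf (-2)"
  | "gl2_br Gf Gh = Poly_Mapping.single Gf 2"
  | "gl2_br Ge Gf = Poly_Mapping.single Gh 1"
  | "gl2_br Gf Ge = Poly_Mapping.single Gh (-1)"
  | "gl2_br _ _ = 0"

fun gl2_act :: "gl2 \<Rightarrow> vb \<Rightarrow> (vb \<Rightarrow>\<^sub>0 'k::comm_ring_1)"
  where
    "gl2_act Ge Vx = 0"
  | "gl2_act Gf Vx = Poly_Mapping.single Vy 1"
  | "gl2_act Ge Vy = Poly_Mapping.single Vx 1"
  | "gl2_act Gf Vy = 0"
  | "gl2_act Gh Vx = Poly_Mapping.single Vx 1"
  | "gl2_act Gh Vy = Poly_Mapping.single Vy (-1)"
  | "gl2_act Gt Vx = Poly_Mapping.single Vx 1"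
  | "gl2_act Gt Vy = Poly_Mapping.single Vy 1"
  | "gl2_act Ge Vx1 = 0"
  | "gl2_act Gf Vx1 = Poly_Mapping.single Vy1 1"
  | "gl2_act Ge Vy1 = Poly_Mapping.single Vx1 1"
  | "gl2_act Gf Vy1 = 0"
  | "gl2_act Gh Vx1 = Poly_Mapping.single Vx1 1"
  | "gl2_act Gh Vy1 = Poly_Mapping.single Vy1 (-1)"
  | "gl2_act Gt Vx1 = Poly_Mapping.single Vx1 (-1)"
  | "gl2_act Gt Vy1 = Poly_Mapping.single Vy1 (-1)"

definition U_rels :: "(gl2 word \<Rightarrow>\<^sub>0 'k::comm_ring_1) set"
  where "U_rels = env_rels gl2_br"

definition U_gl2 :: "(gl2 word \<Rightarrow>\<^sub>0 'k::comm_ring_1) set ring"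
  where "U_gl2 = presented U_rels"

definition UV_rels :: "((gl2 + vb) word \<Rightarrow>\<^sub>0 'k::comm_ring_1) set"
  where "UV_rels = env_rels (semidirect gl2_br gl2_act)"

definition U_gl2_V :: "((gl2 + vb) word \<Rightarrow>\<^sub>0 'k::comm_ring_1) set ring"
  where "U_gl2_V = presented UV_rels"

section \<open>Infinitesimal Cherednik algebras of \<open>gl\<^sub>2\<close>\<close>

text \<open>A linear map from the tensor square of \<open>V\<close> is given as a bilinear map.\<close>

definition invariant_pairing ::
  "((vb \<Rightarrow>\<^sub>0 'k) \<Rightarrow> (vb \<Rightarrow>\<^sub>0 'k) \<Rightarrow> (gl2 word \<Rightarrow>\<^sub>0 'k::field_char_0) set) \<Rightarrow> bool"
  where "invariant_pairing \<gamma> \<longleftrightarrow>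
    (\<forall>v w. \<gamma> v w \<in> carrier U_gl2) \<and>
    (\<forall>v v' w. \<gamma> (v + v') w = \<gamma> v w \<oplus>\<^bsub>U_gl2\<^esub> \<gamma> v' w) \<and>
    (\<forall>v w w'. \<gamma> v (w + w') = \<gamma> v w \<oplus>\<^bsub>U_gl2\<^esub> \<gamma> v w') \<and>
    (\<forall>r v w. \<gamma> (scale r v) w = scal U_rels r \<otimes>\<^bsub>U_gl2\<^esub> \<gamma> v w) \<and>
    (\<forall>r v w. \<gamma> v (scale r w) = scal U_rels r \<otimes>\<^bsub>U_gl2\<^esub> \<gamma> v w) \<and>
    (\<forall>v w. \<gamma> w v = \<ominus>\<^bsub>U_gl2\<^esub> \<gamma> v w) \<and>
    (\<forall>v w. Poly_Mapping.keys v \<subseteq> {Vx, Vy} \<and> Poly_Mapping.keys w \<subseteq> {Vx, Vy} \<longrightarrow>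
             \<gamma> v w = \<zero>\<^bsub>U_gl2\<^esub>) \<and>
    (\<forall>v w. Poly_Mapping.keys v \<subseteq> {Vx1, Vy1} \<and> Poly_Mapping.keys w \<subseteq> {Vx1, Vy1} \<longrightarrow>
             \<gamma> v w = \<zero>\<^bsub>U_gl2\<^esub>) \<and>
    (\<forall>a v w. \<gamma> (bilin gl2_act a v) w \<oplus>\<^bsub>U_gl2\<^esub> \<gamma> v (bilin gl2_act a w) =
             cls U_rels (vec a) \<otimes>\<^bsub>U_gl2\<^esub> \<gamma> v w \<ominus>\<^bsub>U_gl2\<^esub> \<gamma> v w \<otimes>\<^bsub>U_gl2\<^esub> cls U_rels (vec a))"

text \<open>The embeddings of \<open>gl\<^sub>2\<close>, of \<open>V\<close> and of the tensor algebra of \<open>gl\<^sub>2\<close> into the tensor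
  algebra of the direct sum of \<open>gl\<^sub>2\<close> and \<open>V\<close>.\<close>

definition vec_g :: "(gl2 \<Rightarrow>\<^sub>0 'k) \<Rightarrow> ((gl2 + vb) word \<Rightarrow>\<^sub>0 'k::comm_ring_1)"
  where "vec_g a = vec (push Inl a)"

definition vec_V :: "(vb \<Rightarrow>\<^sub>0 'k) \<Rightarrow> ((gl2 + vb) word \<Rightarrow>\<^sub>0 'k::comm_ring_1)"
  where "vec_V v = vec (push Inr v)"

definition incl :: "(gl2 word \<Rightarrow>\<^sub>0 'k) \<Rightarrow> ((gl2 + vb) word \<Rightarrow>\<^sub>0 'k::comm_ring_1)"
  where "incl = push (map_word Inl)"

text \<open>The semidirect product of \<open>U_gl2\<close> and the tensor algebra of \<open>V\<close> is the tensor algebra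
  of the direct sum of \<open>gl\<^sub>2\<close> and \<open>V\<close> modulo the relations of \<open>U_gl2\<close> and the relations saying
  that the commutator of \<open>a\<close> in \<open>gl\<^sub>2\<close> and \<open>v\<close> in \<open>V\<close> is the action of \<open>a\<close> on \<open>v\<close>.\<close>

definition smash_rels :: "((gl2 + vb) word \<Rightarrow>\<^sub>0 'k::comm_ring_1) set"
  where "smash_rels =
    {vec_g a * vec_g a' - vec_g a' * vec_g a - vec_g (bilin gl2_br a a') | a a'. True} \<union>
    {vec_g a * vec_V v - vec_V v * vec_g a - vec_V (bilin gl2_act a v) | a v. True}"

text \<open>In the remaining relations, \<open>p\<close> runs over the representatives of the coset \<open>\<gamma> v w\<close>.\<close>

definition H_rels ::
  "((vb \<Rightarrow>\<^sub>0 'k) \<Rightarrow> (vb \<Rightarrow>\<^sub>0 'k) \<Rightarrow> (gl2 word \<Rightarrow>\<^sub>0 'k) set) \<Rightarrow>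
     ((gl2 + vb) word \<Rightarrow>\<^sub>0 'k::comm_ring_1) set"
  where "H_rels \<gamma> = smash_rels \<union>
    {vec_V v * vec_V w - vec_V w * vec_V v - incl p | v w p. p \<in> \<gamma> v w}"

definition H_alg ::
  "((vb \<Rightarrow>\<^sub>0 'k) \<Rightarrow> (vb \<Rightarrow>\<^sub>0 'k) \<Rightarrow> (gl2 word \<Rightarrow>\<^sub>0 'k) set) \<Rightarrow>
     ((gl2 + vb) word \<Rightarrow>\<^sub>0 'k::comm_ring_1) set ring"
  where "H_alg \<gamma> = presented (H_rels \<gamma>)"

text \<open>The canonical map from \<open>U_gl2\<close> to \<open>H_alg \<gamma>\<close>.\<close>

definition U_to_H ::
  "((vb \<Rightarrow>\<^sub>0 'k) \<Rightarrow> (vb \<Rightarrow>\<^sub>0 'k) \<Rightarrow> (gl2 word \<Rightarrow>\<^sub>0 'k) set) \<Rightarrow>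
     (gl2 word \<Rightarrow>\<^sub>0 'k) set \<Rightarrow> ((gl2 + vb) word \<Rightarrow>\<^sub>0 'k::comm_ring_1) set"
  where "U_to_H \<gamma> A = the_elem ((\<lambda>p. cls (H_rels \<gamma>) (incl p)) ` A)"

definition V_degree :: "('g + 'v) word \<Rightarrow> nat"
  where "V_degree w = length (filter (\<lambda>b. \<not> isl b) (letters w))"

definition H_filt ::
  "((vb \<Rightarrow>\<^sub>0 'k) \<Rightarrow> (vb \<Rightarrow>\<^sub>0 'k) \<Rightarrow> (gl2 word \<Rightarrow>\<^sub>0 'k) set) \<Rightarrow>
     nat \<Rightarrow> ((gl2 + vb) word \<Rightarrow>\<^sub>0 'k::comm_ring_1) set set"
  where "H_filt \<gamma> n =
    cls (H_rels \<gamma>) ` {p. \<forall>w \<in> Poly_Mapping.keys p. V_degree w \<le> n}"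

abbreviation gr_H ::
  "((vb \<Rightarrow>\<^sub>0 'k) \<Rightarrow> (vb \<Rightarrow>\<^sub>0 'k) \<Rightarrow> (gl2 word \<Rightarrow>\<^sub>0 'k) set) \<Rightarrow>
     (nat \<Rightarrow> ((gl2 + vb) word \<Rightarrow>\<^sub>0 'k::comm_ring_1) set set) ring"
  where "gr_H \<gamma> \<equiv> gr (H_alg \<gamma>) (H_filt \<gamma>)"

text \<open>The natural map from \<open>U_gl2_V\<close> to \<open>gr_H \<gamma>\<close>: the homomorphism that sends a generator in
  \<open>gl\<^sub>2\<close> to its class in degree \<open>0\<close> and a generator in \<open>V\<close> to its class in degree \<open>1\<close>.\<close>

definition natural_map ::
  "((vb \<Rightarrow>\<^sub>0 'k) \<Rightarrow> (vb \<Rightarrow>\<^sub>0 'k) \<Rightarrow> (gl2 word \<Rightarrow>\<^sub>0 'k) set) \<Rightarrow>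
     ((gl2 + vb) word \<Rightarrow>\<^sub>0 'k::comm_ring_1) set \<Rightarrow>
     nat \<Rightarrow> ((gl2 + vb) word \<Rightarrow>\<^sub>0 'k) set set"
  where "natural_map \<gamma> A = the_elem (word_eval (gr_H \<gamma>)
    (\<lambda>r. gr_class (H_alg \<gamma>) (H_filt \<gamma>) 0 (scal (H_rels \<gamma>) r))
    (\<lambda>b. gr_class (H_alg \<gamma>) (H_filt \<gamma>) (if isl b then 0 else 1) (cls (H_rels \<gamma>) (gen b))) ` A)"

definition infinitesimal_cherednik ::
  "((vb \<Rightarrow>\<^sub>0 'k) \<Rightarrow> (vb \<Rightarrow>\<^sub>0 'k) \<Rightarrow> (gl2 word \<Rightarrow>\<^sub>0 'k::field_char_0) set) \<Rightarrow> bool"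
  where "infinitesimal_cherednik \<gamma> \<longleftrightarrow>
    invariant_pairing \<gamma> \<and> natural_map \<gamma> \<in> ring_iso U_gl2_V (gr_H \<gamma>)"

definition b_expr :: "(gl2 + vb) word \<Rightarrow>\<^sub>0 'k::comm_ring_1"
  where "b_expr = gen (Inr Vy1) * gen (Inr Vx) - gen (Inr Vx1) * gen (Inr Vy)"

definition d_expr :: "(gl2 + vb) word \<Rightarrow>\<^sub>0 'k::comm_ring_1"
  where "d_expr =
    gen (Inl Gt) * (gen (Inr Vy1) * gen (Inr Vx) - gen (Inr Vx1) * gen (Inr Vy)) -
    (2 * gen (Inl Ge) * gen (Inr Vy1) * gen (Inr Vy) +
     gen (Inl Gh) * (gen (Inr Vy1) * gen (Inr Vx) + gen (Inr Vx1) * gen (Inr Vy)) -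
     2 * gen (Inl Gf) * gen (Inr Vx1) * gen (Inr Vx))"

text \<open>\<open>H_alg \<gamma>\<close> is an infinitesimal Cherednik algebra and \<open>c\<close> is a parameter by which it is
  denoted \<open>H\<^sub>c\<close>: a central element of \<open>U_gl2\<close> such that \<open>y\<^sub>1 x - x\<^sub>1 y - c\<close> is central in it.\<close>

definition is_H_c ::
  "((vb \<Rightarrow>\<^sub>0 'k) \<Rightarrow> (vb \<Rightarrow>\<^sub>0 'k) \<Rightarrow> (gl2 word \<Rightarrow>\<^sub>0 'k::field_char_0) set) \<Rightarrow>
     (gl2 word \<Rightarrow>\<^sub>0 'k) set \<Rightarrow> bool"
  where "is_H_c \<gamma> c \<longleftrightarrow>
    infinitesimal_cherednik \<gamma> \<and> c \<in> center U_gl2 \<and>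
    cls (H_rels \<gamma>) b_expr \<ominus>\<^bsub>H_alg \<gamma>\<^esub> U_to_H \<gamma> c \<in> center (H_alg \<gamma>)"

end

theory Submission
  imports Defs "HOL-Library.Function_Algebras"
begin

text \<open>
  Write \<open>\<gg>\<close> for \<open>gl\<^sub>2\<close> and \<open>A\<close> for the enveloping algebra of \<open>\<gg> \<ltimes> V\<close>. By hypothesis \<open>A\<close> is the
  associated graded algebra of \<open>H\<^sub>c\<close>. The leading part of a central element of \<open>H\<^sub>c\<close> is central in \<open>A\<close>,
  and the center of \<open>A\<close> is the polynomial algebra in \<open>b\<close> and \<open>d\<close> (\<open>center_uea_spanned\<close>,
  \<open>bd_independent\<close>). So it is enough to lift \<open>b\<close> and \<open>d\<close> to central elements of \<open>H\<^sub>c\<close>: by induction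
  on the degree the lifts then generate the center of \<open>H\<^sub>c\<close>, they are algebraically independent because
  their leading parts are, and every central element of \<open>A\<close> is a sum of leading parts of central
  elements. The element \<open>b - c\<close> is a lift of \<open>b\<close> by the choice of \<open>c\<close>. The heart of the
  proof is that \<open>d + w\<close> is central for some central \<open>w\<close> in the enveloping algebra of \<open>\<gg>\<close>
  (\<open>d_lifts\<close>).

  The center of \<open>A\<close>. Put \<open>\<alpha> = (h + t) / 2\<close> and \<open>\<beta> = (t - h) / 2\<close>, where \<open>t\<close> is the generator called \<open>\<tau>\<close>
  or \<open>Gt\<close>. Multiplication by an element of the basis of \<open>V\<close> shifts exactly one of \<open>\<alpha>\<close> and \<open>\<beta>\<close> by one.
  The elements of \<open>A\<close> have unique normal forms, sums of terms
  \<open>f\<^sup>a p(\<alpha>, \<beta>) x\<^sup>i y\<^sup>j x\<^sub>1\<^sup>k y\<^sub>1\<^sup>l e\<^sup>b\<close> with polynomials \<open>p\<close> (\<open>vacuum_faithful\<close>). If \<open>z\<close> is central and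
  \<open>f\<^sup>m\<close> is the highest power of \<open>f\<close> in it, then commuting with \<open>V\<close> gives difference equations for the
  coefficients, by which the coefficient of \<open>f\<^sup>m\<close> is \<open>(x x\<^sub>1)\<^sup>m s\<close> with \<open>s\<close> a polynomial in \<open>V\<close> alone
  (\<open>V_central_top\<close>). Commuting with \<open>h\<close>, \<open>t\<close> and \<open>e\<close> makes \<open>s\<close> a polynomial in \<open>b\<close>. As the
  coefficient of \<open>f\<^sup>m\<close> in \<open>d\<^sup>m\<close> is \<open>2\<^sup>m (x x\<^sub>1)\<^sup>m\<close>, subtracting a combination of the \<open>b\<^sup>n d\<^sup>m\<close>
  lowers the power of \<open>f\<close>.

  The lift of \<open>d\<close>. Since \<open>b - c\<close> is central, the commutators of \<open>c\<close> with \<open>V\<close> are expressed by the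
  values of \<open>\<gamma>\<close>, and so are those of \<open>d\<close>. Let \<open>M\<close> send \<open>x\<close> to \<open>h x + 2 e y\<close> and \<open>y\<close> to
  \<open>2 f x - h y\<close>, and likewise for \<open>x\<^sub>1\<close> and \<open>y\<^sub>1\<close>. It turns out that \<open>[d, v]\<close> is
  \<open>(t + 2 - M) [c, v]\<close> for \<open>v\<close> in \<open>k\<^sup>2\<close> and \<open>(t + M) [c, v]\<close> for \<open>v\<close> in its dual, so that \<open>w\<close> has to
  satisfy \<open>[w, v] = - (t + 2 - M) [c, v]\<close> and \<open>[w, v] = - (t + M) [c, v]\<close>, respectively.
  Under the Harish-Chandra projection the polynomial
  \<open>T\<^sup>2 - (2 t + 2) T + (t\<^sup>2 + 2 t - \<Omega>)\<close>, with \<open>\<Omega>\<close> the Casimir element, has the roots \<open>2 \<alpha> + 2\<close> and \<open>2 \<beta>\<close>.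
  If a polynomial \<open>q(T)\<close> is congruent to \<open>c T + w\<close> modulo it, then \<open>(2 \<alpha> + 2) c + w = q(2 \<alpha> + 2)\<close> and
  \<open>2 \<beta> c + w = q(2 \<beta>)\<close>, and the pair \<open>c\<close>, \<open>w\<close> has the wanted property (\<open>interpolation\<close>).
  Conversely, the relations that \<open>c\<close> and \<open>\<gamma>\<close> satisfy in \<open>A\<close> force the function
  \<open>(\<alpha> - \<beta> + 1) c(\<alpha>, \<beta>)\<close> to have zero mixed difference (\<open>functional_equation\<close>). It therefore has the
  form \<open>(q(2 \<alpha> + 2) - q(2 \<beta>)) / 2\<close>, and \<open>c\<close> arises from \<open>q\<close> in this way (\<open>c_interpolates\<close>).
\<close>

section \<open>Free algebras, ideals and presented algebras\<close>

abbreviation idl :: "'a::ring_1 set \<Rightarrow> 'a set"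
  where "idl R \<equiv> Idl\<^bsub>ring_of_type_algebra\<^esub> R"

lemma type_ring_simps [simp]:
  "carrier (ring_of_type_algebra :: 'a::ring_1 ring) = UNIV"
  "x \<otimes>\<^bsub>(ring_of_type_algebra :: 'a ring)\<^esub> y = x * y"
  "x \<oplus>\<^bsub>(ring_of_type_algebra :: 'a ring)\<^esub> y = x + y"
  "\<one>\<^bsub>(ring_of_type_algebra :: 'a ring)\<^esub> = 1"
  "\<zero>\<^bsub>(ring_of_type_algebra :: 'a ring)\<^esub> = 0"
  by (simp_all add: ring_of_type_algebra_def)

lemma type_ring: "ring (ring_of_type_algebra :: 'a::ring_1 ring)"
proof -
  have "\<exists>y. x + y = 0" for x :: 'a
    using add.right_inverse by blast
  thus ?thesis
    unfolding ring_of_type_algebra_def using add.right_inverse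
    by unfold_locales (auto simp: algebra_simps Units_def)
qed

lemma type_ring_a_inv [simp]: "\<ominus>\<^bsub>(ring_of_type_algebra :: 'a::ring_1 ring)\<^esub> x = - x"
proof -
  interpret ring "ring_of_type_algebra :: 'a ring" by (rule type_ring)
  show ?thesis
    by (rule minus_equality) simp_all
qed

definition two_sided :: "'a::ring_1 set \<Rightarrow> bool"
  where "two_sided J \<longleftrightarrow> 0 \<in> J \<and> (\<forall>p\<in>J. \<forall>q\<in>J. p + q \<in> J) \<and> (\<forall>p\<in>J. \<forall>q. q * p \<in> J \<and> p * q \<in> J)"

lemma two_sidedI:
  assumes "0 \<in> J" "\<And>p q. p \<in> J \<Longrightarrow> q \<in> J \<Longrightarrow> p + q \<in> J"
    "\<And>p q. p \<in> J \<Longrightarrow> q * p \<in> J" "\<And>p q. p \<in> J \<Longrightarrow> p * q \<in> J"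
  shows "two_sided J"
  using assms by (auto simp: two_sided_def)

lemma ideal_iff_two_sided: "ideal J (ring_of_type_algebra :: 'a::ring_1 ring) \<longleftrightarrow> two_sided J"
proof
  assume "ideal J (ring_of_type_algebra :: 'a ring)"
  then interpret ideal J "ring_of_type_algebra :: 'a ring" .
  have "0 \<in> J" using additive_subgroup.zero_closed[OF is_additive_subgroup] by simp
  moreover have "p + q \<in> J" if "p \<in> J" "q \<in> J" for p q
    using additive_subgroup.a_closed[OF is_additive_subgroup that] by simp
  moreover have "q * p \<in> J" "p * q \<in> J" if "p \<in> J" for p q
    using I_l_closed[OF that, of q] I_r_closed[OF that, of q] by simp_all
  ultimately show "two_sided J"
    by (intro two_sidedI)
next
  assume J: "two_sided J"
  have neg: "- p \<in> J" if "p \<in> J" for p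
    using J that by (metis two_sided_def mult_minus1)
  show "ideal J (ring_of_type_algebra :: 'a ring)"
  proof (rule idealI)
    show "subgroup J (add_monoid (ring_of_type_algebra :: 'a ring))"
      using J neg type_ring_a_inv[where 'a = 'a, unfolded a_inv_def]
      by (intro subgroup.intro) (simp_all add: two_sided_def ring_of_type_algebra_def)
  qed (use J in \<open>auto simp: two_sided_def type_ring\<close>)
qed

lemma two_sided_idl: "two_sided (idl R)"
  by (metis ideal_iff_two_sided ring.genideal_ideal[OF type_ring] subset_UNIV type_ring_simps(1))

lemma idl_zero [simp]: "0 \<in> idl R"
  and idl_add: "p \<in> idl R \<Longrightarrow> q \<in> idl R \<Longrightarrow> p + q \<in> idl R"
  and idl_lmult: "p \<in> idl R \<Longrightarrow> q * p \<in> idl R"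
  and idl_rmult: "p \<in> idl R \<Longrightarrow> p * q \<in> idl R"
  using two_sided_idl[of R] by (auto simp: two_sided_def)

lemma idl_uminus: "p \<in> idl R \<Longrightarrow> - p \<in> idl R"
  using idl_lmult[of p R "-1"] by simp

lemma idl_diff: "p \<in> idl R \<Longrightarrow> q \<in> idl R \<Longrightarrow> p - q \<in> idl R"
  using idl_add[of p R "- q"] by (simp add: idl_uminus)

lemma idl_diff_commute: "p - q \<in> idl R \<Longrightarrow> q - p \<in> idl R"
  using idl_uminus[of "p - q"] by simp

lemma idl_trans: "p - q \<in> idl R \<Longrightarrow> q - r \<in> idl R \<Longrightarrow> p - r \<in> idl R"
  using idl_add[of "p - q" R "q - r"] by simp

lemma idl_sum: "(\<And>i. i \<in> A \<Longrightarrow> f i \<in> idl R) \<Longrightarrow> sum f A \<in> idl R"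
  by (induction A rule: infinite_finite_induct) (auto intro: idl_add)

lemma idl_cong_mult:
  assumes "p - p' \<in> idl R" "q - q' \<in> idl R"
  shows "p * q - p' * q' \<in> idl R"
proof -
  have "p * q - p' * q' = (p - p') * q + p' * (q - q')"
    by (simp add: algebra_simps)
  then show ?thesis
    using assms by (simp add: idl_add idl_lmult idl_rmult)
qed

lemma idl_base: "p \<in> R \<Longrightarrow> p \<in> idl R"
  using ring.genideal_self[OF type_ring, of R] by auto

lemma idl_least: "R \<subseteq> J \<Longrightarrow> two_sided J \<Longrightarrow> idl R \<subseteq> J"
  using ring.genideal_minimal[OF type_ring] by (metis ideal_iff_two_sided)

lemma idl_mono: "R \<subseteq> R' \<Longrightarrow> idl R \<subseteq> idl R'"
  by (rule idl_least) (auto intro: idl_base two_sided_idl)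

subsection \<open>Presented algebras\<close>

lemma cls_alt: "cls R p = {q. q - p \<in> idl R}"
proof -
  have "cls R p = {r + p |r. r \<in> idl R}"
    by (auto simp: cls_def a_r_coset_def r_coset_def ring_of_type_algebra_def)
  also have "\<dots> = {q. q - p \<in> idl R}"
    by (auto, metis diff_add_cancel)
  finally show ?thesis .
qed

lemma cls_eq_iff: "cls R p = cls R q \<longleftrightarrow> p - q \<in> idl R"
proof
  assume "cls R p = cls R q"
  moreover have "p \<in> cls R p" by (simp add: cls_alt)
  ultimately show "p - q \<in> idl R" by (auto simp: cls_alt)
next
  assume "p - q \<in> idl R"
  then show "cls R p = cls R q"
    unfolding cls_alt using idl_trans idl_diff_commute by blast
qed

lemma self_in_cls: "p \<in> cls R p"
  by (simp add: cls_alt)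

lemma presented_ring: "ring (presented R)"
  unfolding presented_def by (rule ideal.quotient_is_ring) (simp add: ideal_iff_two_sided two_sided_idl)

lemma carrier_presented: "carrier (presented R) = range (cls R)"
  by (auto simp: presented_def FactRing_def A_RCOSETS_def RCOSETS_def cls_def a_r_coset_def ring_of_type_algebra_def)

lemma cls_mult [simp]: "cls R p \<otimes>\<^bsub>presented R\<^esub> cls R q = cls R (p * q)"
proof -
  interpret ideal "idl R" "ring_of_type_algebra" by (simp add: ideal_iff_two_sided two_sided_idl)
  show ?thesis
    using rcoset_mult_add[of p q] by (simp add: presented_def FactRing_def cls_def)
qed

lemma cls_add [simp]: "cls R p \<oplus>\<^bsub>presented R\<^esub> cls R q = cls R (p + q)"
proof -
  interpret ideal "idl R" "ring_of_type_algebra" by (simp add: ideal_iff_two_sided two_sided_idl)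
  show ?thesis
    using a_rcos_sum[of p q] by (simp add: presented_def FactRing_def cls_def)
qed

lemma presented_one: "\<one>\<^bsub>presented R\<^esub> = cls R 1"
  by (simp add: presented_def FactRing_def cls_def)

lemma presented_zero: "\<zero>\<^bsub>presented R\<^esub> = cls R 0"
  by (simp add: presented_def FactRing_def cls_alt)

lemma cls_uminus [simp]: "\<ominus>\<^bsub>presented R\<^esub> cls R p = cls R (- p)"
proof -
  interpret ring "presented R" by (rule presented_ring)
  show ?thesis
    by (rule minus_equality) (auto simp: presented_zero carrier_presented)
qed

lemma cls_minus [simp]: "cls R p \<ominus>\<^bsub>presented R\<^esub> cls R q = cls R (p - q)"
  by (simp add: a_minus_def)

lemma finsum_cls: "finsum (presented R) (\<lambda>i. cls R (f i)) A = cls R (sum f A)"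
proof -
  interpret ring "presented R" by (rule presented_ring)
  show ?thesis
    by (induction A rule: infinite_finite_induct)
      (auto simp: presented_zero carrier_presented)
qed

lemma cls_in_center_iff: "cls R p \<in> center (presented R) \<longleftrightarrow> (\<forall>q. p * q - q * p \<in> idl R)"
  unfolding center_def carrier_presented by (simp add: cls_eq_iff flip: cls_eq_iff)

lemma center_presented:
  "center (presented R) = cls R ` {p. \<forall>q. p * q - q * p \<in> idl R}"
proof -
  have "center (presented R) \<subseteq> range (cls R)"
    by (auto simp: center_def carrier_presented)
  then show ?thesis
    using cls_in_center_iff[of R] by auto
qed

subsection \<open>Induction over noncommutative polynomials\<close>

lemma word_zero: "(0 :: 'b word) = Word []"
  by (simp add: zero_word_def)

lemma gen_times_single: "gen b * Poly_Mapping.single (Word bs) r = Poly_Mapping.single (Word (b # bs)) r"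
  by (simp add: gen_def mult_single plus_word_def)

lemma poly_mapping_sum: "p = (\<Sum>w\<in>Poly_Mapping.keys p. Poly_Mapping.single w (Poly_Mapping.lookup p w))"
  by (rule poly_mapping_eqI)
    (auto simp: lookup_sum lookup_single when_def in_keys_iff sum.delta')

lemma poly_mapping_additive_induct [case_names single add]:
  fixes p :: "'a \<Rightarrow>\<^sub>0 'k::comm_monoid_add"
  assumes single: "\<And>w r. P (Poly_Mapping.single w r)" and add: "\<And>p q. P p \<Longrightarrow> P q \<Longrightarrow> P (p + q)"
  shows "P p"
proof -
  have "P (\<Sum>w\<in>A. Poly_Mapping.single w (f w))" if "finite A" for A f
    using that
  proof induction
    case empty
    show ?case using single[of undefined 0] by simp
  qed (simp add: single add)
  then show ?thesis
    by (subst poly_mapping_sum) simp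
qed

lemma free_algebra_induct [case_names scalar gen add]:
  fixes p :: "'b word \<Rightarrow>\<^sub>0 'k::comm_ring_1"
  assumes scalar: "\<And>r. P (Poly_Mapping.single 0 r)" and gen: "\<And>b p. P p \<Longrightarrow> P (gen b * p)"
    and add: "\<And>p q. P p \<Longrightarrow> P q \<Longrightarrow> P (p + q)"
  shows "P p"
proof (induction p rule: poly_mapping_additive_induct)
  case (single w r)
  have "P (Poly_Mapping.single (Word bs) r)" for bs
    by (induction bs) (use scalar gen in \<open>auto simp: word_zero simp flip: gen_times_single\<close>)
  then show ?case by (cases w) simp
qed (rule add)

lemma scalar_commute: "Poly_Mapping.single (0 :: 'b word) r * p = p * Poly_Mapping.single 0 (r :: 'k::comm_ring_1)"
  by (induction p rule: poly_mapping_additive_induct) (simp_all add: mult_single mult.commute algebra_simps)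

text \<open>The elements that commute with \<open>p\<close> modulo a two-sided ideal form a subalgebra, so that centrality modulo
  the ideal can be tested on generators.\<close>

lemma commutes_if_commutes_gen:
  fixes p :: "'b word \<Rightarrow>\<^sub>0 'k::comm_ring_1"
  assumes "\<And>b. p * gen b - gen b * p \<in> idl R"
  shows "p * q - q * p \<in> idl R"
proof (induction q rule: free_algebra_induct)
  case (scalar r)
  show ?case by (simp add: scalar_commute)
next
  case (gen b q)
  have "p * (gen b * q) - gen b * q * p = (p * gen b - gen b * p) * q + gen b * (p * q - q * p)"
    by (simp add: algebra_simps)
  then show ?case
    using gen assms by (simp add: idl_add idl_lmult idl_rmult)
next
  case (add q q')
  have "p * (q + q') - (q + q') * p = (p * q - q * p) + (p * q' - q' * p)"
    by (simp add: algebra_simps)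
  then show ?case
    using add by (simp add: idl_add)
qed

section \<open>The associated graded algebra of a filtered presented algebra\<close>

subsection \<open>Words filtered by the number of letters in \<open>V\<close>\<close>

definition filt_lt :: "nat \<Rightarrow> (('g + 'v) word \<Rightarrow>\<^sub>0 'k::comm_ring_1) set"
  where "filt_lt n = {p. \<forall>w \<in> Poly_Mapping.keys p. V_degree w < n}"

definition hpart :: "nat \<Rightarrow> (('g + 'v) word \<Rightarrow>\<^sub>0 'k) \<Rightarrow> (('g + 'v) word \<Rightarrow>\<^sub>0 'k::comm_ring_1)"
  where "hpart n p = (\<Sum>w | w \<in> Poly_Mapping.keys p \<and> V_degree w = n.
           Poly_Mapping.single w (Poly_Mapping.lookup p w))"

lemma V_degree_add [simp]: "V_degree (u + v) = V_degree u + V_degree v"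
  by (simp add: V_degree_def plus_word_def)

lemma V_degree_zero [simp]: "V_degree 0 = 0"
  by (simp add: V_degree_def zero_word_def)

lemma in_filt_lt: "p \<in> filt_lt n \<longleftrightarrow> (\<forall>w. n \<le> V_degree w \<longrightarrow> Poly_Mapping.lookup p w = 0)"
  unfolding filt_lt_def mem_Collect_eq by (metis in_keys_iff not_le)

lemma filt_lt_0 [simp]: "filt_lt 0 = {0}"
  by (auto simp: in_filt_lt intro: poly_mapping_eqI)

lemma zero_in_filt_lt [simp]: "0 \<in> filt_lt n"
  by (simp add: in_filt_lt)

lemma filt_lt_add: "p \<in> filt_lt n \<Longrightarrow> q \<in> filt_lt n \<Longrightarrow> p + q \<in> filt_lt n"
  by (simp add: in_filt_lt lookup_add)

lemma filt_lt_uminus: "p \<in> filt_lt n \<Longrightarrow> - p \<in> filt_lt n"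
  by (simp add: in_filt_lt)

lemma filt_lt_mono: "p \<in> filt_lt m \<Longrightarrow> m \<le> n \<Longrightarrow> p \<in> filt_lt n"
  by (simp add: in_filt_lt)

lemma filt_lt_mult:
  assumes "p \<in> filt_lt m" "q \<in> filt_lt (Suc n)"
  shows "p * q \<in> filt_lt (m + n)" "q * p \<in> filt_lt (m + n)"
proof -
  have "\<And>w. w \<in> Poly_Mapping.keys (p * q) \<Longrightarrow> V_degree w < m + n"
    using keys_mult[of p q] assms by (fastforce simp: filt_lt_def)
  then show "p * q \<in> filt_lt (m + n)" by (simp add: filt_lt_def)
  have "\<And>w. w \<in> Poly_Mapping.keys (q * p) \<Longrightarrow> V_degree w < m + n"
    using keys_mult[of q p] assms by (fastforce simp: filt_lt_def)
  then show "q * p \<in> filt_lt (m + n)" by (simp add: filt_lt_def)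
qed

lemma filt_lt_bounded: "\<exists>n. p \<in> filt_lt n"
proof -
  have "finite (V_degree ` Poly_Mapping.keys p)" by simp
  then obtain n where "\<forall>i \<in> V_degree ` Poly_Mapping.keys p. i < n"
    using finite_nat_set_iff_bounded by blast
  then show ?thesis by (auto simp: filt_lt_def)
qed

lemma lookup_hpart: "Poly_Mapping.lookup (hpart n p) w = (if V_degree w = n then Poly_Mapping.lookup p w else 0)"
  by (auto simp: hpart_def lookup_sum lookup_single when_def in_keys_iff sum.delta')

lemma hpart_zero [simp]: "hpart n 0 = 0"
  by (simp add: hpart_def)

lemma hpart_add: "hpart n (p + q) = hpart n p + hpart n q"
  by (rule poly_mapping_eqI) (simp add: lookup_hpart lookup_add)

lemma hpart_diff: "hpart n (p - q) = hpart n p - hpart n q"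
  by (rule poly_mapping_eqI) (simp add: lookup_hpart lookup_minus)

lemma hpart_sum: "hpart n (sum f A) = (\<Sum>i\<in>A. hpart n (f i))"
  by (induction A rule: infinite_finite_induct) (simp_all add: hpart_add)

lemma hpart_single: "hpart n (Poly_Mapping.single w r) = (if V_degree w = n then Poly_Mapping.single w r else 0)"
  by (rule poly_mapping_eqI) (auto simp: lookup_hpart lookup_single when_def)

lemma hpart_in_filt: "hpart n p \<in> filt_lt (Suc n)"
  by (simp add: in_filt_lt lookup_hpart)

lemma hpart_hpart: "hpart n (hpart m p) = (if n = m then hpart m p else 0)"
  by (rule poly_mapping_eqI) (simp add: lookup_hpart)

lemma diff_hpart_in_filt: "p \<in> filt_lt (Suc n) \<Longrightarrow> p - hpart n p \<in> filt_lt n"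
  by (auto simp: in_filt_lt lookup_hpart lookup_minus)

lemma sum_hpart: "p \<in> filt_lt n \<Longrightarrow> p = (\<Sum>i<n. hpart i p)"
  by (rule poly_mapping_eqI) (auto simp: in_filt_lt lookup_sum lookup_hpart not_less)

lemma hpart_mult: "hpart n (p * q) = (\<Sum>i\<le>n. hpart i p * hpart (n - i) q)"
proof (induction p rule: poly_mapping_additive_induct)
  case (single u r)
  show ?case
  proof (induction q rule: poly_mapping_additive_induct)
    case (single v s)
    have "(\<Sum>i\<le>n. hpart i (Poly_Mapping.single u r) * hpart (n - i) (Poly_Mapping.single v s)) =
        (\<Sum>i\<le>n. if V_degree u = i then (if V_degree v = n - i then Poly_Mapping.single (u + v) (r * s) else 0) else 0)"
      by (rule sum.cong) (auto simp: hpart_single mult_single)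
    also have "\<dots> = hpart n (Poly_Mapping.single u r * Poly_Mapping.single v s)"
      by (auto simp: hpart_single mult_single)
    finally show ?case ..
  qed (simp add: hpart_add algebra_simps sum.distrib)
qed (simp add: hpart_add algebra_simps sum.distrib)

lemma hpart_one: "hpart n 1 = (if n = 0 then 1 else 0)"
  using hpart_single[of n 0 1] by (simp only: single_one V_degree_zero eq_commute[of 0 n])

lemma hpart_gen: "hpart n (gen b) = (if n = (if isl b then 0 else 1) then gen b else 0)"
  by (auto simp: gen_def hpart_single V_degree_def)

subsection \<open>Classes modulo lower filtration degree\<close>

text \<open>The elements whose class in degree \<open>n\<close> of the associated graded algebra of the presented algebra vanishes.\<close>

definition low :: "(('g + 'v) word \<Rightarrow>\<^sub>0 'k::comm_ring_1) set \<Rightarrow> nat \<Rightarrow> (('g + 'v) word \<Rightarrow>\<^sub>0 'k) set"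
  where "low R n = {p. \<exists>q \<in> filt_lt n. p - q \<in> idl R}"

lemma lowI: "q \<in> filt_lt n \<Longrightarrow> p - q \<in> idl R \<Longrightarrow> p \<in> low R n"
  by (auto simp: low_def)

lemma lowE:
  assumes "p \<in> low R n"
  obtains q r where "p = q + r" "q \<in> filt_lt n" "r \<in> idl R"
  using assms by (auto simp: low_def) (metis add.commute diff_add_cancel)

lemma idl_in_low: "p \<in> idl R \<Longrightarrow> p \<in> low R n"
  by (rule lowI[of 0]) simp_all

lemma filt_lt_in_low: "p \<in> filt_lt n \<Longrightarrow> p \<in> low R n"
  by (rule lowI[of p]) simp_all

lemma low_0: "low R 0 = idl R"
  by (simp add: low_def)

lemma low_zero [simp]: "0 \<in> low R n"
  by (simp add: idl_in_low)

lemma low_add: "p \<in> low R n \<Longrightarrow> q \<in> low R n \<Longrightarrow> p + q \<in> low R n"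
proof (elim lowE)
  fix p' p'' q' q''
  assume "p = p' + p''" "q = q' + q''" and *: "p' \<in> filt_lt n" "q' \<in> filt_lt n" "p'' \<in> idl R" "q'' \<in> idl R"
  then show "p + q \<in> low R n"
    by (intro lowI[of "p' + q'"]) (simp_all add: filt_lt_add idl_add algebra_simps)
qed

lemma low_uminus: "p \<in> low R n \<Longrightarrow> - p \<in> low R n"
proof (elim lowE)
  fix p' p''
  assume "p = p' + p''" and *: "p' \<in> filt_lt n" "p'' \<in> idl R"
  then show "- p \<in> low R n"
    by (intro lowI[of "- p'"]) (simp_all add: filt_lt_uminus idl_uminus)
qed

lemma low_diff: "p \<in> low R n \<Longrightarrow> q \<in> low R n \<Longrightarrow> p - q \<in> low R n"
  using low_add[of p R n "- q"] by (simp add: low_uminus)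

lemma low_diff_commute: "p - q \<in> low R n \<Longrightarrow> q - p \<in> low R n"
  using low_uminus[of "p - q"] by simp

lemma low_trans: "p - q \<in> low R n \<Longrightarrow> q - r \<in> low R n \<Longrightarrow> p - r \<in> low R n"
  using low_add[of "p - q" R n "q - r"] by simp

lemma low_sum: "(\<And>i. i \<in> A \<Longrightarrow> f i \<in> low R n) \<Longrightarrow> sum f A \<in> low R n"
  by (induction A rule: infinite_finite_induct) (auto intro: low_add)

lemma low_mono: "p \<in> low R m \<Longrightarrow> m \<le> n \<Longrightarrow> p \<in> low R n"
  by (auto simp: low_def intro: filt_lt_mono)

lemma low_mult:
  assumes "p \<in> low R m" "q \<in> filt_lt (Suc n)"
  shows "p * q \<in> low R (m + n)" "q * p \<in> low R (m + n)"
proof -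
  obtain p' p'' where p: "p = p' + p''" and *: "p' \<in> filt_lt m" "p'' \<in> idl R"
    using assms(1) by (elim lowE)
  show "p * q \<in> low R (m + n)"
    unfolding p using * filt_lt_mult(1)[OF *(1) assms(2)]
    by (simp add: distrib_right low_add filt_lt_in_low idl_in_low idl_rmult)
  show "q * p \<in> low R (m + n)"
    unfolding p using * filt_lt_mult(2)[OF *(1) assms(2)]
    by (simp add: distrib_left low_add filt_lt_in_low idl_in_low idl_lmult)
qed

text \<open>The product of the graded algebra is well defined: changing the factors by terms of lower degree
  changes the product by terms of lower degree.\<close>

lemma low_cong_mult:
  assumes "p - p' \<in> low R m" "q - q' \<in> low R n" "p' \<in> filt_lt (Suc m)" "q' \<in> filt_lt (Suc n)"
  shows "p * q - p' * q' \<in> low R (m + n)"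
proof -
  obtain u r where u: "q - q' = u + r" "u \<in> filt_lt n" "r \<in> idl R"
    using assms(2) by (elim lowE)
  have q: "q' + u \<in> filt_lt (Suc n)"
    using u assms(4) by (meson filt_lt_add filt_lt_mono le_SucI order_refl)
  have "p * q - p' * q' = (p - p') * (q' + u) + p * r + p' * u - 0 * q"
    using u(1) by (simp add: algebra_simps)
  moreover have "(p - p') * (q' + u) \<in> low R (m + n)"
    by (rule low_mult) fact+
  moreover have "p * r \<in> low R (m + n)"
    using u by (simp add: idl_in_low idl_lmult)
  moreover have "p' * u \<in> low R (m + n)"
    using filt_lt_mult(2)[OF u(2) assms(3)] by (simp add: filt_lt_in_low add.commute)
  ultimately show ?thesis
    by (simp add: low_add)
qed

definition cfilt :: "(('g + 'v) word \<Rightarrow>\<^sub>0 'k::comm_ring_1) set \<Rightarrow> nat \<Rightarrow> (('g + 'v) word \<Rightarrow>\<^sub>0 'k) set set"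
  where "cfilt R n = cls R ` filt_lt (Suc n)"

lemma H_filt_eq_cfilt: "H_filt \<gamma> = cfilt (H_rels \<gamma>)"
  by (auto simp: fun_eq_iff H_filt_def cfilt_def filt_lt_def less_Suc_eq_le)

text \<open>The class of \<open>p\<close> in the component of degree \<open>n\<close>. An element of the presented algebra is itself a coset, so
  that this is a set of cosets.\<close>

definition gcos :: "(('g + 'v) word \<Rightarrow>\<^sub>0 'k::comm_ring_1) set \<Rightarrow> nat \<Rightarrow> (('g + 'v) word \<Rightarrow>\<^sub>0 'k) \<Rightarrow> (('g + 'v) word \<Rightarrow>\<^sub>0 'k) set set"
  where "gcos R n p = {cls R q | q. q - p \<in> low R n}"

lemma cls_in_gcos: "cls R q \<in> gcos R n p \<longleftrightarrow> q - p \<in> low R n"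
proof
  assume "cls R q \<in> gcos R n p"
  then obtain q' where "q - q' \<in> idl R" "q' - p \<in> low R n"
    by (auto simp: gcos_def cls_eq_iff)
  then show "q - p \<in> low R n"
    using low_trans idl_in_low by blast
qed (auto simp: gcos_def)

lemma in_gcosE:
  assumes "x \<in> gcos R n p"
  obtains q where "x = cls R q" "q - p \<in> low R n"
  using assms by (auto simp: gcos_def)

lemma prev_eq_gcos: "prev (presented R) (cfilt R) n = gcos R n 0"
proof -
  have "prev (presented R) (cfilt R) n = cls R ` filt_lt n"
    by (cases n) (simp_all add: prev_def cfilt_def presented_zero)
  also have "\<dots> = gcos R n 0"
    by (auto simp: gcos_def cls_eq_iff image_iff intro: filt_lt_in_low elim!: lowE)
      (metis add_diff_cancel_left')
  finally show ?thesis .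
qed

lemma prev_coset: "prev (presented R) (cfilt R) n +>\<^bsub>presented R\<^esub> cls R p = gcos R n p"
proof -
  have "prev (presented R) (cfilt R) n +>\<^bsub>presented R\<^esub> cls R p = {cls R (q + p) | q. q \<in> low R n}"
    unfolding prev_eq_gcos a_r_coset_def' gcos_def by (auto; metis cls_add)
  also have "\<dots> = gcos R n p"
    by (auto simp: gcos_def) (metis diff_add_cancel)
  finally show ?thesis .
qed

lemma gcos_eq_iff: "gcos R n p = gcos R n q \<longleftrightarrow> p - q \<in> low R n"
proof
  assume "gcos R n p = gcos R n q"
  moreover have "cls R p \<in> gcos R n p" by (simp add: cls_in_gcos)
  ultimately show "p - q \<in> low R n" by (simp add: cls_in_gcos)
next
  assume "p - q \<in> low R n"
  then show "gcos R n p = gcos R n q"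
    unfolding gcos_def using low_trans low_diff_commute by blast
qed

lemma set_add_gcos: "gcos R n p <+>\<^bsub>presented R\<^esub> gcos R n q = gcos R n (p + q)"
proof -
  have "gcos R n p <+>\<^bsub>presented R\<^esub> gcos R n q = {cls R (p' + q') | p' q'. p' - p \<in> low R n \<and> q' - q \<in> low R n}"
    unfolding set_add_def' gcos_def by (auto; metis cls_add)
  also have "\<dots> = gcos R n (p + q)"
  proof -
    have "p' + q' - (p + q) \<in> low R n" if "p' - p \<in> low R n" "q' - q \<in> low R n" for p' q'
      using low_add[OF that] by (simp add: algebra_simps)
    moreover have "\<exists>p' q'. r = p' + q' \<and> p' - p \<in> low R n \<and> q' - q \<in> low R n" if "r - (p + q) \<in> low R n" for r
      using that by (intro exI[of _ p] exI[of _ "r - p"]) (simp add: algebra_simps)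
    ultimately show ?thesis
      by (auto simp: gcos_def) metis
  qed
  finally show ?thesis .
qed

subsection \<open>The graded algebra as an image of the free algebra\<close>

abbreviation grp :: "(('g + 'v) word \<Rightarrow>\<^sub>0 'k::comm_ring_1) set \<Rightarrow> (nat \<Rightarrow> (('g + 'v) word \<Rightarrow>\<^sub>0 'k) set set) ring"
  where "grp R \<equiv> gr (presented R) (cfilt R)"

text \<open>The projection of the free algebra onto the graded algebra. It sends each homogeneous part to its class in its
  own degree, and it reduces calculations in the graded algebra to calculations with polynomials.\<close>

definition gproj :: "(('g + 'v) word \<Rightarrow>\<^sub>0 'k::comm_ring_1) set \<Rightarrow> (('g + 'v) word \<Rightarrow>\<^sub>0 'k) \<Rightarrow> nat \<Rightarrow> (('g + 'v) word \<Rightarrow>\<^sub>0 'k) set set"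
  where "gproj R p = (\<lambda>n. gcos R n (hpart n p))"

lemma gproj_eq_iff: "gproj R p = gproj R q \<longleftrightarrow> (\<forall>n. hpart n (p - q) \<in> low R n)"
  by (auto simp: gproj_def fun_eq_iff gcos_eq_iff hpart_diff)

lemma gproj_add: "gproj R p \<oplus>\<^bsub>grp R\<^esub> gproj R q = gproj R (p + q)"
  by (simp add: gr_def gproj_def set_add_gcos hpart_add)

lemma gproj_zero: "\<zero>\<^bsub>grp R\<^esub> = gproj R 0"
  by (simp add: gr_def gproj_def fun_eq_iff prev_eq_gcos)

lemma gproj_one: "\<one>\<^bsub>grp R\<^esub> = gproj R 1"
  by (simp add: gr_def gproj_def fun_eq_iff prev_eq_gcos presented_one prev_coset[of R 0, simplified prev_eq_gcos]
      hpart_one)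

text \<open>The component of degree \<open>n\<close> of a product in the graded algebra is a set of sums of products over all
  choices of representatives. All these sums agree modulo lower degree, and adding an arbitrary element of
  lower degree fills up the coset.\<close>

lemma gproj_mult: "gproj R p \<otimes>\<^bsub>grp R\<^esub> gproj R q = gproj R (p * q)"
proof (rule ext)
  fix n
  have "(gproj R p \<otimes>\<^bsub>grp R\<^esub> gproj R q) n = {r \<oplus>\<^bsub>presented R\<^esub> finsum (presented R) (\<lambda>i. x i \<otimes>\<^bsub>presented R\<^esub> y (n - i)) {..n} | x y r.
               (\<forall>i. x i \<in> gproj R p i) \<and> (\<forall>i. y i \<in> gproj R q i) \<and> r \<in> gcos R n 0}"
    by (simp add: gr_def prev_eq_gcos)
  also have "\<dots> = gcos R n (hpart n (p * q))"
  proof (intro equalityI subsetI)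
    fix z assume "z \<in> {r \<oplus>\<^bsub>presented R\<^esub> finsum (presented R) (\<lambda>i. x i \<otimes>\<^bsub>presented R\<^esub> y (n - i)) {..n} | x y r.
               (\<forall>i. x i \<in> gproj R p i) \<and> (\<forall>i. y i \<in> gproj R q i) \<and> r \<in> gcos R n 0}"
    then obtain x y r where z: "z = r \<oplus>\<^bsub>presented R\<^esub> finsum (presented R) (\<lambda>i. x i \<otimes>\<^bsub>presented R\<^esub> y (n - i)) {..n}"
      and x: "\<forall>i. x i \<in> gproj R p i" and y: "\<forall>i. y i \<in> gproj R q i" and r: "r \<in> gcos R n 0" by blast
    from x have "\<forall>i. \<exists>a. x i = cls R a \<and> a - hpart i p \<in> low R i"
      by (auto simp: gproj_def gcos_def)
    then obtain a where a: "\<And>i. x i = cls R (a i)" "\<And>i. a i - hpart i p \<in> low R i" by metis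
    from y have "\<forall>i. \<exists>b. y i = cls R b \<and> b - hpart i q \<in> low R i"
      by (auto simp: gproj_def gcos_def)
    then obtain b where b: "\<And>i. y i = cls R (b i)" "\<And>i. b i - hpart i q \<in> low R i" by metis
    from r obtain c where c: "r = cls R c" "c \<in> low R n"
      by (auto simp: gcos_def)
    have "z = cls R (c + (\<Sum>i\<le>n. a i * b (n - i)))"
      by (simp add: z c a b finsum_cls)
    moreover have e: "c + (\<Sum>i\<le>n. a i * b (n - i)) - hpart n (p * q) = c + (\<Sum>i\<le>n. a i * b (n - i) - hpart i p * hpart (n - i) q)"
      by (simp add: hpart_mult sum_subtractf)
    moreover have "a i * b (n - i) - hpart i p * hpart (n - i) q \<in> low R n" if "i \<le> n" for i
      using low_cong_mult[OF a(2) b(2) hpart_in_filt hpart_in_filt, of i "n - i"] that by simp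
    moreover have "c + (\<Sum>i\<le>n. a i * b (n - i) - hpart i p * hpart (n - i) q) \<in> low R n"
      using calculation(3) c by (intro low_add low_sum) simp_all
    ultimately show "z \<in> gcos R n (hpart n (p * q))"
      by (simp only: cls_in_gcos e)
  next
    fix z assume "z \<in> gcos R n (hpart n (p * q))"
    then obtain c where c: "z = cls R c" "c - hpart n (p * q) \<in> low R n" by (elim in_gcosE)
    have "z = cls R (c - hpart n (p * q)) \<oplus>\<^bsub>presented R\<^esub> finsum (presented R) (\<lambda>i. cls R (hpart i p) \<otimes>\<^bsub>presented R\<^esub> cls R (hpart (n - i) q)) {..n}"
      by (simp add: finsum_cls c) (simp flip: hpart_mult)
    moreover have "cls R (c - hpart n (p * q)) \<in> gcos R n 0"
      using c by (simp add: cls_in_gcos)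
    moreover have "\<forall>i. cls R (hpart i p) \<in> gproj R p i" "\<forall>i. cls R (hpart i q) \<in> gproj R q i"
      by (simp_all add: gproj_def cls_in_gcos)
    ultimately show "z \<in> {r \<oplus>\<^bsub>presented R\<^esub> finsum (presented R) (\<lambda>i. x i \<otimes>\<^bsub>presented R\<^esub> y (n - i)) {..n} | x y r.
               (\<forall>i. x i \<in> gproj R p i) \<and> (\<forall>i. y i \<in> gproj R q i) \<and> r \<in> gcos R n 0}"
      by (intro CollectI exI[of _ "\<lambda>i. cls R (hpart i p)"] exI[of _ "\<lambda>i. cls R (hpart i q)"]
          exI[of _ "cls R (c - hpart n (p * q))"] conjI)
  qed
  finally show "(gproj R p \<otimes>\<^bsub>grp R\<^esub> gproj R q) n = gproj R (p * q) n"
    by (simp add: gproj_def)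
qed

text \<open>Each component of an element of the graded algebra is the class of a homogeneous polynomial, namely of the
  leading part of a representative, and the sum of these finitely many polynomials is a preimage.\<close>

lemma carrier_gr: "carrier (grp R) = range (gproj R)"
proof (intro equalityI subsetI)
  fix u assume "u \<in> carrier (grp R)"
  then have u: "\<forall>n. \<exists>a \<in> cfilt R n. u n = prev (presented R) (cfilt R) n +>\<^bsub>presented R\<^esub> a"
    and fin: "finite {n. u n \<noteq> gcos R n 0}"
    by (simp_all add: gr_def prev_eq_gcos)
  have "\<exists>p. p \<in> filt_lt (Suc n) \<and> u n = gcos R n p" for n
  proof -
    obtain a where a: "a \<in> cfilt R n" "u n = prev (presented R) (cfilt R) n +>\<^bsub>presented R\<^esub> a"
      using u by blast
    then obtain p where "p \<in> filt_lt (Suc n)" "a = cls R p"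
      by (auto simp: cfilt_def)
    with a show ?thesis
      by (auto simp: prev_coset)
  qed
  then obtain p where p: "\<And>n. p n \<in> filt_lt (Suc n)" "\<And>n. u n = gcos R n (p n)"
    by metis
  define N where "N = {n. u n \<noteq> gcos R n 0}"
  have "u n = gproj R (\<Sum>m\<in>N. hpart m (p m)) n" for n
  proof -
    have *: "hpart n (\<Sum>m\<in>N. hpart m (p m)) = (if n \<in> N then hpart n (p n) else 0)"
      using fin by (simp add: hpart_sum hpart_hpart N_def sum.delta' cong: if_cong)
    have "gcos R n (p n) = gcos R n (hpart n (p n))"
      using diff_hpart_in_filt[OF p(1)] by (simp add: gcos_eq_iff filt_lt_in_low)
    then show ?thesis
      using p(2)[of n] unfolding gproj_def * by (auto simp: N_def)
  qed
  then show "u \<in> range (gproj R)" by auto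
next
  fix u assume "u \<in> range (gproj R)"
  then obtain p where u: "u = gproj R p" by auto
  have "{n. gcos R n (hpart n p) \<noteq> gcos R n 0} \<subseteq> V_degree ` Poly_Mapping.keys p"
  proof
    fix n assume "n \<in> {n. gcos R n (hpart n p) \<noteq> gcos R n 0}"
    then have "hpart n p \<noteq> 0" by auto
    then show "n \<in> V_degree ` Poly_Mapping.keys p"
      unfolding poly_mapping_eq_iff fun_eq_iff
      by (auto simp: lookup_hpart in_keys_iff split: if_splits)
  qed
  then have fin: "finite {n. gcos R n (hpart n p) \<noteq> gcos R n 0}"
    by (rule finite_subset) simp
  show "u \<in> carrier (grp R)"
  proof -
    have "\<exists>a \<in> cfilt R n. gcos R n (hpart n p) = prev (presented R) (cfilt R) n +>\<^bsub>presented R\<^esub> a" for n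
      by (rule bexI[of _ "cls R (hpart n p)"]) (simp_all add: prev_coset cfilt_def hpart_in_filt)
    with fin show ?thesis
      by (simp add: u gr_def gproj_def) (simp add: prev_eq_gcos)
  qed
qed

lemma abelian_monoid_gr: "abelian_monoid (grp R)"
  by (rule abelian_monoidI) (auto simp: carrier_gr gproj_add gproj_zero add_ac)

lemma finsum_gproj: "finsum (grp R) (\<lambda>i. gproj R (f i)) A = gproj R (sum f A)"
proof -
  interpret abelian_monoid "grp R" by (rule abelian_monoid_gr)
  show ?thesis
    by (induction A rule: infinite_finite_induct)
      (auto simp: gproj_zero carrier_gr gproj_add)
qed

lemma gr_class_gproj:
  assumes "hpart n p = p"
  shows "gr_class (presented R) (cfilt R) n (cls R p) = gproj R p"
proof -
  have "hpart m p = (if m = n then p else 0)" for m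
    using hpart_hpart[of m n p] assms by auto
  then show ?thesis
    by (simp add: gr_class_def gproj_def fun_eq_iff prev_coset) (simp add: prev_eq_gcos)
qed

lemma word_eval_gr:
  "word_eval (grp R) (\<lambda>r. gr_class (presented R) (cfilt R) 0 (scal R r))
     (\<lambda>b. gr_class (presented R) (cfilt R) (if isl b then 0 else 1) (cls R (gen b))) p = gproj R p"
proof -
  have s: "gr_class (presented R) (cfilt R) 0 (scal R r) = gproj R (Poly_Mapping.single 0 r)" for r
    unfolding scal_def by (rule gr_class_gproj) (simp add: hpart_single)
  have g: "gr_class (presented R) (cfilt R) (if isl b then 0 else 1) (cls R (gen b)) = gproj R (gen b)" for b
    by (rule gr_class_gproj) (simp add: hpart_gen)
  have "foldr (\<lambda>b a. gproj R (gen b) \<otimes>\<^bsub>grp R\<^esub> a) bs \<one>\<^bsub>grp R\<^esub> = gproj R (Poly_Mapping.single (Word bs) 1)" for bs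
    by (induction bs) (simp_all add: gproj_one gproj_mult gen_times_single flip: word_zero)
  then have "gproj R (Poly_Mapping.single 0 r) \<otimes>\<^bsub>grp R\<^esub> foldr (\<lambda>b a. gproj R (gen b) \<otimes>\<^bsub>grp R\<^esub> a) (letters w) \<one>\<^bsub>grp R\<^esub> = gproj R (Poly_Mapping.single w r)" for r w
    by (simp add: gproj_mult mult_single)
  then show ?thesis
    unfolding word_eval_def s g by (simp add: finsum_gproj flip: poly_mapping_sum)
qed

section \<open>The defining relations on basis elements\<close>

lemma push_single [simp]: "push f (Poly_Mapping.single a r) = Poly_Mapping.single (f a) r"
  by (simp add: push_def)

lemma push_add: "push f (p + q) = push f p + push f q"
  unfolding push_def by (rule setsum_keys_plus_distrib) (simp_all add: single_add)

lemma push_zero [simp]: "push f 0 = 0"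
  by (simp add: push_def)

lemma push_uminus: "push f (- p) = - push f p"
  using push_add[of f p "- p"] by (simp add: eq_neg_iff_add_eq_0 add.commute)

lemma push_diff: "push f (p - q) = push f p - push f q"
  using push_add[of f p "- q"] by (simp add: push_uminus)

lemma push_sum: "push f (sum g A) = (\<Sum>i\<in>A. push f (g i))"
  by (induction A rule: infinite_finite_induct) (simp_all add: push_add)

lemma lookup_scale [simp]: "Poly_Mapping.lookup (scale r p) a = r * Poly_Mapping.lookup p a"
  by (simp add: scale_def map.rep_eq when_def)

lemma scale_add: "scale r (p + q) = scale r p + scale r q"
  by (rule poly_mapping_eqI) (simp add: lookup_add algebra_simps)

lemma scale_single: "scale r (Poly_Mapping.single a s) = Poly_Mapping.single a (r * s)"
  by (rule poly_mapping_eqI) (simp add: lookup_single when_def)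

lemma scale_one [simp]: "scale 1 p = p"
  by (rule poly_mapping_eqI) simp

lemma vec_single: "vec (Poly_Mapping.single b r) = Poly_Mapping.single 0 r * gen b"
  by (simp add: vec_def gen_def mult_single)

lemma vec_basis [simp]: "vec (Poly_Mapping.single b 1) = gen b"
  by (simp add: vec_single)

lemma vec_add: "vec (p + q) = vec p + vec q"
  by (simp add: vec_def push_add)

lemma vec_zero [simp]: "vec 0 = 0"
  by (simp add: vec_def)

lemma vec_uminus: "vec (- p) = - vec p"
  by (simp add: vec_def push_uminus)

lemma vec_sum: "vec (sum g A) = (\<Sum>i\<in>A. vec (g i))"
  by (induction A rule: infinite_finite_induct) (simp_all add: vec_add)

lemma vec_scale: "vec (scale r p) = Poly_Mapping.single 0 r * vec p"
  by (induction p rule: poly_mapping_additive_induct)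
    (simp_all add: scale_single scale_add vec_add vec_single mult_single algebra_simps flip: mult.assoc)

lemma bilin_single [simp]:
  fixes B :: "'a \<Rightarrow> 'b \<Rightarrow> ('c \<Rightarrow>\<^sub>0 'k::{comm_ring_1,zero_neq_one})"
  shows "bilin B (Poly_Mapping.single a 1) (Poly_Mapping.single b 1) = B a b"
  by (simp add: bilin_def)

text \<open>All terms are bilinear in \<open>x\<close> and \<open>y\<close>, so that the relations for arbitrary vectors follow from those for
  basis vectors.\<close>

lemma bracket_relation_expand:
  fixes x :: "'a \<Rightarrow>\<^sub>0 'k::comm_ring_1" and y :: "'b \<Rightarrow>\<^sub>0 'k" and f :: "'a \<Rightarrow> 'c" and g :: "'b \<Rightarrow> 'c"
    and br :: "'a \<Rightarrow> 'b \<Rightarrow> ('d \<Rightarrow>\<^sub>0 'k)" and i :: "'d \<Rightarrow> 'c"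
  shows "vec (push f x) * vec (push g y) - vec (push g y) * vec (push f x) - vec (push i (bilin br x y)) =
    (\<Sum>a\<in>Poly_Mapping.keys x. \<Sum>b\<in>Poly_Mapping.keys y.
       Poly_Mapping.single 0 (Poly_Mapping.lookup x a * Poly_Mapping.lookup y b) *
       (gen (f a) * gen (g b) - gen (g b) * gen (f a) - vec (push i (br a b))))"
proof -
  have push_scale: "push i (scale r p) = scale r (push i p)" for r and p :: "'d \<Rightarrow>\<^sub>0 'k"
    by (induction p rule: poly_mapping_additive_induct) (simp_all add: scale_single scale_add push_add)
  have vp: "vec (push h z) = (\<Sum>b\<in>Poly_Mapping.keys z. Poly_Mapping.single 0 (Poly_Mapping.lookup z b) * gen (h b))"
    for h :: "'e \<Rightarrow> 'c" and z :: "'e \<Rightarrow>\<^sub>0 'k"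
    by (simp add: push_def vec_sum vec_single)
  have swap: "(Poly_Mapping.single 0 r * p) * (Poly_Mapping.single 0 s * q) = Poly_Mapping.single 0 (r * s) * (p * q)"
    for r s and p q :: "'c word \<Rightarrow>\<^sub>0 'k"
  proof -
    have "(Poly_Mapping.single 0 r * p) * (Poly_Mapping.single 0 s * q) = Poly_Mapping.single 0 r * (p * Poly_Mapping.single 0 s) * q"
      by (simp only: mult.assoc)
    also have "\<dots> = (Poly_Mapping.single 0 r * Poly_Mapping.single 0 s) * (p * q)"
      by (simp only: mult.assoc scalar_commute[of s p, symmetric])
    finally show ?thesis by (simp add: mult_single)
  qed
  have A: "vec (push f x) * vec (push g y) = (\<Sum>a\<in>Poly_Mapping.keys x. \<Sum>b\<in>Poly_Mapping.keys y.
       Poly_Mapping.single 0 (Poly_Mapping.lookup x a * Poly_Mapping.lookup y b) * (gen (f a) * gen (g b)))"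
    unfolding vp sum_product swap ..
  have B: "vec (push g y) * vec (push f x) = (\<Sum>a\<in>Poly_Mapping.keys x. \<Sum>b\<in>Poly_Mapping.keys y.
       Poly_Mapping.single 0 (Poly_Mapping.lookup x a * Poly_Mapping.lookup y b) * (gen (g b) * gen (f a)))"
    unfolding vp sum_product swap by (subst sum.swap) (simp only: mult.commute[of "Poly_Mapping.lookup y _"])
  have C: "vec (push i (bilin br x y)) = (\<Sum>a\<in>Poly_Mapping.keys x. \<Sum>b\<in>Poly_Mapping.keys y.
       Poly_Mapping.single 0 (Poly_Mapping.lookup x a * Poly_Mapping.lookup y b) * vec (push i (br a b)))"
    unfolding bilin_def push_sum vec_sum push_scale vec_scale ..
  show ?thesis
    unfolding A B C by (simp only: right_diff_distrib sum_subtractf)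
qed

lemma push_id: "push (\<lambda>x. x) p = p"
  unfolding push_def by (rule poly_mapping_sum[symmetric])

lemma env_relation_expand:
  "vec x * vec y - vec y * vec x - vec (bilin br x y) =
    (\<Sum>a\<in>Poly_Mapping.keys x. \<Sum>b\<in>Poly_Mapping.keys y.
       Poly_Mapping.single 0 (Poly_Mapping.lookup x a * Poly_Mapping.lookup y b) *
       (gen a * gen b - gen b * gen a - vec (br a b)))"
  using bracket_relation_expand[of "\<lambda>x. x" x "\<lambda>x. x" y "\<lambda>x. x" br] by (simp add: push_id)

lemma two_sided_sum: "two_sided J \<Longrightarrow> (\<And>i. i \<in> A \<Longrightarrow> f i \<in> J) \<Longrightarrow> sum f A \<in> J"
  by (induction A rule: infinite_finite_induct) (auto simp: two_sided_def)

lemma env_rels_subset: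
  assumes "two_sided J" "\<And>a b. gen a * gen b - gen b * gen a - vec (br a b) \<in> J"
  shows "env_rels br \<subseteq> J"
  unfolding env_rels_def
proof clarify
  fix x y
  show "vec x * vec y - vec y * vec x - vec (bilin br x y) \<in> J"
    unfolding env_relation_expand
    by (intro two_sided_sum assms(1)) (use assms in \<open>auto simp: two_sided_def\<close>)
qed

lemma smash_rels_subset:
  assumes J: "two_sided J"
    and g: "\<And>a b. gen (Inl a) * gen (Inl b) - gen (Inl b) * gen (Inl a) - vec (push Inl (gl2_br a b)) \<in> J"
    and V: "\<And>a v. gen (Inl a) * gen (Inr v) - gen (Inr v) * gen (Inl a) - vec (push Inr (gl2_act a v)) \<in> J"
  shows "smash_rels \<subseteq> J"
proof -
  have "vec_g a * vec_g a' - vec_g a' * vec_g a - vec_g (bilin gl2_br a a') \<in> J" for a a'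
    unfolding vec_g_def bracket_relation_expand
    by (intro two_sided_sum J) (use J g in \<open>auto simp: two_sided_def\<close>)
  moreover have "vec_g a * vec_V v - vec_V v * vec_g a - vec_V (bilin gl2_act a v) \<in> J" for a v
    unfolding vec_g_def vec_V_def bracket_relation_expand
    by (intro two_sided_sum J) (use J V in \<open>auto simp: two_sided_def\<close>)
  ultimately show ?thesis
    by (auto simp: smash_rels_def)
qed

lemma env_basis_relation: "gen a * gen b - gen b * gen a - vec (br a b) \<in> idl (env_rels br)"
proof (rule idl_base)
  have "vec (Poly_Mapping.single a 1) * vec (Poly_Mapping.single b 1) - vec (Poly_Mapping.single b 1) * vec (Poly_Mapping.single a 1)
      - vec (bilin br (Poly_Mapping.single a 1) (Poly_Mapping.single b 1)) \<in> env_rels br"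
    unfolding env_rels_def by blast
  then show "gen a * gen b - gen b * gen a - vec (br a b) \<in> env_rels br"
    by (simp only: vec_basis bilin_single)
qed

lemma smash_basis_relation:
  "gen (Inl a) * gen (Inl b) - gen (Inl b) * gen (Inl a) - vec (push Inl (gl2_br a b)) \<in> idl (smash_rels :: (_ \<Rightarrow>\<^sub>0 'k::comm_ring_1) set)"
  "gen (Inl a) * gen (Inr v) - gen (Inr v) * gen (Inl a) - vec (push Inr (gl2_act a v)) \<in> idl (smash_rels :: (_ \<Rightarrow>\<^sub>0 'k::comm_ring_1) set)"
proof -
  have "vec_g (Poly_Mapping.single a 1) * vec_g (Poly_Mapping.single b 1) - vec_g (Poly_Mapping.single b 1) * vec_g (Poly_Mapping.single a 1)
      - vec_g (bilin gl2_br (Poly_Mapping.single a 1) (Poly_Mapping.single b 1)) \<in> (smash_rels :: (_ \<Rightarrow>\<^sub>0 'k) set)"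
    unfolding smash_rels_def by blast
  then show "gen (Inl a) * gen (Inl b) - gen (Inl b) * gen (Inl a) - vec (push Inl (gl2_br a b)) \<in> idl (smash_rels :: (_ \<Rightarrow>\<^sub>0 'k) set)"
    by (intro idl_base) (simp only: vec_g_def vec_basis bilin_single push_single)
  have "vec_g (Poly_Mapping.single a 1) * vec_V (Poly_Mapping.single v 1) - vec_V (Poly_Mapping.single v 1) * vec_g (Poly_Mapping.single a 1)
      - vec_V (bilin gl2_act (Poly_Mapping.single a 1) (Poly_Mapping.single v 1)) \<in> (smash_rels :: (_ \<Rightarrow>\<^sub>0 'k) set)"
    unfolding smash_rels_def by blast
  then show "gen (Inl a) * gen (Inr v) - gen (Inr v) * gen (Inl a) - vec (push Inr (gl2_act a v)) \<in> idl (smash_rels :: (_ \<Rightarrow>\<^sub>0 'k) set)"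
    by (intro idl_base) (simp only: vec_g_def vec_V_def vec_basis bilin_single push_single)
qed

lemma idl_smash_subset_idl_H: "idl smash_rels \<subseteq> idl (H_rels \<gamma>)"
  by (rule idl_mono) (simp add: H_rels_def)

lemma H_basis_relation:
  assumes "p \<in> \<gamma> (Poly_Mapping.single v 1) (Poly_Mapping.single w 1)"
  shows "gen (Inr v) * gen (Inr w) - gen (Inr w) * gen (Inr v) - incl p \<in> idl (H_rels \<gamma>)"
proof (rule idl_base)
  let ?s = "\<lambda>a. Poly_Mapping.single a 1"
  have "vec_V (?s v) * vec_V (?s w) - vec_V (?s w) * vec_V (?s v) - incl p \<in> H_rels \<gamma>"
    unfolding H_rels_def using assms by blast
  then show "gen (Inr v) * gen (Inr w) - gen (Inr w) * gen (Inr v) - incl p \<in> H_rels \<gamma>"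
    by (simp only: vec_V_def vec_basis push_single)
qed

lemma idl_smash_subset_idl_UV: "idl smash_rels \<subseteq> idl UV_rels"
proof (intro idl_least smash_rels_subset two_sided_idl)
  fix a b v
  show "gen (Inl a) * gen (Inl b) - gen (Inl b) * gen (Inl a) - vec (push Inl (gl2_br a b)) \<in> idl UV_rels"
    using env_basis_relation[of "Inl a" "Inl b" "semidirect gl2_br gl2_act"] by (simp add: UV_rels_def)
  show "gen (Inl a) * gen (Inr v) - gen (Inr v) * gen (Inl a) - vec (push Inr (gl2_act a v)) \<in> idl UV_rels"
    using env_basis_relation[of "Inl a" "Inr v" "semidirect gl2_br gl2_act"] by (simp add: UV_rels_def)
qed

lemma UV_rels_commute: "gen (Inr v) * gen (Inr w) - gen (Inr w) * gen (Inr v) \<in> idl UV_rels"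
  using env_basis_relation[of "Inr v" "Inr w" "semidirect gl2_br gl2_act"] by (simp add: UV_rels_def)

lemma idl_UV_subset:
  assumes "two_sided J" "idl smash_rels \<subseteq> J"
    and V: "\<And>v w. gen (Inr v) * gen (Inr w) - gen (Inr w) * gen (Inr v) \<in> J"
  shows "idl UV_rels \<subseteq> J"
  unfolding UV_rels_def
proof (intro idl_least env_rels_subset assms(1))
  fix a b :: "gl2 + vb"
  have neg: "- p \<in> J" if "p \<in> J" for p
    using assms(1) that by (metis two_sided_def mult_minus1)
  note smash = smash_basis_relation[THEN subsetD[OF assms(2)]]
  show "gen a * gen b - gen b * gen a - vec (semidirect gl2_br gl2_act a b) \<in> J"
  proof (cases a; cases b)
    fix v c assume ab: "a = Inr v" "b = Inl c"
    then show ?thesis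
      using neg[of "gen (Inl c) * gen (Inr v) - gen (Inr v) * gen (Inl c) - vec (push Inr (gl2_act c v))"]
        smash(2)[of c v] by (auto simp: vec_uminus algebra_simps)
  qed (use smash V in auto)
qed

subsection \<open>The embedding of the enveloping algebra of \<open>gl\<^sub>2\<close>\<close>

lemma incl_single: "incl (Poly_Mapping.single w r) = Poly_Mapping.single (map_word Inl w) r"
  by (simp add: incl_def)

lemma incl_zero [simp]: "incl 0 = 0"
  by (simp add: incl_def)

lemma incl_add: "incl (p + q) = incl p + incl q"
  by (simp add: incl_def push_add)

lemma incl_uminus: "incl (- p) = - incl p"
  by (simp add: incl_def push_uminus)

lemma incl_diff: "incl (p - q) = incl p - incl q"
  by (simp add: incl_def push_diff)

lemma map_word_add: "map_word f (u + v) = map_word f u + map_word f v"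
  by (cases u; cases v) (simp add: plus_word_def)

lemma incl_mult: "incl (p * q) = incl p * incl q"
proof (induction p rule: poly_mapping_additive_induct)
  case (single u r)
  show ?case
    by (induction q rule: poly_mapping_additive_induct)
      (simp_all add: incl_single mult_single map_word_add incl_add distrib_left)
qed (simp add: incl_add distrib_right)

lemma incl_scalar: "incl (Poly_Mapping.single 0 r) = Poly_Mapping.single 0 r"
  by (simp add: incl_single word_zero)

lemma incl_gen: "incl (gen a) = gen (Inl a)"
  by (simp add: gen_def incl_single)

lemma hpart_incl: "hpart n (incl p :: (gl2 + vb) word \<Rightarrow>\<^sub>0 'k::comm_ring_1) = (if n = 0 then incl p else 0)"
proof (induction p rule: poly_mapping_additive_induct)
  case (single w r)
  have "V_degree (map_word Inl w :: (gl2 + vb) word) = 0"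
    by (cases w) (simp add: V_degree_def filter_map comp_def)
  then show ?case by (auto simp add: incl_single hpart_single)
qed (simp add: incl_add hpart_add)

lemma incl_vec: "incl (vec x) = vec (push Inl x)"
  by (induction x rule: poly_mapping_additive_induct)
    (simp_all add: incl_add push_add vec_add vec_single incl_mult incl_scalar incl_gen)

lemma incl_idl_U: "p \<in> idl U_rels \<Longrightarrow> incl p \<in> idl smash_rels"
proof -
  have "idl U_rels \<subseteq> {p. incl p \<in> idl smash_rels}"
    unfolding U_rels_def
  proof (intro idl_least env_rels_subset)
    show "two_sided {p. incl p \<in> idl smash_rels}"
      by (rule two_sidedI) (auto simp: incl_add incl_mult idl_add idl_lmult idl_rmult)
    then show "two_sided {p. incl p \<in> idl smash_rels}" .
  next
    fix a b :: gl2
    show "gen a * gen b - gen b * gen a - vec (gl2_br a b) \<in> {p. incl p \<in> idl smash_rels}"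
      using smash_basis_relation(1)[of a b] by (simp add: incl_diff incl_mult incl_gen incl_vec)
  qed
  then show "p \<in> idl U_rels \<Longrightarrow> incl p \<in> idl smash_rels" by auto
qed

section \<open>Transfer between \<open>H\<^sub>c\<close> and its associated graded algebra\<close>

lemma pairing_representative:
  assumes "invariant_pairing \<gamma>"
  obtains p where "p \<in> \<gamma> v w"
proof -
  have "\<forall>v w. \<gamma> v w \<in> carrier U_gl2"
    using assms unfolding invariant_pairing_def by (rule conjunct1)
  then have "\<gamma> v w \<in> range (cls U_rels)"
    by (simp add: U_gl2_def carrier_presented)
  then show ?thesis
    using that self_in_cls by blast
qed

lemma homogeneous_low:
  assumes "hpart n p = p" "p \<in> low R n"
  shows "hpart m p \<in> low R m"
  using hpart_hpart[of m n p] assms by (cases "m = n") auto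

text \<open>The relations of \<open>gl\<^sub>2 \<ltimes> V\<close> are homogeneous. Those that involve \<open>gl\<^sub>2\<close> are relations of \<open>H\<^sub>c\<close> as well, and a
  commutator of two elements of \<open>V\<close> is in \<open>H\<^sub>c\<close> equal to a value of \<open>\<gamma>\<close>, which has degree \<open>0 < 2\<close>.\<close>

lemma idl_UV_imp_low:
  fixes \<gamma> :: "(vb \<Rightarrow>\<^sub>0 'k) \<Rightarrow> (vb \<Rightarrow>\<^sub>0 'k) \<Rightarrow> (gl2 word \<Rightarrow>\<^sub>0 'k::field_char_0) set"
  assumes "invariant_pairing \<gamma>" "p \<in> idl UV_rels"
  shows "hpart n p \<in> low (H_rels \<gamma>) n"
proof -
  let ?J = "{p. \<forall>n. hpart n p \<in> low (H_rels \<gamma>) n}"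
  have J: "two_sided ?J"
  proof (rule two_sidedI)
    fix p q assume p: "p \<in> ?J"
    have "hpart i q * hpart (n - i) p \<in> low (H_rels \<gamma>) n" if "i \<le> n" for i n
      using low_mult(2)[of "hpart (n - i) p" "H_rels \<gamma>" "n - i" "hpart i q" i] p that hpart_in_filt[of i q] by simp
    then show "q * p \<in> ?J"
      by (auto simp: hpart_mult intro!: low_sum)
    have "hpart i p * hpart (n - i) q \<in> low (H_rels \<gamma>) n" if "i \<le> n" for i n
      using low_mult(1)[of "hpart i p" "H_rels \<gamma>" "i" "hpart (n - i) q" "n - i"] p that hpart_in_filt[of "n - i" q] by simp
    then show "p * q \<in> ?J"
      by (auto simp: hpart_mult intro!: low_sum)
  qed (auto simp: hpart_add low_add)
  have hom: "hpart n (gen a * gen b) = (if n = (if isl a then 0 else 1) + (if isl b then 0 else 1) then gen a * gen b else (0 :: _ \<Rightarrow>\<^sub>0 'k))"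
    for n and a b :: "gl2 + vb"
    unfolding gen_def mult_single hpart_single by (auto simp: V_degree_def plus_word_def)
  have homv: "hpart n (vec (push f x)) = (if n = i then vec (push f x) else (0 :: _ \<Rightarrow>\<^sub>0 'k))"
    if "\<And>a. (if isl (f a) then 0 else 1) = i" for n i x and f :: "'e \<Rightarrow> gl2 + vb"
  proof (induction x rule: poly_mapping_additive_induct)
    case (single w r)
    show ?case
      using that[of w] unfolding push_single vec_def hpart_single by (auto simp: V_degree_def)
  qed (simp add: push_add vec_add hpart_add)
  have "idl smash_rels \<subseteq> ?J"
  proof (rule idl_least[OF smash_rels_subset[OF J] J])
    fix a b v
    let ?p = "gen (Inl a) * gen (Inl b) - gen (Inl b) * gen (Inl a) - vec (push Inl (gl2_br a b)) :: (gl2 + vb) word \<Rightarrow>\<^sub>0 'k"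
    have "hpart 0 ?p = ?p"
      by (simp add: hpart_diff hom homv[of Inl 0])
    moreover have "?p \<in> low (H_rels \<gamma>) 0"
      by (rule idl_in_low[OF subsetD[OF idl_smash_subset_idl_H smash_basis_relation(1)]])
    ultimately show "?p \<in> ?J"
      using homogeneous_low by blast
    let ?q = "gen (Inl a) * gen (Inr v) - gen (Inr v) * gen (Inl a) - vec (push Inr (gl2_act a v)) :: (gl2 + vb) word \<Rightarrow>\<^sub>0 'k"
    have "hpart 1 ?q = ?q"
      by (simp add: hpart_diff hom homv[of Inr 1])
    moreover have "?q \<in> low (H_rels \<gamma>) 1"
      by (rule idl_in_low[OF subsetD[OF idl_smash_subset_idl_H smash_basis_relation(2)]])
    ultimately show "?q \<in> ?J"
      using homogeneous_low by blast
  qed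
  then have "idl UV_rels \<subseteq> ?J"
  proof (rule idl_UV_subset[OF J])
    fix v w :: vb
    let ?p = "gen (Inr v) * gen (Inr w) - gen (Inr w) * gen (Inr v) :: (gl2 + vb) word \<Rightarrow>\<^sub>0 'k"
    obtain g where g: "g \<in> \<gamma> (Poly_Mapping.single v 1) (Poly_Mapping.single w 1)"
      using pairing_representative[OF assms(1)] by blast
    have "incl g = hpart 0 (incl g)" by (simp add: hpart_incl)
    then have "incl g \<in> filt_lt 2"
      by (metis filt_lt_mono hpart_in_filt one_le_numeral One_nat_def)
    moreover have "?p - incl g \<in> idl (H_rels \<gamma>)"
      by (rule H_basis_relation[where \<gamma> = \<gamma>, OF g])
    ultimately have "?p \<in> low (H_rels \<gamma>) 2"
      by (rule lowI)
    moreover have "hpart 2 ?p = ?p"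
      by (simp add: hpart_diff hom)
    ultimately show "?p \<in> ?J"
      using homogeneous_low by blast
  qed
  then show ?thesis using assms(2) by blast
qed

lemma natural_map_cls:
  assumes "invariant_pairing \<gamma>"
  shows "natural_map \<gamma> (cls UV_rels p) = gproj (H_rels \<gamma>) p"
proof -
  have "gproj (H_rels \<gamma>) q = gproj (H_rels \<gamma>) p" if "q \<in> cls UV_rels p" for q
    using that idl_UV_imp_low[OF assms] by (simp add: gproj_eq_iff cls_alt)
  then have "gproj (H_rels \<gamma>) ` cls UV_rels p = {gproj (H_rels \<gamma>) p}"
    using self_in_cls[of p UV_rels] by blast
  then show ?thesis
    by (simp add: natural_map_def H_filt_eq_cfilt H_alg_def word_eval_gr)
qed

text \<open>The direction from right to left is the injectivity of the natural map.\<close>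

lemma idl_UV_iff_low:
  assumes "infinitesimal_cherednik \<gamma>"
  shows "p \<in> idl UV_rels \<longleftrightarrow> (\<forall>n. hpart n p \<in> low (H_rels \<gamma>) n)"
proof
  assume "\<forall>n. hpart n p \<in> low (H_rels \<gamma>) n"
  then have "gproj (H_rels \<gamma>) p = gproj (H_rels \<gamma>) 0"
    by (simp add: gproj_eq_iff)
  then have "natural_map \<gamma> (cls UV_rels p) = natural_map \<gamma> (cls UV_rels 0)"
    using assms by (simp add: natural_map_cls infinitesimal_cherednik_def)
  moreover have "inj_on (natural_map \<gamma>) (carrier U_gl2_V)"
    using assms by (simp add: infinitesimal_cherednik_def ring_iso_def bij_betw_def)
  ultimately have "cls UV_rels p = cls UV_rels 0"
    by (auto simp: U_gl2_V_def carrier_presented dest!: inj_onD)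
  then show "p \<in> idl UV_rels" by (simp add: cls_eq_iff)
qed (use idl_UV_imp_low assms in \<open>auto simp: infinitesimal_cherednik_def\<close>)

text \<open>The form in which relations are transferred: a homogeneous relation holds in the enveloping algebra as soon as it
  holds in \<open>H\<^sub>c\<close> up to terms of lower degree.\<close>

lemma homogeneous_idl_UV_iff:
  assumes "infinitesimal_cherednik \<gamma>" "hpart n p = p"
  shows "p \<in> idl UV_rels \<longleftrightarrow> p \<in> low (H_rels \<gamma>) n"
  using idl_UV_iff_low[OF assms(1), of p] homogeneous_low[OF assms(2)] assms(2) by metis

section \<open>A faithful representation of the enveloping algebra of \<open>gl\<^sub>2 \<ltimes> V\<close>\<close>

lemmas fun_arith = plus_fun_apply zero_fun_apply minus_apply uminus_apply

declare plus_fun_apply [simp del] zero_fun_apply [simp del] minus_apply [simp del] uminus_apply [simp del]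

text \<open>A state is an infinite sum of normal forms
  \<open>f\<^sup>a p(\<alpha>, \<beta>) x\<^sup>i y\<^sup>j x\<^sub>1\<^sup>k y\<^sub>1\<^sup>l e\<^sup>b\<close> with \<open>\<alpha> = (h + t) / 2\<close> and \<open>\<beta> = (t - h) / 2\<close>, given by the
  coefficients \<open>p(\<alpha>, \<beta>)\<close> as a function of \<open>a\<close>, \<open>b\<close>, \<open>i\<close>, \<open>j\<close>, \<open>k\<close>, \<open>l\<close>, \<open>\<alpha>\<close> and \<open>\<beta>\<close>. With arbitrary functions as
  coefficients no finiteness or polynomiality has to be carried along. The variables \<open>\<alpha>\<close> and \<open>\<beta>\<close> are chosen
  because moving a generator past \<open>p\<close> only shifts them by integers.\<close>

type_synonym 'k state = "nat \<Rightarrow> nat \<Rightarrow> nat \<Rightarrow> nat \<Rightarrow> nat \<Rightarrow> nat \<Rightarrow> 'k \<Rightarrow> 'k \<Rightarrow> 'k"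

text \<open>Left multiplication by a generator, computed on normal forms.\<close>

fun lop :: "gl2 + vb \<Rightarrow> 'k::field_char_0 state \<Rightarrow> 'k state"
  where
    "lop (Inl Gf) \<psi> = (\<lambda>a b i j k l \<alpha> \<beta>. if a = 0 then 0 else \<psi> (a - 1) b i j k l \<alpha> \<beta>)"
  | "lop (Inl Gh) \<psi> = (\<lambda>a b i j k l \<alpha> \<beta>. (\<alpha> - \<beta> - 2 * of_nat a) * \<psi> a b i j k l \<alpha> \<beta>)"
  | "lop (Inl Gt) \<psi> = (\<lambda>a b i j k l \<alpha> \<beta>. (\<alpha> + \<beta>) * \<psi> a b i j k l \<alpha> \<beta>)"
  | "lop (Inl Ge) \<psi> = (\<lambda>a b i j k l \<alpha> \<beta>.
        (if b = 0 then 0 else \<psi> a (b - 1) i j k l (\<alpha> - 1) (\<beta> + 1))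
      + (if i = 0 then 0 else of_nat (Suc j) * \<psi> a b (i - 1) (Suc j) k l (\<alpha> - 1) (\<beta> + 1))
      + (if k = 0 then 0 else of_nat (Suc l) * \<psi> a b i j (k - 1) (Suc l) (\<alpha> - 1) (\<beta> + 1))
      + of_nat (Suc a) * (\<alpha> - \<beta> - of_nat a) * \<psi> (Suc a) b i j k l \<alpha> \<beta>)"
  | "lop (Inr Vx) \<psi> = (\<lambda>a b i j k l \<alpha> \<beta>.
        (if i = 0 then 0 else \<psi> a b (i - 1) j k l (\<alpha> - 1) \<beta>)
      - (if j = 0 then 0 else of_nat (Suc a) * \<psi> (Suc a) b i (j - 1) k l \<alpha> (\<beta> - 1)))"
  | "lop (Inr Vy) \<psi> = (\<lambda>a b i j k l \<alpha> \<beta>. if j = 0 then 0 else \<psi> a b i (j - 1) k l \<alpha> (\<beta> - 1))"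
  | "lop (Inr Vx1) \<psi> = (\<lambda>a b i j k l \<alpha> \<beta>.
        (if k = 0 then 0 else \<psi> a b i j (k - 1) l \<alpha> (\<beta> + 1))
      - (if l = 0 then 0 else of_nat (Suc a) * \<psi> (Suc a) b i j k (l - 1) (\<alpha> + 1) \<beta>))"
  | "lop (Inr Vy1) \<psi> = (\<lambda>a b i j k l \<alpha> \<beta>. if l = 0 then 0 else \<psi> a b i j k (l - 1) (\<alpha> + 1) \<beta>)"

text \<open>Right multiplication by a generator, computed on normal forms. For \<open>f\<close> the equation is the right one only for
  states without elements of \<open>V\<close>, which is where it is used.\<close>

fun rop :: "gl2 + vb \<Rightarrow> 'k::field_char_0 state \<Rightarrow> 'k state"
  where
    "rop (Inl Ge) \<psi> = (\<lambda>a b i j k l \<alpha> \<beta>. if b = 0 then 0 else \<psi> a (b - 1) i j k l \<alpha> \<beta>)"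
  | "rop (Inl Gh) \<psi> = (\<lambda>a b i j k l \<alpha> \<beta>.
        (\<alpha> - \<beta> - 2 * of_nat b - of_nat i + of_nat j - of_nat k + of_nat l) * \<psi> a b i j k l \<alpha> \<beta>)"
  | "rop (Inl Gt) \<psi> = (\<lambda>a b i j k l \<alpha> \<beta>.
        (\<alpha> + \<beta> - of_nat i - of_nat j + of_nat k + of_nat l) * \<psi> a b i j k l \<alpha> \<beta>)"
  | "rop (Inl Gf) \<psi> = (\<lambda>a b i j k l \<alpha> \<beta>. if i = 0 \<and> j = 0 \<and> k = 0 \<and> l = 0
        then (if a = 0 then 0 else \<psi> (a - 1) b 0 0 0 0 (\<alpha> - 1) (\<beta> + 1))
          + of_nat (Suc b) * (\<alpha> - \<beta> - of_nat b) * \<psi> a (Suc b) 0 0 0 0 \<alpha> \<beta>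
        else 0)"
  | "rop (Inr Vx) \<psi> = (\<lambda>a b i j k l \<alpha> \<beta>. if i = 0 then 0 else \<psi> a b (i - 1) j k l \<alpha> \<beta>)"
  | "rop (Inr Vy) \<psi> = (\<lambda>a b i j k l \<alpha> \<beta>. (if j = 0 then 0 else \<psi> a b i (j - 1) k l \<alpha> \<beta>)
      + (if i = 0 then 0 else of_nat (Suc b) * \<psi> a (Suc b) (i - 1) j k l \<alpha> \<beta>))"
  | "rop (Inr Vx1) \<psi> = (\<lambda>a b i j k l \<alpha> \<beta>. if k = 0 then 0 else \<psi> a b i j (k - 1) l \<alpha> \<beta>)"
  | "rop (Inr Vy1) \<psi> = (\<lambda>a b i j k l \<alpha> \<beta>. (if l = 0 then 0 else \<psi> a b i j k (l - 1) \<alpha> \<beta>)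
      + (if k = 0 then 0 else of_nat (Suc b) * \<psi> a (Suc b) i j (k - 1) l \<alpha> \<beta>))"

definition smul :: "'k::field_char_0 \<Rightarrow> 'k state \<Rightarrow> 'k state"
  where "smul r \<psi> = (\<lambda>a b i j k l \<alpha> \<beta>. r * \<psi> a b i j k l \<alpha> \<beta>)"

lemma lop_add: "lop b (\<phi> + \<psi>) = lop b \<phi> + lop b \<psi>"
  by (cases "(b, \<phi>)" rule: lop.cases) (auto simp: fun_eq_iff fun_arith algebra_simps)

lemma lop_smul: "lop b (smul r \<psi>) = smul r (lop b \<psi>)"
  by (cases "(b, \<psi>)" rule: lop.cases) (auto simp: fun_eq_iff fun_arith smul_def algebra_simps)

lemma lop_zero [simp]: "lop b 0 = 0"
  using lop_add[of b 0 0] by simp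

lemma smul_add: "smul r (\<phi> + \<psi>) = smul r \<phi> + smul r \<psi>"
  and smul_add_left: "smul (r + s) \<psi> = smul r \<psi> + smul s \<psi>"
  and smul_smul: "smul r (smul s \<psi>) = smul (r * s) \<psi>"
  and smul_one [simp]: "smul 1 \<psi> = \<psi>"
  and smul_zero [simp]: "smul 0 \<psi> = 0" "smul r 0 = 0"
  by (simp_all add: smul_def fun_eq_iff fun_arith algebra_simps)

text \<open>The linear extension of the action of words by left multiplications.\<close>

definition act :: "((gl2 + vb) word \<Rightarrow>\<^sub>0 'k::field_char_0) \<Rightarrow> 'k state \<Rightarrow> 'k state"
  where "act p \<psi> = (\<Sum>w\<in>Poly_Mapping.keys p. smul (Poly_Mapping.lookup p w) (foldr lop (letters w) \<psi>))"

lemma act_single: "act (Poly_Mapping.single w r) \<psi> = smul r (foldr lop (letters w) \<psi>)"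
  by (simp add: act_def)

lemma act_add: "act (p + q) \<psi> = act p \<psi> + act q \<psi>"
  unfolding act_def by (rule setsum_keys_plus_distrib) (simp_all add: smul_add_left)

lemma act_zero [simp]: "act 0 \<psi> = 0"
  by (simp add: act_def)

lemma act_uminus: "act (- p) \<psi> = - act p \<psi>"
  using act_add[of p "- p" \<psi>] by (simp add: eq_neg_iff_add_eq_0 add.commute)

lemma act_diff: "act (p - q) \<psi> = act p \<psi> - act q \<psi>"
  using act_add[of p "- q" \<psi>] by (simp add: act_uminus)

lemma act_scalar: "act (Poly_Mapping.single 0 r) \<psi> = smul r \<psi>"
  by (simp add: act_single word_zero)

lemma act_one [simp]: "act 1 \<psi> = \<psi>"
  using act_scalar[of 1 \<psi>] by simp

lemma act_gen_mult: "act (gen b * p) \<psi> = lop b (act p \<psi>)"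
proof (induction p rule: poly_mapping_additive_induct)
  case (single w r)
  show ?case by (cases w) (simp add: gen_times_single act_single lop_smul)
qed (simp add: distrib_left act_add lop_add)

lemma act_gen: "act (gen b) \<psi> = lop b \<psi>"
  using act_gen_mult[of b 1] by simp

lemma act_scalar_mult: "act (Poly_Mapping.single 0 r * p) \<psi> = smul r (act p \<psi>)"
  by (induction p rule: poly_mapping_additive_induct)
    (simp_all add: mult_single act_single distrib_left act_add smul_add smul_smul)

lemma act_mult: "act (p * q) \<psi> = act p (act q \<psi>)"
proof (induction p rule: free_algebra_induct)
  case (gen b p)
  then show ?case by (simp add: mult.assoc act_gen_mult)
qed (simp_all add: act_scalar_mult act_scalar distrib_right act_add)

lemma act_at_zero [simp]: "act p 0 = 0"
  by (induction p rule: free_algebra_induct) (simp_all add: act_scalar act_gen_mult act_add)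

lemma lop_relations:
  fixes \<psi> :: "'k::field_char_0 state"
  shows "lop (Inl Ge) (lop (Inl Gf) \<psi>) - lop (Inl Gf) (lop (Inl Ge) \<psi>) = lop (Inl Gh) \<psi>"
  and "lop (Inl Gh) (lop (Inl Ge) \<psi>) - lop (Inl Ge) (lop (Inl Gh) \<psi>) = smul 2 (lop (Inl Ge) \<psi>)"
  and "lop (Inl Gh) (lop (Inl Gf) \<psi>) - lop (Inl Gf) (lop (Inl Gh) \<psi>) = smul (-2) (lop (Inl Gf) \<psi>)"
  and "lop (Inl Gt) (lop (Inl a) \<psi>) = lop (Inl a) (lop (Inl Gt) \<psi>)"
  and "lop (Inl Ge) (lop (Inr Vx) \<psi>) = lop (Inr Vx) (lop (Inl Ge) \<psi>)"
  and "lop (Inl Ge) (lop (Inr Vx1) \<psi>) = lop (Inr Vx1) (lop (Inl Ge) \<psi>)"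
  and "lop (Inl Ge) (lop (Inr Vy) \<psi>) - lop (Inr Vy) (lop (Inl Ge) \<psi>) = lop (Inr Vx) \<psi>"
  and "lop (Inl Ge) (lop (Inr Vy1) \<psi>) - lop (Inr Vy1) (lop (Inl Ge) \<psi>) = lop (Inr Vx1) \<psi>"
  and "lop (Inl Gf) (lop (Inr Vx) \<psi>) - lop (Inr Vx) (lop (Inl Gf) \<psi>) = lop (Inr Vy) \<psi>"
  and "lop (Inl Gf) (lop (Inr Vx1) \<psi>) - lop (Inr Vx1) (lop (Inl Gf) \<psi>) = lop (Inr Vy1) \<psi>"
  and "lop (Inl Gf) (lop (Inr Vy) \<psi>) = lop (Inr Vy) (lop (Inl Gf) \<psi>)"
  and "lop (Inl Gf) (lop (Inr Vy1) \<psi>) = lop (Inr Vy1) (lop (Inl Gf) \<psi>)"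
  and "lop (Inl Gh) (lop (Inr Vx) \<psi>) - lop (Inr Vx) (lop (Inl Gh) \<psi>) = lop (Inr Vx) \<psi>"
  and "lop (Inl Gh) (lop (Inr Vx1) \<psi>) - lop (Inr Vx1) (lop (Inl Gh) \<psi>) = lop (Inr Vx1) \<psi>"
  and "lop (Inl Gh) (lop (Inr Vy) \<psi>) - lop (Inr Vy) (lop (Inl Gh) \<psi>) = smul (-1) (lop (Inr Vy) \<psi>)"
  and "lop (Inl Gh) (lop (Inr Vy1) \<psi>) - lop (Inr Vy1) (lop (Inl Gh) \<psi>) = smul (-1) (lop (Inr Vy1) \<psi>)"
  and "lop (Inl Gt) (lop (Inr Vx) \<psi>) - lop (Inr Vx) (lop (Inl Gt) \<psi>) = lop (Inr Vx) \<psi>"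
  and "lop (Inl Gt) (lop (Inr Vy) \<psi>) - lop (Inr Vy) (lop (Inl Gt) \<psi>) = lop (Inr Vy) \<psi>"
  and "lop (Inl Gt) (lop (Inr Vx1) \<psi>) - lop (Inr Vx1) (lop (Inl Gt) \<psi>) = smul (-1) (lop (Inr Vx1) \<psi>)"
  and "lop (Inl Gt) (lop (Inr Vy1) \<psi>) - lop (Inr Vy1) (lop (Inl Gt) \<psi>) = smul (-1) (lop (Inr Vy1) \<psi>)"
  apply (simp_all only: fun_eq_iff)
  subgoal by (auto simp: fun_arith smul_def algebra_simps of_nat_diff split: nat_diff_split)
  subgoal by (auto simp: fun_arith smul_def algebra_simps)
  subgoal by (auto simp: fun_arith smul_def algebra_simps of_nat_diff)
  subgoal by (cases a) (auto simp: fun_arith smul_def algebra_simps)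
  subgoal by (auto simp: fun_arith smul_def algebra_simps)
  subgoal by (auto simp: fun_arith smul_def algebra_simps)
  subgoal by (auto simp: fun_arith smul_def algebra_simps)
  subgoal by (auto simp: fun_arith smul_def algebra_simps)
  subgoal by (auto simp: fun_arith smul_def algebra_simps)
  subgoal by (auto simp: fun_arith smul_def algebra_simps)
  subgoal by (auto simp: fun_arith smul_def algebra_simps)
  subgoal by (auto simp: fun_arith smul_def algebra_simps)
  subgoal by (auto simp: fun_arith smul_def algebra_simps)
  subgoal by (auto simp: fun_arith smul_def algebra_simps)
  subgoal by (auto simp: fun_arith smul_def algebra_simps)
  subgoal by (auto simp: fun_arith smul_def algebra_simps)
  subgoal by (auto simp: fun_arith smul_def algebra_simps)
  subgoal by (auto simp: fun_arith smul_def algebra_simps)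
  subgoal by (auto simp: fun_arith smul_def algebra_simps)
  subgoal by (auto simp: fun_arith smul_def algebra_simps)
  done

lemma lop_V_commute:
  fixes \<psi> :: "'k::field_char_0 state"
  shows "lop (Inr v) (lop (Inr w) \<psi>) = lop (Inr w) (lop (Inr v) \<psi>)"
  by (cases v; cases w) (simp_all add: fun_eq_iff fun_arith smul_def algebra_simps)

lemma rop_lop_commute:
  fixes \<psi> :: "'k::field_char_0 state"
  assumes "b \<noteq> Inl Gf"
  shows "rop b (lop (Inl Ge) \<psi>) = lop (Inl Ge) (rop b \<psi>)"
   "rop b (lop (Inl Gf) \<psi>) = lop (Inl Gf) (rop b \<psi>)"
   "rop b (lop (Inl Gh) \<psi>) = lop (Inl Gh) (rop b \<psi>)"
   "rop b (lop (Inl Gt) \<psi>) = lop (Inl Gt) (rop b \<psi>)"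
   "rop b (lop (Inr Vx) \<psi>) = lop (Inr Vx) (rop b \<psi>)"
   "rop b (lop (Inr Vy) \<psi>) = lop (Inr Vy) (rop b \<psi>)"
   "rop b (lop (Inr Vx1) \<psi>) = lop (Inr Vx1) (rop b \<psi>)"
   "rop b (lop (Inr Vy1) \<psi>) = lop (Inr Vy1) (rop b \<psi>)"
  using assms
  by (cases "(b, \<psi>)" rule: rop.cases; auto simp: fun_eq_iff fun_arith smul_def algebra_simps)+

lemma rop_f_lop_commute:
  fixes \<psi> :: "'k::field_char_0 state"
  shows "rop (Inl Gf) (lop (Inl a) \<psi>) = lop (Inl a) (rop (Inl Gf) \<psi>)"
proof (intro ext)
  fix a' b i j k l \<alpha> \<beta>
  show "rop (Inl Gf) (lop (Inl a) \<psi>) a' b i j k l \<alpha> \<beta> = lop (Inl a) (rop (Inl Gf) \<psi>) a' b i j k l \<alpha> \<beta>"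
    by (cases a; cases a'; cases b; cases i; cases j; cases k; cases l; simp add: algebra_simps)
qed

declare lop.simps [simp del] rop.simps [simp del]

lemma act_idl_UV:
  fixes p :: "(gl2 + vb) word \<Rightarrow>\<^sub>0 'k::field_char_0"
  assumes "p \<in> idl UV_rels"
  shows "act p \<psi> = 0"
proof -
  let ?J = "{p :: (gl2 + vb) word \<Rightarrow>\<^sub>0 'k. \<forall>\<psi>. act p \<psi> = 0}"
  have J: "two_sided ?J"
    by (rule two_sidedI) (simp_all add: act_add act_mult)
  have sub: "p - q - r \<in> ?J" if "\<And>\<psi>. act p \<psi> - act q \<psi> = act r \<psi>" for p q r :: "(gl2 + vb) word \<Rightarrow>\<^sub>0 'k"
    using that by (simp add: act_diff)
  note simps = act_scalar act_mult act_gen vec_single act_scalar_mult act_uminus vec_uminus push_uminus lop_relations(1-3,5-)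
    lop_relations(4)[where a = Ge] lop_relations(4)[where a = Gf] lop_relations(4)[where a = Gh]
  have rev: "\<phi> - \<chi> = \<omega> \<Longrightarrow> \<chi> - \<phi> = - \<omega>" for \<phi> \<chi> \<omega> :: "'k state"
    by (metis minus_diff_eq)
  have m1: "smul (- r) \<psi> = - smul r \<psi>" for r and \<psi> :: "'k state"
    by (simp add: smul_def fun_eq_iff fun_arith)
  have "idl smash_rels \<subseteq> ?J"
  proof (rule idl_least[OF smash_rels_subset[OF J] J])
    fix a b
    show "gen (Inl a) * gen (Inl b) - gen (Inl b) * gen (Inl a) - vec (push Inl (gl2_br a b)) \<in> ?J"
    proof (rule sub)
      fix \<psi> :: "'k state"
      show "act (gen (Inl a) * gen (Inl b)) \<psi> - act (gen (Inl b) * gen (Inl a)) \<psi> = act (vec (push Inl (gl2_br a b))) \<psi>"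
        by (cases a; cases b; simp add: simps m1 rev[OF lop_relations(1)] rev[OF lop_relations(2)] rev[OF lop_relations(3)] del: single_numeral)
    qed
  next
    fix a v
    show "gen (Inl a) * gen (Inr v) - gen (Inr v) * gen (Inl a) - vec (push Inr (gl2_act a v)) \<in> ?J"
      by (rule sub) (cases a; cases v; simp add: simps m1 del: single_numeral)
  qed
  then have "idl UV_rels \<subseteq> ?J"
    by (rule idl_UV_subset[OF J]) (simp add: act_diff act_mult act_gen lop_V_commute)
  then show ?thesis using assms by blast
qed

subsection \<open>Monomial states\<close>

definition mono_state :: "nat \<Rightarrow> nat \<Rightarrow> nat \<Rightarrow> nat \<Rightarrow> nat \<Rightarrow> nat \<Rightarrow> ('k \<Rightarrow> 'k \<Rightarrow> 'k) \<Rightarrow> 'k::field_char_0 state"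
  where "mono_state a b i j k l g = (\<lambda>a' b' i' j' k' l' \<alpha> \<beta>.
    if a' = a \<and> b' = b \<and> i' = i \<and> j' = j \<and> k' = k \<and> l' = l then g \<alpha> \<beta> else 0)"

text \<open>The state of the unit, so that \<open>act p vacuum\<close> is the normal form of \<open>p\<close>.\<close>

abbreviation vacuum :: "'k::field_char_0 state"
  where "vacuum \<equiv> mono_state 0 0 0 0 0 0 (\<lambda>\<alpha> \<beta>. 1)"

lemma lop_mono_state:
  "lop (Inl Gf) (mono_state a b i j k l g) = mono_state (Suc a) b i j k l g"
  "lop (Inl Ge) (mono_state 0 b 0 0 0 0 (\<lambda>\<alpha> \<beta>. r)) = mono_state 0 (Suc b) 0 0 0 0 (\<lambda>\<alpha> \<beta>. r)"
  "lop (Inr Vx) (mono_state 0 b i j k l (\<lambda>\<alpha> \<beta>. r)) = mono_state 0 b (Suc i) j k l (\<lambda>\<alpha> \<beta>. r)"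
  "lop (Inr Vy) (mono_state 0 b i j k l (\<lambda>\<alpha> \<beta>. r)) = mono_state 0 b i (Suc j) k l (\<lambda>\<alpha> \<beta>. r)"
  "lop (Inr Vx1) (mono_state 0 b i j k l (\<lambda>\<alpha> \<beta>. r)) = mono_state 0 b i j (Suc k) l (\<lambda>\<alpha> \<beta>. r)"
  "lop (Inr Vy1) (mono_state 0 b i j k l (\<lambda>\<alpha> \<beta>. r)) = mono_state 0 b i j k (Suc l) (\<lambda>\<alpha> \<beta>. r)"
  "lop (Inl Gh) (mono_state 0 b i j k l g) = mono_state 0 b i j k l (\<lambda>\<alpha> \<beta>. (\<alpha> - \<beta>) * g \<alpha> \<beta>)"
  "lop (Inl Gt) (mono_state 0 b i j k l g) = mono_state 0 b i j k l (\<lambda>\<alpha> \<beta>. (\<alpha> + \<beta>) * g \<alpha> \<beta>)"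
  by (auto simp: mono_state_def fun_eq_iff lop.simps)

lemma rop_add: "rop b (\<phi> + \<psi>) = rop b \<phi> + rop b \<psi>"
  by (cases "(b, \<phi>)" rule: rop.cases) (auto simp: rop.simps fun_eq_iff fun_arith algebra_simps)

lemma rop_smul: "rop b (smul r \<psi>) = smul r (rop b \<psi>)"
  by (cases "(b, \<psi>)" rule: rop.cases) (auto simp: rop.simps fun_eq_iff smul_def algebra_simps)

lemma rop_lop: "rop b (lop c \<psi>) = lop c (rop b \<psi>)" if "b \<noteq> Inl Gf"
proof (cases c)
  case (Inl a)
  then show ?thesis by (cases a) (simp_all only: rop_lop_commute[OF that])
next
  case (Inr v)
  then show ?thesis by (cases v) (simp_all only: rop_lop_commute[OF that])
qed

lemma rop_act: "rop b (act p \<psi>) = act p (rop b \<psi>)" if "b \<noteq> Inl Gf"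
  by (induction p rule: free_algebra_induct)
    (simp_all add: act_scalar rop_smul act_gen_mult rop_lop[OF that] act_add rop_add)

lemma rop_act_incl: "rop (Inl a) (act (incl p) \<psi>) = act (incl p) (rop (Inl a) \<psi>)"
proof (cases "a = Gf")
  case True
  show ?thesis unfolding True
    by (induction p rule: free_algebra_induct)
      (simp_all add: incl_scalar incl_mult incl_gen incl_add act_scalar rop_smul act_gen_mult rop_f_lop_commute act_add rop_add)
qed (simp add: rop_act)

lemma lop_vacuum: "lop b vacuum = rop b vacuum"
  by (cases "(b, vacuum)" rule: rop.cases) (auto simp: lop.simps rop.simps mono_state_def fun_eq_iff)

text \<open>Left and right multiplications commute and agree on the vacuum, so that \<open>rop\<close> is right multiplication on the
  states of elements.\<close>

lemma act_mult_gen_vacuum: "act (p * gen b) vacuum = rop b (act p vacuum)" if "b \<noteq> Inl Gf"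
  by (simp add: act_mult act_gen lop_vacuum rop_act[OF that])

lemma act_incl_mult_gen_vacuum: "act (incl p * gen (Inl a)) vacuum = rop (Inl a) (act (incl p) vacuum)"
  by (simp add: act_mult act_gen lop_vacuum rop_act_incl)

section \<open>The enveloping algebra and the smash product as types\<close>

text \<open>These algebras are introduced as types in order to compute in them with the rules of the class \<open>ring_1\<close>. The smash
  product is the enveloping algebra of \<open>gl\<^sub>2\<close> extended by the tensor algebra of \<open>V\<close>. Both \<open>H\<^sub>c\<close> and the
  enveloping algebra of \<open>gl\<^sub>2 \<ltimes> V\<close> are quotients of it, and identities proved there hold in both.\<close>

quotient_type (overloaded) 'k uea = "(gl2 + vb) word \<Rightarrow>\<^sub>0 'k::field_char_0" / "\<lambda>p q. p - q \<in> idl UV_rels"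
  morphisms rep_uea abs_uea
  by (rule equivpI) (auto simp: reflp_def symp_def transp_def intro: idl_diff_commute idl_trans)

quotient_type (overloaded) 'k smash = "(gl2 + vb) word \<Rightarrow>\<^sub>0 'k::field_char_0" / "\<lambda>p q. p - q \<in> idl smash_rels"
  morphisms rep_smash abs_smash
  by (rule equivpI) (auto simp: reflp_def symp_def transp_def intro: idl_diff_commute idl_trans)

lemma idl_cong_add: "p - p' \<in> idl R \<Longrightarrow> q - q' \<in> idl R \<Longrightarrow> (p + q) - (p' + q') \<in> idl R"
  using idl_add[of "p - p'" R "q - q'"] by (simp add: algebra_simps)

lemma idl_cong_diff: "p - p' \<in> idl R \<Longrightarrow> q - q' \<in> idl R \<Longrightarrow> (p - q) - (p' - q') \<in> idl R"
  using idl_diff[of "p - p'" R "q - q'"] by (simp add: algebra_simps)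

lemma idl_cong_uminus: "p - p' \<in> idl R \<Longrightarrow> (- p) - (- p') \<in> idl R"
  using idl_uminus[of "p - p'" R] by (simp add: algebra_simps)

instantiation uea :: (field_char_0) ring_1
begin
lift_definition zero_uea :: "'a uea" is 0 .
lift_definition one_uea :: "'a uea" is 1 .
lift_definition plus_uea :: "'a uea \<Rightarrow> 'a uea \<Rightarrow> 'a uea" is "(+)" by (rule idl_cong_add)
lift_definition minus_uea :: "'a uea \<Rightarrow> 'a uea \<Rightarrow> 'a uea" is "(-)" by (rule idl_cong_diff)
lift_definition uminus_uea :: "'a uea \<Rightarrow> 'a uea" is uminus by (rule idl_cong_uminus)
lift_definition times_uea :: "'a uea \<Rightarrow> 'a uea \<Rightarrow> 'a uea" is "(*)" by (rule idl_cong_mult)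
instance
proof
  show "(0 :: 'a uea) \<noteq> 1"
  proof (transfer, rule notI)
    assume "0 - 1 \<in> idl (UV_rels :: (_ \<Rightarrow>\<^sub>0 'a) set)"
    then have "act (0 - 1) (vacuum :: 'a state) = 0"
      by (rule act_idl_UV)
    then have "(vacuum :: 'a state) 0 0 0 0 0 0 0 0 = 0"
      by (simp add: act_uminus zero_fun_apply)
    then show False by (simp add: mono_state_def)
  qed
qed (transfer; simp add: algebra_simps)+
end

instantiation smash :: (field_char_0) ring_1
begin
lift_definition zero_smash :: "'a smash" is 0 .
lift_definition one_smash :: "'a smash" is 1 .
lift_definition plus_smash :: "'a smash \<Rightarrow> 'a smash \<Rightarrow> 'a smash" is "(+)" by (rule idl_cong_add)
lift_definition minus_smash :: "'a smash \<Rightarrow> 'a smash \<Rightarrow> 'a smash" is "(-)" by (rule idl_cong_diff)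
lift_definition uminus_smash :: "'a smash \<Rightarrow> 'a smash" is uminus by (rule idl_cong_uminus)
lift_definition times_smash :: "'a smash \<Rightarrow> 'a smash \<Rightarrow> 'a smash" is "(*)" by (rule idl_cong_mult)
instance
proof
  show "(0 :: 'a smash) \<noteq> 1"
  proof (transfer, rule notI)
    assume "0 - 1 \<in> idl (smash_rels :: (_ \<Rightarrow>\<^sub>0 'a) set)"
    then have "act (0 - 1) (vacuum :: 'a state) = 0"
      using idl_smash_subset_idl_UV act_idl_UV by blast
    then have "(vacuum :: 'a state) 0 0 0 0 0 0 0 0 = 0"
      by (simp add: act_uminus zero_fun_apply)
    then show False by (simp add: mono_state_def)
  qed
qed (transfer; simp add: algebra_simps)+
end

lemma abs_uea_hom [simp]:
  "abs_uea (p + q) = abs_uea p + abs_uea q" "abs_uea (p - q) = abs_uea p - abs_uea q"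
  "abs_uea (- p) = - abs_uea p" "abs_uea (p * q) = abs_uea p * abs_uea q"
  "abs_uea 0 = 0" "abs_uea 1 = 1"
  by (simp_all add: plus_uea.abs_eq minus_uea.abs_eq uminus_uea.abs_eq times_uea.abs_eq zero_uea.abs_eq one_uea.abs_eq)

lemma abs_smash_hom [simp]:
  "abs_smash (p + q) = abs_smash p + abs_smash q" "abs_smash (p - q) = abs_smash p - abs_smash q"
  "abs_smash (- p) = - abs_smash p" "abs_smash (p * q) = abs_smash p * abs_smash q"
  "abs_smash 0 = 0" "abs_smash 1 = 1"
  by (simp_all add: plus_smash.abs_eq minus_smash.abs_eq uminus_smash.abs_eq times_smash.abs_eq zero_smash.abs_eq one_smash.abs_eq)

lemma abs_uea_eq_iff: "abs_uea p = abs_uea q \<longleftrightarrow> p - q \<in> idl UV_rels"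
  by (rule uea.abs_eq_iff)

lemma abs_smash_eq_iff: "abs_smash p = abs_smash q \<longleftrightarrow> p - q \<in> idl smash_rels"
  by (rule smash.abs_eq_iff)

lemma abs_uea_cases:
  obtains p where "z = abs_uea p"
proof -
  have "\<exists>p. z = abs_uea p"
    by (induct z rule: uea.abs_induct) blast
  then show ?thesis using that by blast
qed

section \<open>Computing with the relations\<close>

text \<open>The subalgebra generated by \<open>G\<close>, with \<open>s\<close> the embedding of the scalars.\<close>

inductive_set alg_gen :: "('k \<Rightarrow> 'r::ring_1) \<Rightarrow> 'r set \<Rightarrow> 'r set" for s G
  where scal: "s r \<in> alg_gen s G"
  | mult: "g \<in> G \<Longrightarrow> p \<in> alg_gen s G \<Longrightarrow> g * p \<in> alg_gen s G"
  | add: "p \<in> alg_gen s G \<Longrightarrow> q \<in> alg_gen s G \<Longrightarrow> p + q \<in> alg_gen s G"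

inductive_set add_span :: "'r::ring_1 set \<Rightarrow> 'r set" for B
  where zero: "0 \<in> add_span B"
  | step: "p \<in> B \<Longrightarrow> q \<in> add_span B \<Longrightarrow> p + q \<in> add_span B"

lemma add_span_base: "p \<in> B \<Longrightarrow> p \<in> add_span B"
  using add_span.step[OF _ add_span.zero, of p B] by simp

lemma add_span_add: "p \<in> add_span B \<Longrightarrow> q \<in> add_span B \<Longrightarrow> p + q \<in> add_span B"
  by (induction rule: add_span.induct) (auto simp: add.assoc intro: add_span.step)

lemma add_span_mult:
  assumes "\<And>b. b \<in> B \<Longrightarrow> c * b \<in> add_span B'" "p \<in> add_span B"
  shows "c * p \<in> add_span B'"
  using assms(2) by (induction rule: add_span.induct) (auto simp: distrib_left intro: add_span.zero add_span_add assms(1))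

text \<open>The relations of the smash product as rewrite rules, which move \<open>f\<close>, then \<open>h\<close> and \<open>t\<close> to the left of the elements of \<open>V\<close>
  and \<open>e\<close> to the right of them. The elements of \<open>V\<close> are not reordered among each other.\<close>

locale smash_algebra =
  fixes s :: "'k::field_char_0 \<Rightarrow> 'r::ring_1" and e f h t x y x1 y1 :: 'r
  assumes s_add: "s (r + r') = s r + s r'" and s_mult: "s (r * r') = s r * s r'" and s_one: "s 1 = 1"
    and s_commute: "s r * a = a * s r"
    and ef: "e * f = f * e + h" and hf: "h * f = f * h - f - f" and tf: "t * f = f * t"
    and th: "t * h = h * t" and eh: "e * h = h * e - e - e" and et: "e * t = t * e"
    and xf: "x * f = f * x - y" and yf: "y * f = f * y" and xh: "x * h = h * x - x" and yh: "y * h = h * y + y"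
    and xt: "x * t = t * x - x" and yt: "y * t = t * y - y" and ex: "e * x = x * e" and ey: "e * y = y * e + x"
    and x1f: "x1 * f = f * x1 - y1" and y1f: "y1 * f = f * y1" and x1h: "x1 * h = h * x1 - x1" and y1h: "y1 * h = h * y1 + y1"
    and x1t: "x1 * t = t * x1 + x1" and y1t: "y1 * t = t * y1 + y1" and ex1: "e * x1 = x1 * e" and ey1: "e * y1 = y1 * e + x1"
begin

lemmas order = ef hf tf th eh et xf yf xh yh xt yt ex ey x1f y1f x1h y1h x1t y1t ex1 ey1

lemma order_assoc:
  "e * (f * a) = f * (e * a) + h * a" "h * (f * a) = f * (h * a) - f * a - f * a" "t * (f * a) = f * (t * a)"
  "t * (h * a) = h * (t * a)" "e * (h * a) = h * (e * a) - e * a - e * a" "e * (t * a) = t * (e * a)"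
  "x * (f * a) = f * (x * a) - y * a" "y * (f * a) = f * (y * a)" "x * (h * a) = h * (x * a) - x * a"
  "y * (h * a) = h * (y * a) + y * a" "x * (t * a) = t * (x * a) - x * a" "y * (t * a) = t * (y * a) - y * a"
  "e * (x * a) = x * (e * a)" "e * (y * a) = y * (e * a) + x * a"
  "x1 * (f * a) = f * (x1 * a) - y1 * a" "y1 * (f * a) = f * (y1 * a)" "x1 * (h * a) = h * (x1 * a) - x1 * a"
  "y1 * (h * a) = h * (y1 * a) + y1 * a" "x1 * (t * a) = t * (x1 * a) + x1 * a" "y1 * (t * a) = t * (y1 * a) + y1 * a"
  "e * (x1 * a) = x1 * (e * a)" "e * (y1 * a) = y1 * (e * a) + x1 * a"
  unfolding mult.assoc[symmetric] order by (simp_all add: algebra_simps)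

lemma s_zero [simp]: "s 0 = 0"
  using s_add[of 0 0] by simp

lemma s_uminus: "s (- r) = - s r"
  using s_add[of r "- r"] by (simp add: eq_neg_iff_add_eq_0 add.commute)

lemma s_diff: "s (r - r') = s r - s r'"
  using s_add[of r "- r'"] by (simp add: s_uminus)

lemma s_of_nat: "s (of_nat n) = of_nat n"
  by (induction n) (simp_all add: s_add s_one)

lemma s_half: "s (1/2) + s (1/2) = 1"
  by (simp add: s_one flip: s_add)

lemma s_half_left: "s (1/2) * a + s (1/2) * a = a"
  by (simp add: s_half flip: distrib_right)

lemma s_assoc: "a * (s r * b) = s r * (a * b)"
  by (metis mult.assoc s_commute)

text \<open>The elements \<open>\<alpha>\<close> and \<open>\<beta>\<close>: they commute, and each of \<open>x\<close>, \<open>y\<close>, \<open>x\<^sub>1\<close>, \<open>y\<^sub>1\<close> commutes with one of them and shifts the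
  other one.\<close>

definition al :: 'r where "al = s (1/2) * (h + t)"
definition be :: 'r where "be = s (1/2) * (t - h)"

lemma h_eq: "h = al - be" and t_eq: "t = al + be"
  using s_half_left[of h] s_half_left[of t] by (simp_all add: al_def be_def algebra_simps)

lemma
  shows al_f: "al * f = f * (al - 1)" and be_f: "be * f = f * (be + 1)" and be_al: "be * al = al * be"
    and e_al: "e * al = (al - 1) * e" and e_be: "e * be = (be + 1) * e"
    and x_al: "x * al = (al - 1) * x" and x_be: "x * be = be * x"
    and y_al: "y * al = al * y" and y_be: "y * be = (be - 1) * y"
    and x1_al: "x1 * al = al * x1" and x1_be: "x1 * be = (be + 1) * x1"
    and y1_al: "y1 * al = (al + 1) * y1" and y1_be: "y1 * be = be * y1"
proof -
  \<comment> \<open>The relations for the doubles \<open>h + t\<close> and \<open>t - h\<close> are relations of the generators.\<close>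
  have cancel: "a = b" if "a + a = b + b" for a b :: 'r
    using s_half_left[of a] s_half_left[of b] that by (metis distrib_left)
  have al2: "al + al = h + t" and be2: "be + be = t - h"
    unfolding al_def be_def using s_half_left by simp_all
  have *: "(al + al) * f = f * (al + al) - f - f" "(be + be) * f = f * (be + be) + f + f"
    "e * (al + al) = (al + al) * e - e - e" "e * (be + be) = (be + be) * e + e + e"
    "x * (al + al) = (al + al) * x - x - x" "x * (be + be) = (be + be) * x"
    "y * (al + al) = (al + al) * y" "y * (be + be) = (be + be) * y - y - y"
    "x1 * (al + al) = (al + al) * x1" "x1 * (be + be) = (be + be) * x1 + x1 + x1"
    "y1 * (al + al) = (al + al) * y1 + y1 + y1" "y1 * (be + be) = (be + be) * y1"
    unfolding al2 be2 by (simp_all add: algebra_simps order)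
  show "al * f = f * (al - 1)" "be * f = f * (be + 1)"
    "e * al = (al - 1) * e" "e * be = (be + 1) * e" "x * al = (al - 1) * x" "x * be = be * x"
    "y * al = al * y" "y * be = (be - 1) * y" "x1 * al = al * x1" "x1 * be = (be + 1) * x1"
    "y1 * al = (al + 1) * y1" "y1 * be = be * y1"
    by (rule cancel; use * in \<open>simp add: algebra_simps\<close>)+
  have "(be + be) * (al + al) = (al + al) * (be + be)"
    unfolding al2 be2 by (simp add: algebra_simps order)
  then have "(be * al + be * al) + (be * al + be * al) = (al * be + al * be) + (al * be + al * be)"
    by (simp add: algebra_simps)
  then show "be * al = al * be"
    by (rule cancel[OF cancel])
qed

subsection \<open>Moving polynomials and powers past each other\<close>

abbreviation cpoly :: "'r set" where "cpoly \<equiv> alg_gen s {al, be}"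
abbreviation vpoly :: "'r set" where "vpoly \<equiv> alg_gen s {x, y, x1, y1}"

lemma alg_gen_scal: "p \<in> alg_gen s G \<Longrightarrow> s r * p \<in> alg_gen s G"
proof (induction rule: alg_gen.induct)
  case (scal r')
  show ?case using alg_gen.scal[of s "r * r'"] by (simp add: s_mult)
next
  case (mult g p)
  then show ?case using alg_gen.mult[of g G "s r * p"] by (simp add: s_assoc)
qed (simp add: distrib_left alg_gen.add)

lemma s_of_int: "s (of_int n) = of_int n"
  by (cases n) (simp_all add: s_of_nat s_uminus s_diff s_one)

lemma alg_gen_plus: "g \<in> G \<Longrightarrow> p \<in> alg_gen s G \<Longrightarrow> (g + of_int n) * p \<in> alg_gen s G"
  using alg_gen_scal[of p G "of_int n"] by (simp add: distrib_right alg_gen.intros s_of_int)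

lemma cpoly_shift:
  assumes "c * al = (al + of_int m) * c" "c * be = (be + of_int n) * c" "p \<in> cpoly"
  shows "\<exists>p' \<in> cpoly. c * p = p' * c"
  using assms(3)
proof (induction rule: alg_gen.induct)
  case (scal r)
  show ?case using s_commute[of r c] alg_gen.scal by metis
next
  case (mult g p)
  then obtain p' where p': "p' \<in> cpoly" "c * p = p' * c" by blast
  from mult(1) obtain m' where m': "c * g = (g + of_int m') * c"
    using assms(1,2) by blast
  have "c * (g * p) = ((g + of_int m') * p') * c"
    using p'(2) m' by (metis mult.assoc)
  then show ?case using alg_gen_plus[OF mult(1) p'(1)] by blast
next
  case (add p q)
  then obtain p' q' where pq: "p' \<in> cpoly" "c * p = p' * c" "q' \<in> cpoly" "c * q = q' * c" by blast
  have "c * (p + q) = (p' + q') * c"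
    by (simp add: distrib_left distrib_right pq)
  then show ?case using alg_gen.add[OF pq(1,3)] by blast
qed

lemma al_f_pow: "al * f ^ a = f ^ a * (al + of_int (- int a))"
proof (induction a)
  case (Suc a)
  have "al * f ^ Suc a = f * ((al - 1) * f ^ a)"
    by (simp add: al_f flip: mult.assoc)
  also have "(al - 1) * f ^ a = f ^ a * (al + of_int (- int (Suc a)))"
    using Suc by (simp add: algebra_simps)
  finally show ?case by (simp add: mult.assoc)
qed simp

lemma be_f_pow: "be * f ^ a = f ^ a * (be + of_int (int a))"
proof (induction a)
  case (Suc a)
  have "be * f ^ Suc a = f * ((be + 1) * f ^ a)"
    by (simp add: be_f flip: mult.assoc)
  also have "(be + 1) * f ^ a = f ^ a * (be + of_int (int (Suc a)))"
    using Suc by (simp add: algebra_simps)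
  finally show ?case by (simp add: mult.assoc)
qed simp

lemma y_f_pow: "y * f ^ a = f ^ a * y" and y1_f_pow: "y1 * f ^ a = f ^ a * y1"
  by (simp_all add: power_commuting_commutes yf y1f)

lemma x_f_pow: "x * f ^ Suc a = f ^ Suc a * x - f ^ a * (of_int (int (Suc a)) * y)"
proof (induction a)
  case (Suc a)
  have "x * f ^ Suc (Suc a) = f * (x * f ^ Suc a) - y * f ^ Suc a"
    by (subst power_Suc) (simp only: order_assoc)
  then show ?case
    unfolding Suc y_f_pow by (simp add: algebra_simps mult_2)
qed (simp add: xf)

lemma x1_f_pow: "x1 * f ^ Suc a = f ^ Suc a * x1 - f ^ a * (of_int (int (Suc a)) * y1)"
proof (induction a)
  case (Suc a)
  have "x1 * f ^ Suc (Suc a) = f * (x1 * f ^ Suc a) - y1 * f ^ Suc a"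
    by (subst power_Suc) (simp only: order_assoc)
  then show ?case
    unfolding Suc y1_f_pow by (simp add: algebra_simps mult_2)
qed (simp add: x1f)

lemma e_f_pow: "e * f ^ Suc a = f ^ Suc a * e + f ^ a * (of_int (int (Suc a)) * (h - of_int (int a)))"
proof (induction a)
  case (Suc a)
  have h: "h * f ^ Suc a = f ^ Suc a * (h - of_int (int (Suc a)) - of_int (int (Suc a)))"
  proof -
    have "(al - be) * f ^ Suc a = f ^ Suc a * ((al - be) - of_int (int (Suc a)) - of_int (int (Suc a)))"
      unfolding left_diff_distrib al_f_pow be_f_pow by (simp add: algebra_simps)
    then show ?thesis by (simp only: h_eq[symmetric])
  qed
  have "e * f ^ Suc (Suc a) = f * (e * f ^ Suc a) + h * f ^ Suc a"
    by (subst power_Suc) (simp only: order_assoc)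
  also have "\<dots> = f ^ Suc (Suc a) * e + f ^ Suc a * (of_int (int (Suc a)) * (h - of_int (int a)) + (h - of_int (int (Suc a)) - of_int (int (Suc a))))"
    unfolding Suc h by (simp add: distrib_left mult.assoc)
  also have "of_int (int (Suc a)) * (h - of_int (int a)) + (h - of_int (int (Suc a)) - of_int (int (Suc a))) =
     of_int (int (Suc (Suc a))) * (h - of_int (int (Suc a)))"
    by (simp only: of_int_of_nat_eq of_nat_Suc distrib_left distrib_right left_diff_distrib right_diff_distrib
        mult_1_left mult_1_right, simp add: algebra_simps)
      (simp only: one_add_one[symmetric] distrib_right mult_1_left add_ac)
  finally show ?case .
qed (simp add: ef)

subsection \<open>Normal forms\<close>

text \<open>The factor \<open>m\<close> is a noncommutative polynomial, because the elements of \<open>V\<close> do not commute in the smash product.\<close>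

definition nf_basis :: "'r set"
  where "nf_basis = {f ^ a * (p * (m * e ^ b)) | a p m b. p \<in> cpoly \<and> m \<in> vpoly}"

abbreviation nform :: "'r set" where "nform \<equiv> add_span nf_basis"

lemma nformI: "p \<in> cpoly \<Longrightarrow> m \<in> vpoly \<Longrightarrow> f ^ a * (p * (m * e ^ b)) \<in> nform"
  by (rule add_span_base) (auto simp: nf_basis_def)

text \<open>The span of the normal forms is shown to be a left ideal. Since it contains \<open>1\<close>, it is the whole
  algebra.\<close>

lemma nform_mult:
  assumes "\<And>a p m b. p \<in> cpoly \<Longrightarrow> m \<in> vpoly \<Longrightarrow> c * (f ^ a * (p * (m * e ^ b))) \<in> nform" "z \<in> nform"
  shows "c * z \<in> nform"
proof (rule add_span_mult[OF _ assms(2)])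
  fix w assume "w \<in> nf_basis"
  then obtain a p m b where "w = f ^ a * (p * (m * e ^ b))" "p \<in> cpoly" "m \<in> vpoly"
    unfolding nf_basis_def by blast
  then show "c * w \<in> nform" using assms(1) by simp
qed

lemma nform_scal: "z \<in> nform \<Longrightarrow> s r * z \<in> nform"
proof (rule nform_mult)
  fix a p m b assume "p \<in> cpoly" "m \<in> vpoly"
  then have "f ^ a * ((s r * p) * (m * e ^ b)) \<in> nform"
    by (intro nformI alg_gen_scal)
  then show "s r * (f ^ a * (p * (m * e ^ b))) \<in> nform"
    by (simp only: mult.assoc s_assoc)
qed

lemma nform_diff: "z \<in> nform \<Longrightarrow> w \<in> nform \<Longrightarrow> z - w \<in> nform"
  using add_span_add[of z nf_basis "s (-1) * w"] nform_scal[of w "-1"] by (simp add: s_uminus s_one)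

lemma nform_f: "z \<in> nform \<Longrightarrow> f * z \<in> nform"
proof (rule nform_mult)
  fix a p m b assume "p \<in> cpoly" "m \<in> vpoly"
  then have "f ^ Suc a * (p * (m * e ^ b)) \<in> nform"
    by (rule nformI)
  then show "f * (f ^ a * (p * (m * e ^ b))) \<in> nform"
    by (simp add: mult.assoc)
qed

lemma nform_al: "z \<in> nform \<Longrightarrow> al * z \<in> nform"
proof (rule nform_mult)
  fix a p m b assume "p \<in> cpoly" "m \<in> vpoly"
  then have "f ^ a * (((al + of_int (- int a)) * p) * (m * e ^ b)) \<in> nform"
    by (intro nformI alg_gen_plus) auto
  then show "al * (f ^ a * (p * (m * e ^ b))) \<in> nform"
    by (simp only: mult.assoc[symmetric] al_f_pow)
qed

lemma nform_be: "z \<in> nform \<Longrightarrow> be * z \<in> nform"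
proof (rule nform_mult)
  fix a p m b assume "p \<in> cpoly" "m \<in> vpoly"
  then have "f ^ a * (((be + of_int (int a)) * p) * (m * e ^ b)) \<in> nform"
    by (intro nformI alg_gen_plus) auto
  then show "be * (f ^ a * (p * (m * e ^ b))) \<in> nform"
    by (simp only: mult.assoc[symmetric] be_f_pow)
qed

lemma nform_V:
  assumes v: "v \<in> {x, y, x1, y1}" and p: "p \<in> cpoly" and m: "m \<in> vpoly"
  shows "f ^ a * (v * (p * (m * e ^ b))) \<in> nform"
proof -
  from v consider "v = x" | "v = y" | "v = x1" | "v = y1" by blast
  then have "\<exists>k l. v * al = (al + of_int k) * v \<and> v * be = (be + of_int l) * v"
  proof cases
    case 1
    then show ?thesis using x_al x_be by (intro exI[of _ "-1"] exI[of _ 0]) simp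
  next
    case 2
    then show ?thesis using y_al y_be by (intro exI[of _ "0"] exI[of _ "-1"]) simp
  next
    case 3
    then show ?thesis using x1_al x1_be by (intro exI[of _ "0"] exI[of _ 1]) simp
  next
    case 4
    then show ?thesis using y1_al y1_be by (intro exI[of _ 1] exI[of _ 0]) simp
  qed
  then obtain p' where p': "p' \<in> cpoly" "v * p = p' * v"
    using cpoly_shift[OF _ _ p] by blast
  have "f ^ a * (p' * ((v * m) * e ^ b)) \<in> nform"
    by (intro nformI p' alg_gen.mult v m)
  then show ?thesis
    by (simp only: mult.assoc[symmetric]) (simp only: mult.assoc p'(2))
qed

lemma nform_y: "z \<in> nform \<Longrightarrow> y * z \<in> nform"
proof (rule nform_mult)
  fix a p m b assume "p \<in> cpoly" "m \<in> vpoly"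
  then have "f ^ a * (y * (p * (m * e ^ b))) \<in> nform"
    by (intro nform_V) auto
  then show "y * (f ^ a * (p * (m * e ^ b))) \<in> nform"
    by (simp only: mult.assoc[symmetric] y_f_pow)
qed

lemma nform_y1: "z \<in> nform \<Longrightarrow> y1 * z \<in> nform"
proof (rule nform_mult)
  fix a p m b assume "p \<in> cpoly" "m \<in> vpoly"
  then have "f ^ a * (y1 * (p * (m * e ^ b))) \<in> nform"
    by (intro nform_V) auto
  then show "y1 * (f ^ a * (p * (m * e ^ b))) \<in> nform"
    by (simp only: mult.assoc[symmetric] y1_f_pow)
qed

lemma nform_x: "z \<in> nform \<Longrightarrow> x * z \<in> nform"
proof (rule nform_mult)
  fix a p m b assume *: "p \<in> cpoly" "m \<in> vpoly"
  show "x * (f ^ a * (p * (m * e ^ b))) \<in> nform"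
  proof (cases a)
    case 0
    then show ?thesis using nform_V[OF _ *, of x 0 b] by simp
  next
    case (Suc n)
    have "x * (f ^ a * (p * (m * e ^ b))) = f ^ a * (x * (p * (m * e ^ b))) - s (of_int (int a)) * (f ^ n * (y * (p * (m * e ^ b))))"
      by (simp only: Suc mult.assoc[symmetric] x_f_pow left_diff_distrib)
        (simp only: s_of_int[symmetric] mult.assoc s_assoc)
    then show ?thesis
      using * by (simp only:) (intro nform_diff nform_scal nform_V; simp)
  qed
qed

lemma nform_x1: "z \<in> nform \<Longrightarrow> x1 * z \<in> nform"
proof (rule nform_mult)
  fix a p m b assume *: "p \<in> cpoly" "m \<in> vpoly"
  show "x1 * (f ^ a * (p * (m * e ^ b))) \<in> nform"
  proof (cases a)
    case 0
    then show ?thesis using nform_V[OF _ *, of x1 0 b] by simp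
  next
    case (Suc n)
    have "x1 * (f ^ a * (p * (m * e ^ b))) = f ^ a * (x1 * (p * (m * e ^ b))) - s (of_int (int a)) * (f ^ n * (y1 * (p * (m * e ^ b))))"
      by (simp only: Suc mult.assoc[symmetric] x1_f_pow left_diff_distrib)
        (simp only: s_of_int[symmetric] mult.assoc s_assoc)
    then show ?thesis
      using * by (simp only:) (intro nform_diff nform_scal nform_V; simp)
  qed
qed

lemma e_vpoly: "m \<in> vpoly \<Longrightarrow> \<exists>m' \<in> vpoly. e * m = m * e + m'"
proof (induction rule: alg_gen.induct)
  case (scal r)
  show ?case using s_commute[of r e] alg_gen.scal[of s 0] by (intro bexI[of _ "s 0"]) simp_all
next
  case (mult v m)
  then obtain m' where m': "m' \<in> vpoly" "e * m = m * e + m'" by blast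
  from mult(1) have "\<exists>w \<in> {x, y, x1, y1}. e * v = v * e \<or> e * v = v * e + w"
    using ex ey ex1 ey1 by blast
  then obtain w where w: "w \<in> {x, y, x1, y1}" "e * v = v * e \<or> e * v = v * e + w" by blast
  have "e * (v * m) = v * m * e + v * m' \<or> e * (v * m) = v * m * e + (v * m' + w * m)"
    using w(2)
  proof
    assume "e * v = v * e"
    then have "e * (v * m) = v * (e * m)" by (simp flip: mult.assoc)
    then show ?thesis by (simp add: m'(2) algebra_simps)
  next
    assume "e * v = v * e + w"
    then have "e * (v * m) = v * (e * m) + w * m" by (simp add: distrib_right flip: mult.assoc)
    then show ?thesis by (simp add: m'(2) algebra_simps)
  qed
  moreover have "v * m' \<in> vpoly" "v * m' + w * m \<in> vpoly"
    using mult(1,2) w(1) m'(1) by (auto intro!: alg_gen.mult alg_gen.add)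
  ultimately show ?case by blast
next
  case (add p q)
  then obtain p' q' where pq: "p' \<in> vpoly" "e * p = p * e + p'" "q' \<in> vpoly" "e * q = q * e + q'" by blast
  have "e * (p + q) = (p + q) * e + (p' + q')"
    by (simp add: distrib_left distrib_right pq add_ac)
  then show ?case using alg_gen.add[OF pq(1,3)] by blast
qed

lemma nform_e: "z \<in> nform \<Longrightarrow> e * z \<in> nform"
proof (rule nform_mult)
  fix a p m b assume p: "p \<in> cpoly" and m: "m \<in> vpoly"
  obtain p' where p': "p' \<in> cpoly" "e * p = p' * e"
    using cpoly_shift[of e "-1" 1, OF _ _ p] e_al e_be by auto
  obtain m' where m': "m' \<in> vpoly" "e * m = m * e + m'"
    using e_vpoly[OF m] by blast
  have "e * (p * (m * e ^ b)) = p' * ((e * m) * e ^ b)"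
    using p'(2) by (simp add: mult.assoc[symmetric])
  also have "\<dots> = p' * (m * e ^ Suc b) + p' * (m' * e ^ b)"
    by (simp add: m'(2) algebra_simps)
  finally have A: "e * (p * (m * e ^ b)) = p' * (m * e ^ Suc b) + p' * (m' * e ^ b)" .
  have B: "f ^ a * (e * (p * (m * e ^ b))) \<in> nform" for a
    unfolding A distrib_left by (intro add_span_add nformI p' m m')
  show "e * (f ^ a * (p * (m * e ^ b))) \<in> nform"
  proof (cases a)
    case 0
    then show ?thesis using B[of 0] by simp
  next
    case (Suc n)
    have "(al + of_int (- int n)) * p - (be + of_int 0) * p \<in> cpoly"
      using alg_gen.add[OF alg_gen_plus[of al _ p "- int n"] alg_gen_scal[OF alg_gen_plus[of be _ p 0], of _ "-1"]] p
      by (simp add: s_uminus s_one)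
    moreover have "(al + of_int (- int n)) * p - (be + of_int 0) * p = (h - of_int (int n)) * p"
      unfolding h_eq[symmetric] by (simp add: left_diff_distrib distrib_right) (simp add: h_eq[symmetric] flip: left_diff_distrib)
    ultimately have C: "s (of_int (int a)) * ((h - of_int (int n)) * p) \<in> cpoly"
      by (simp add: alg_gen_scal)
    have "e * (f ^ a * (p * (m * e ^ b))) = f ^ a * (e * (p * (m * e ^ b))) + f ^ n * ((s (of_int (int a)) * ((h - of_int (int n)) * p)) * (m * e ^ b))"
      by (simp only: Suc mult.assoc[symmetric] e_f_pow distrib_right s_of_int)
    then show ?thesis
      using add_span_add[OF B nformI[OF C m]] by (simp only:)
  qed
qed

end

lemma smash_algebraI:
  fixes \<phi> :: "((gl2 + vb) word \<Rightarrow>\<^sub>0 'k::field_char_0) \<Rightarrow> 'r::ring_1"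
  assumes add: "\<And>p q. \<phi> (p + q) = \<phi> p + \<phi> q" and mult: "\<And>p q. \<phi> (p * q) = \<phi> p * \<phi> q" and one: "\<phi> 1 = 1"
    and surj: "surj \<phi>" and rels: "\<And>p. p \<in> idl smash_rels \<Longrightarrow> \<phi> p = 0"
  shows "smash_algebra (\<lambda>r. \<phi> (Poly_Mapping.single 0 r)) (\<phi> (gen (Inl Ge))) (\<phi> (gen (Inl Gf))) (\<phi> (gen (Inl Gh))) (\<phi> (gen (Inl Gt)))
     (\<phi> (gen (Inr Vx))) (\<phi> (gen (Inr Vy))) (\<phi> (gen (Inr Vx1))) (\<phi> (gen (Inr Vy1)))"
proof -
  have zero: "\<phi> 0 = 0" using add[of 0 0] by simp
  have uminus: "\<phi> (- p) = - \<phi> p" for p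
    using add[of p "- p"] by (simp add: zero eq_neg_iff_add_eq_0 add.commute)
  have diff: "\<phi> (p - q) = \<phi> p - \<phi> q" for p q
    using add[of p "- q"] by (simp add: uminus)
  have two: "\<phi> 2 = 1 + 1"
    using add[of 1 1] by (simp add: one)
  have sgl: "Poly_Mapping.single 0 (-1) = (-1 :: (gl2 + vb) word \<Rightarrow>\<^sub>0 'k)" "Poly_Mapping.single 0 (-2) = (-2 :: (gl2 + vb) word \<Rightarrow>\<^sub>0 'k)"
    by (simp_all add: single_uminus)
  have g: "\<phi> (gen (Inl a)) * \<phi> (gen (Inl b)) = \<phi> (gen (Inl b)) * \<phi> (gen (Inl a)) + \<phi> (vec (push Inl (gl2_br a b)))" for a b
    using rels[OF smash_basis_relation(1)[of a b]] by (simp add: diff mult add algebra_simps)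
  have v: "\<phi> (gen (Inr v)) * \<phi> (gen (Inl a)) = \<phi> (gen (Inl a)) * \<phi> (gen (Inr v)) - \<phi> (vec (push Inr (gl2_act a v)))" for a v
    using rels[OF smash_basis_relation(2)[of a v]] by (simp add: diff mult add algebra_simps)
  have v': "\<phi> (gen (Inl a)) * \<phi> (gen (Inr v)) = \<phi> (gen (Inr v)) * \<phi> (gen (Inl a)) + \<phi> (vec (push Inr (gl2_act a v)))" for a v
    using v[of v a] by simp
  note simps = diff vec_single sgl uminus two mult zero one distrib_right
  have comm: "\<phi> (Poly_Mapping.single 0 r) * a = a * \<phi> (Poly_Mapping.single 0 r)" for r a
  proof -
    obtain p where "a = \<phi> p" using surj by (metis surj_def)
    then show ?thesis by (simp add: scalar_commute flip: mult)
  qed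
  show ?thesis
  proof unfold_locales
    show "\<phi> (Poly_Mapping.single 0 (r + r')) = \<phi> (Poly_Mapping.single 0 r) + \<phi> (Poly_Mapping.single 0 r')" for r r'
      by (simp add: single_add add)
    show "\<phi> (Poly_Mapping.single 0 (r * r')) = \<phi> (Poly_Mapping.single 0 r) * \<phi> (Poly_Mapping.single 0 r')" for r r'
      by (simp add: mult_single flip: mult)
    show "\<phi> (Poly_Mapping.single 0 1) = 1"
      by (simp add: one)
  qed (fact comm, simp_all add: g[of Ge Gf] g[of Gh Gf] g[of Gt Gf] g[of Gt Gh] g[of Ge Gh] g[of Ge Gt]
      v[where a = Gf] v[where a = Gh] v[where a = Gt] v'[where a = Ge] simps mult_2)
qed

locale semidirect_algebra = smash_algebra +
  assumes V_commute: "y * x = x * y" "x1 * x = x * x1" "x1 * y = y * x1" "y1 * x = x * y1" "y1 * y = y * y1" "y1 * x1 = x1 * y1"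

interpretation S: smash_algebra "\<lambda>r. abs_smash (Poly_Mapping.single 0 r)" "abs_smash (gen (Inl Ge))" "abs_smash (gen (Inl Gf))"
    "abs_smash (gen (Inl Gh))" "abs_smash (gen (Inl Gt))" "abs_smash (gen (Inr Vx))" "abs_smash (gen (Inr Vy))"
    "abs_smash (gen (Inr Vx1))" "abs_smash (gen (Inr Vy1))"
proof (rule smash_algebraI)
  have "\<exists>p. z = abs_smash p" for z :: "'a smash"
    by (induct z rule: smash.abs_induct) blast
  then show "surj (abs_smash :: _ \<Rightarrow> 'a smash)"
    by (metis surj_def)
  show "abs_smash p = 0" if "p \<in> idl smash_rels" for p :: "(gl2 + vb) word \<Rightarrow>\<^sub>0 'a"
    using that abs_smash_eq_iff[of p 0] by simp
qed simp_all

interpretation U: semidirect_algebra "\<lambda>r. abs_uea (Poly_Mapping.single 0 r)" "abs_uea (gen (Inl Ge))" "abs_uea (gen (Inl Gf))"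
    "abs_uea (gen (Inl Gh))" "abs_uea (gen (Inl Gt))" "abs_uea (gen (Inr Vx))" "abs_uea (gen (Inr Vy))"
    "abs_uea (gen (Inr Vx1))" "abs_uea (gen (Inr Vy1))"
proof (intro semidirect_algebra.intro smash_algebraI)
  have "\<exists>p. z = abs_uea p" for z :: "'a uea"
    by (induct z rule: uea.abs_induct) blast
  then show "surj (abs_uea :: _ \<Rightarrow> 'a uea)"
    by (metis surj_def)
  show "abs_uea p = 0" if "p \<in> idl smash_rels" for p :: "(gl2 + vb) word \<Rightarrow>\<^sub>0 'a"
    using that abs_uea_eq_iff[of p 0] idl_smash_subset_idl_UV by auto
  have "abs_uea (gen (Inr v)) * abs_uea (gen (Inr w)) = abs_uea (gen (Inr w)) * (abs_uea (gen (Inr v)) :: 'a uea)" for v w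
    using abs_uea_eq_iff[of "gen (Inr v) * gen (Inr w)" "gen (Inr w) * gen (Inr v) :: _ \<Rightarrow>\<^sub>0 'a"] UV_rels_commute by simp
  then show "semidirect_algebra_axioms (abs_uea (gen (Inr Vx))) (abs_uea (gen (Inr Vy)))
    (abs_uea (gen (Inr Vx1)) :: 'a uea) (abs_uea (gen (Inr Vy1)))"
    by (intro semidirect_algebra_axioms.intro)
qed simp_all

section \<open>The Poincare-Birkhoff-Witt basis\<close>

definition lincomb :: "('k::field_char_0 \<Rightarrow> 'r::ring_1) \<Rightarrow> ('i \<Rightarrow> 'r) \<Rightarrow> ('i \<Rightarrow>\<^sub>0 'k) \<Rightarrow> 'r"
  where "lincomb s M r = (\<Sum>q\<in>Poly_Mapping.keys r. s (Poly_Mapping.lookup r q) * M q)"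

context smash_algebra
begin

lemma lincomb_add: "lincomb s M (p + q) = lincomb s M p + lincomb s M q"
  unfolding lincomb_def by (rule setsum_keys_plus_distrib) (simp_all add: s_add distrib_right)

lemma lincomb_single: "lincomb s M (Poly_Mapping.single q r) = s r * M q"
  by (simp add: lincomb_def)

lemma lincomb_mult:
  assumes "z \<in> range (lincomb s M)" "\<And>q. c * M q \<in> range (lincomb s M')"
  shows "c * z \<in> range (lincomb s M')"
proof -
  from assms(1) obtain r where r: "z = lincomb s M r" by blast
  have "c * lincomb s M r \<in> range (lincomb s M')"
  proof (induction r rule: poly_mapping_additive_induct)
    case (single q r)
    obtain r' where r': "c * M q = lincomb s M' r'" using assms(2)[of q] by blast
    have *: "\<exists>p''. s r * lincomb s M' p = lincomb s M' p''" for p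
    proof (induction p rule: poly_mapping_additive_induct)
      case (single w r')
      show ?case by (rule exI[of _ "Poly_Mapping.single w (r * r')"]) (simp add: lincomb_single s_mult mult.assoc)
    next
      case (add p q)
      then show ?case by (metis distrib_left lincomb_add)
    qed
    show ?case
      using *[of r'] by (auto simp: lincomb_single s_assoc r')
  next
    case (add p q)
    then obtain p' q' where "c * lincomb s M p = lincomb s M' p'" "c * lincomb s M q = lincomb s M' q'" by blast
    then have "c * lincomb s M (p + q) = lincomb s M' (p' + q')"
      by (simp add: lincomb_add distrib_left)
    then show ?case by blast
  qed
  then show ?thesis by (simp add: r)
qed

lemma lincomb_scal: "z \<in> range (lincomb s M) \<Longrightarrow> s r * z \<in> range (lincomb s M)"
  by (erule lincomb_mult) (metis lincomb_single rangeI)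

lemma lincomb_base: "M q \<in> range (lincomb s M)"
  by (metis lincomb_single mult_1 rangeI s_one)

lemma lincomb_mult_scal:
  assumes "z \<in> range (lincomb s M)" "\<And>q. M q * w \<in> range (lincomb s M')"
  shows "z * w \<in> range (lincomb s M')"
proof -
  from assms(1) obtain r where r: "z = lincomb s M r" by blast
  have "lincomb s M r * w \<in> range (lincomb s M')"
  proof (induction r rule: poly_mapping_additive_induct)
    case (single q r)
    then show ?case
      using lincomb_scal[OF assms(2), of r q] by (simp add: lincomb_single mult.assoc)
  next
    case (add p q)
    then obtain p' q' where "lincomb s M p * w = lincomb s M' p'" "lincomb s M q * w = lincomb s M' q'" by blast
    then have "lincomb s M (p + q) * w = lincomb s M' (p' + q')"
      by (simp add: lincomb_add distrib_right)
    then show ?case by blast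
  qed
  then show ?thesis by (simp add: r)
qed

lemma alg_gen_lincomb:
  assumes "p \<in> alg_gen s G" "M q0 = 1" "\<And>g q. g \<in> G \<Longrightarrow> \<exists>q'. g * M q = M q'"
  shows "p \<in> range (lincomb s M)"
  using assms(1)
proof (induction rule: alg_gen.induct)
  case (scal r)
  show ?case using lincomb_scal[OF lincomb_base[of M q0], of r] assms(2) by simp
next
  case (mult g p)
  show ?case by (rule lincomb_mult[OF mult(3)]) (metis assms(3) mult(1) lincomb_base)
next
  case (add p q)
  then show ?case by (auto simp flip: lincomb_add)
qed

definition cmono :: "nat \<times> nat \<Rightarrow> 'r"
  where "cmono = (\<lambda>(m, n). al ^ m * be ^ n)"

lemma cpoly_lincomb: "p \<in> cpoly \<Longrightarrow> p \<in> range (lincomb s cmono)"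
proof (rule alg_gen_lincomb)
  show "cmono (0, 0) = 1" by (simp add: cmono_def)
  fix g q assume "g \<in> {al, be}"
  then consider "g = al" | "g = be" by blast
  then show "\<exists>q'. g * cmono q = cmono q'"
  proof cases
    case 1
    then show ?thesis
      by (intro exI[of _ "(Suc (fst q), snd q)"]) (simp add: cmono_def split_def mult.assoc)
  next
    case 2
    have "be * al ^ m = al ^ m * be" for m
      by (rule power_commuting_commutes[symmetric]) (rule be_al[symmetric])
    then have "be * (al ^ m * z) = al ^ m * (be * z)" for m z
      by (metis mult.assoc)
    then show ?thesis using 2
      by (intro exI[of _ "(fst q, Suc (snd q))"]) (simp add: cmono_def split_def)
  qed
qed

end

context semidirect_algebra
begin

definition vmono :: "nat \<times> nat \<times> nat \<times> nat \<Rightarrow> 'b"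
  where "vmono = (\<lambda>(i, j, k, l). x ^ i * (y ^ j * (x1 ^ k * y1 ^ l)))"

lemma vpoly_lincomb: "p \<in> vpoly \<Longrightarrow> p \<in> range (lincomb s vmono)"
proof (rule alg_gen_lincomb)
  show "vmono (0, 0, 0, 0) = 1" by (simp add: vmono_def)
  have pow: "v * (w ^ m * z) = w ^ m * (v * z)" if "v * w = w * v" for v w z :: 'b and m
  proof -
    have "v * w ^ m = w ^ m * v"
      by (rule power_commuting_commutes[symmetric]) (rule that[symmetric])
    then show ?thesis by (metis mult.assoc)
  qed
  fix g q assume "g \<in> {x, y, x1, y1}"
  then consider "g = x" | "g = y" | "g = x1" | "g = y1" by blast
  then show "\<exists>q'. g * vmono q = vmono q'"
  proof cases
    case 1
    then show ?thesis
      by (cases q, intro exI[of _ "(Suc (fst q), snd q)"]) (simp add: vmono_def mult.assoc)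
  next
    case 2
    obtain i j k l where "q = (i, j, k, l)" by (cases q)
    then show ?thesis using 2
      by (intro exI[of _ "(i, Suc j, k, l)"]) (simp add: vmono_def mult.assoc pow V_commute)
  next
    case 3
    obtain i j k l where "q = (i, j, k, l)" by (cases q)
    then show ?thesis using 3
      by (intro exI[of _ "(i, j, Suc k, l)"]) (simp add: vmono_def mult.assoc pow V_commute)
  next
    case 4
    obtain i j k l where "q = (i, j, k, l)" by (cases q)
    then show ?thesis using 4
      by (intro exI[of _ "(i, j, k, Suc l)"]) (simp add: vmono_def mult.assoc pow V_commute)
  qed
qed

definition pbw :: "(nat \<times> nat) \<times> (nat \<times> nat) \<times> (nat \<times> nat \<times> nat \<times> nat) \<Rightarrow> 'b"
  where "pbw = (\<lambda>((a, b), c, v). f ^ a * (cmono c * (vmono v * e ^ b)))"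

lemma nform_lincomb: "z \<in> nform \<Longrightarrow> z \<in> range (lincomb s pbw)"
proof (induction rule: add_span.induct)
  case zero
  show ?case using lincomb_scal[OF lincomb_base, of 0] by auto
next
  case (step p q)
  from step(1) obtain a p' m b where p: "p = f ^ a * (p' * (m * e ^ b))" "p' \<in> cpoly" "m \<in> vpoly"
    unfolding nf_basis_def by blast
  have "m * e ^ b \<in> range (lincomb s (\<lambda>v. vmono v * e ^ b))"
    by (rule lincomb_mult_scal[OF vpoly_lincomb[OF p(3)]]) (rule lincomb_base)
  then have "p' * (m * e ^ b) \<in> range (lincomb s (\<lambda>q. cmono (fst q) * (vmono (snd q) * e ^ b)))"
  proof (intro lincomb_mult_scal[OF cpoly_lincomb[OF p(2)]] lincomb_mult[of "m * e ^ b" "\<lambda>v. vmono v * e ^ b"])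
    fix c v
    show "cmono c * (vmono v * e ^ b) \<in> range (lincomb s (\<lambda>q. cmono (fst q) * (vmono (snd q) * e ^ b)))"
      using lincomb_base[of "\<lambda>q. cmono (fst q) * (vmono (snd q) * e ^ b)" "(c, v)"] by simp
  qed
  then have "p \<in> range (lincomb s pbw)"
    unfolding p(1)
  proof (rule lincomb_mult)
    fix q :: "(nat \<times> nat) \<times> (nat \<times> nat \<times> nat \<times> nat)"
    show "f ^ a * (cmono (fst q) * (vmono (snd q) * e ^ b)) \<in> range (lincomb s pbw)"
      using lincomb_base[of pbw "((a, b), q)"] by (simp add: pbw_def split_def)
  qed
  then show ?case using step(3) by (auto simp flip: lincomb_add)
qed

end

lemma nform_UNIV: "(z :: 'k::field_char_0 uea) \<in> U.nform"
proof -
  have "abs_uea p \<in> U.nform" for p :: "(gl2 + vb) word \<Rightarrow>\<^sub>0 'k"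
  proof (induction p rule: free_algebra_induct)
    case (scalar r)
    show ?case
      using U.nformI[OF alg_gen.scal[of _ r] alg_gen.scal[of _ 1], of 0 0] by simp
  next
    case (gen b p)
    then have "abs_uea (gen b) * abs_uea p \<in> U.nform"
    proof (cases b)
      case (Inl a)
      have h: "abs_uea (gen (Inl Gh)) * z \<in> U.nform" if "z \<in> U.nform" for z :: "'k uea"
        by (subst U.h_eq) (simp add: left_diff_distrib U.nform_diff U.nform_al U.nform_be that)
      have t: "abs_uea (gen (Inl Gt)) * z \<in> U.nform" if "z \<in> U.nform" for z :: "'k uea"
        by (subst U.t_eq) (simp add: distrib_right add_span_add U.nform_al U.nform_be that)
      show ?thesis
        using gen Inl h t U.nform_e U.nform_f by (cases a) auto
    next
      case (Inr v)
      then show ?thesis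
        using gen U.nform_x U.nform_y U.nform_x1 U.nform_y1 by (cases v) auto
    qed
    then show ?case by simp
  next
    case (add p q)
    then show ?case by (simp add: add_span_add)
  qed
  then show ?thesis by (metis abs_uea_cases)
qed

definition sclA :: "'k::field_char_0 \<Rightarrow> 'k uea"
  where "sclA r = abs_uea (Poly_Mapping.single 0 r)"

lemma pbw_spanning: "\<exists>r. z = lincomb sclA U.pbw r"
  using U.nform_lincomb[OF nform_UNIV[of z]] by (auto simp: sclA_def[abs_def])

lift_definition actA :: "'k::field_char_0 uea \<Rightarrow> 'k state \<Rightarrow> 'k state" is act
proof (rule ext)
  fix p q :: "(gl2 + vb) word \<Rightarrow>\<^sub>0 'k" and \<psi>
  assume "p - q \<in> idl UV_rels"
  then show "act p \<psi> = act q \<psi>"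
    using act_idl_UV[of "p - q" \<psi>] by (simp add: act_diff)
qed

lemma actA_abs: "actA (abs_uea p) \<psi> = act p \<psi>"
  by transfer simp

lemma actA_simps [simp]:
  "actA (z + w) \<psi> = actA z \<psi> + actA w \<psi>" "actA (z - w) \<psi> = actA z \<psi> - actA w \<psi>"
  "actA (z * w) \<psi> = actA z (actA w \<psi>)" "actA 0 \<psi> = 0" "actA 1 \<psi> = \<psi>" "actA (sclA r) \<psi> = smul r \<psi>"
  "actA (abs_uea (gen b)) \<psi> = lop b \<psi>"
proof -
  obtain p q where pq: "z = abs_uea p" "w = abs_uea q"
    by (metis abs_uea_cases)
  show "actA (z + w) \<psi> = actA z \<psi> + actA w \<psi>" "actA (z - w) \<psi> = actA z \<psi> - actA w \<psi>"
    "actA (z * w) \<psi> = actA z (actA w \<psi>)"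
    unfolding pq by (simp_all only: actA_abs act_add act_diff act_mult flip: abs_uea_hom)
  show "actA 0 \<psi> = 0" "actA 1 \<psi> = \<psi>"
    using actA_abs[of 0 \<psi>] actA_abs[of 1 \<psi>] by simp_all
  show "actA (sclA r) \<psi> = smul r \<psi>" "actA (abs_uea (gen b)) \<psi> = lop b \<psi>"
    by (simp_all add: sclA_def actA_abs act_scalar act_gen)
qed

lemma actA_power: "actA (z ^ n) \<psi> = (actA z ^^ n) \<psi>"
  by (induction n) simp_all

lemma smul_mono: "smul r (mono_state a b i j k l g) = mono_state a b i j k l (\<lambda>\<alpha> \<beta>. r * g \<alpha> \<beta>)"
  by (simp add: smul_def mono_state_def fun_eq_iff)

lemma add_mono: "mono_state a b i j k l g + mono_state a b i j k l g' = mono_state a b i j k l (\<lambda>\<alpha> \<beta>. g \<alpha> \<beta> + g' \<alpha> \<beta>)"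
  by (auto simp: mono_state_def fun_eq_iff fun_arith)

lemma diff_mono: "mono_state a b i j k l g - mono_state a b i j k l g' = mono_state a b i j k l (\<lambda>\<alpha> \<beta>. g \<alpha> \<beta> - g' \<alpha> \<beta>)"
  by (auto simp: mono_state_def fun_eq_iff fun_arith)

lemma actA_al: "actA U.al (mono_state 0 b i j k l g) = mono_state 0 b i j k l (\<lambda>\<alpha> \<beta>. \<alpha> * g \<alpha> \<beta>)"
  by (subst U.al_def, unfold sclA_def[symmetric], simp add: lop_mono_state smul_mono add_mono smul_add)
    (simp add: field_simps)

lemma actA_be: "actA U.be (mono_state 0 b i j k l g) = mono_state 0 b i j k l (\<lambda>\<alpha> \<beta>. \<beta> * g \<alpha> \<beta>)"
  by (subst U.be_def, unfold sclA_def[symmetric], simp add: lop_mono_state smul_mono diff_mono)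
    (simp add: field_simps)

lemma act_pbw:
  "actA (U.pbw ((a, b), (m, n), (i, j, k, l))) vacuum = mono_state a b i j k l (\<lambda>\<alpha> \<beta>. \<alpha> ^ m * \<beta> ^ n)"
proof -
  have e: "(lop (Inl Ge) ^^ b) vacuum = mono_state 0 b 0 0 0 0 (\<lambda>\<alpha> \<beta>. 1)" for b
    by (induction b) (simp_all add: lop_mono_state)
  have y1: "(lop (Inr Vy1) ^^ l) (mono_state 0 b 0 0 0 0 (\<lambda>\<alpha> \<beta>. 1)) = mono_state 0 b 0 0 0 l (\<lambda>\<alpha> \<beta>. 1)" for b l
    by (induction l) (simp_all add: lop_mono_state)
  have x1: "(lop (Inr Vx1) ^^ k) (mono_state 0 b 0 0 0 l (\<lambda>\<alpha> \<beta>. 1)) = mono_state 0 b 0 0 k l (\<lambda>\<alpha> \<beta>. 1)" for b k l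
    by (induction k) (simp_all add: lop_mono_state)
  have y: "(lop (Inr Vy) ^^ j) (mono_state 0 b 0 0 k l (\<lambda>\<alpha> \<beta>. 1)) = mono_state 0 b 0 j k l (\<lambda>\<alpha> \<beta>. 1)" for b j k l
    by (induction j) (simp_all add: lop_mono_state)
  have x: "(lop (Inr Vx) ^^ i) (mono_state 0 b 0 j k l (\<lambda>\<alpha> \<beta>. 1)) = mono_state 0 b i j k l (\<lambda>\<alpha> \<beta>. 1)" for b i j k l
    by (induction i) (simp_all add: lop_mono_state)
  have be: "(actA U.be ^^ n) (mono_state 0 b i j k l (\<lambda>\<alpha> \<beta>. 1)) = mono_state 0 b i j k l (\<lambda>\<alpha> \<beta>. \<beta> ^ n)" for n
    by (induction n) (simp_all add: actA_be)
  have al: "(actA U.al ^^ m) (mono_state 0 b i j k l g) = mono_state 0 b i j k l (\<lambda>\<alpha> \<beta>. \<alpha> ^ m * g \<alpha> \<beta>)" for m g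
    by (induction m) (simp_all add: actA_al mult.assoc)
  have f: "(lop (Inl Gf) ^^ a) (mono_state 0 b i j k l g) = mono_state a b i j k l g" for g
    by (induction a) (simp_all add: lop_mono_state)
  have L: "actA (abs_uea (gen b)) = lop b" for b
    by (rule ext) simp
  show ?thesis
    by (simp add: U.pbw_def U.cmono_def U.vmono_def actA_power L e y1 x1 y x be al f)
qed

lemma act_pbw_apply:
  "actA (U.pbw ((a', b'), (m, n), (i', j', k', l'))) vacuum a b i j k l \<alpha> \<beta> =
    (if a = a' \<and> b = b' \<and> i = i' \<and> j = j' \<and> k = k' \<and> l = l' then \<alpha> ^ m * \<beta> ^ n else 0)"
  by (subst act_pbw) (simp add: mono_state_def)

lemma act_lincomb_pbw:
  "actA (lincomb sclA U.pbw r) vacuum = (\<Sum>q\<in>Poly_Mapping.keys r. smul (Poly_Mapping.lookup r q) (actA (U.pbw q) vacuum))"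
proof -
  have "actA (\<Sum>q\<in>A. sclA (Poly_Mapping.lookup r q) * U.pbw q) vacuum = (\<Sum>q\<in>A. smul (Poly_Mapping.lookup r q) (actA (U.pbw q) vacuum))" for A
    by (induction A rule: infinite_finite_induct) simp_all
  then show ?thesis by (simp add: lincomb_def)
qed

text \<open>The polynomial is zero as a polynomial in \<open>\<alpha>\<close> for each \<open>\<beta>\<close>, because the field is infinite, and then so are its
  coefficients as polynomials in \<open>\<beta>\<close>.\<close>

lemma two_variable_poly_zero:
  fixes c :: "nat \<times> nat \<Rightarrow> 'k::field_char_0"
  assumes "finite K" "\<And>\<alpha> \<beta>. (\<Sum>(m, n)\<in>K. c (m, n) * (\<alpha> ^ m * \<beta> ^ n)) = 0" "(m, n) \<in> K"
  shows "c (m, n) = 0"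
proof -
  define N where "N = {n. (m, n) \<in> K}"
  have fin: "finite N"
    unfolding N_def by (rule finite_subset[of _ "snd ` K"]) (use assms(1) in \<open>auto simp: image_iff\<close>, force)
  have "(\<Sum>n\<in>N. c (m, n) * \<beta> ^ n) = 0" for \<beta>
  proof -
    define p where "p = (\<Sum>(m, n)\<in>K. monom (c (m, n) * \<beta> ^ n) m)"
    have "poly p \<alpha> = 0" for \<alpha>
      using assms(2)[of \<alpha> \<beta>] by (simp add: p_def poly_sum split_def poly_monom mult_ac)
    then have "p = 0"
      using poly_all_0_iff_0[of p] by blast
    then have "0 = coeff p m" by simp
    also have "\<dots> = (\<Sum>q\<in>K. if fst q = m then c q * \<beta> ^ snd q else 0)"
      by (simp add: p_def coeff_sum split_def)
    also have "\<dots> = (\<Sum>q\<in>{q \<in> K. fst q = m}. c q * \<beta> ^ snd q)"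
      using assms(1) by (simp add: sum.inter_filter)
    also have "\<dots> = (\<Sum>n\<in>N. c (m, n) * \<beta> ^ n)"
      by (rule sum.reindex_bij_witness[of _ "\<lambda>n. (m, n)" snd]) (auto simp: N_def)
    finally show ?thesis by simp
  qed
  define p where "p = (\<Sum>n\<in>N. monom (c (m, n)) n)"
  have "poly p \<beta> = 0" for \<beta>
    using \<open>(\<Sum>n\<in>N. c (m, n) * \<beta> ^ n) = 0\<close> by (simp add: p_def poly_sum poly_monom)
  then have "p = 0"
    using poly_all_0_iff_0[of p] by blast
  then have "0 = coeff p n" by simp
  also have "\<dots> = c (m, n)"
    using fin assms(3) by (simp add: p_def coeff_sum N_def)
  finally show ?thesis by simp
qed

lemma sum_state_apply:
  fixes F :: "'i \<Rightarrow> 'k::field_char_0 state"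
  shows "(\<Sum>q\<in>A. F q) a b i j k l \<alpha> \<beta> = (\<Sum>q\<in>A. F q a b i j k l \<alpha> \<beta>)"
  by (induction A rule: infinite_finite_induct) (simp_all add: fun_arith)

text \<open>This is the linear independence in the Poincare-Birkhoff-Witt theorem. The normal forms span the algebra and their
  actions on the vacuum are linearly independent states, so that an element is determined by its state.\<close>

lemma vacuum_faithful:
  assumes "actA z vacuum = 0"
  shows "z = 0"
proof -
  obtain r where r: "z = lincomb sclA U.pbw r" using pbw_spanning by blast
  have "Poly_Mapping.lookup r q = 0" for q
  proof (rule ccontr)
    assume nz: "Poly_Mapping.lookup r q \<noteq> 0"
    obtain a b m n i j k l where q: "q = ((a, b), (m, n), (i, j, k, l))"
      by (metis surj_pair)
    define K where "K = {(m, n). ((a, b), (m, n), (i, j, k, l)) \<in> Poly_Mapping.keys r}"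
    have "K = (\<lambda>q. fst (snd q)) ` {q \<in> Poly_Mapping.keys r. fst q = (a, b) \<and> snd (snd q) = (i, j, k, l)}"
      by (force simp: K_def)
    then have fin: "finite K" by simp
    have "(\<Sum>(m, n)\<in>K. Poly_Mapping.lookup r ((a, b), (m, n), (i, j, k, l)) * (\<alpha> ^ m * \<beta> ^ n)) = 0" for \<alpha> \<beta>
    proof -
      have "0 = actA z vacuum a b i j k l \<alpha> \<beta>"
        using assms by (simp add: zero_fun_apply)
      also have "\<dots> = (\<Sum>q\<in>Poly_Mapping.keys r. Poly_Mapping.lookup r q * actA (U.pbw q) vacuum a b i j k l \<alpha> \<beta>)"
        by (simp add: r act_lincomb_pbw sum_state_apply smul_def)
      also have "\<dots> = (\<Sum>q\<in>Poly_Mapping.keys r. if fst q = (a, b) \<and> snd (snd q) = (i, j, k, l)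
            then Poly_Mapping.lookup r q * (\<alpha> ^ fst (fst (snd q)) * \<beta> ^ snd (fst (snd q))) else 0)"
        by (rule sum.cong) (auto simp: act_pbw_apply)
      also have "\<dots> = (\<Sum>q | q \<in> Poly_Mapping.keys r \<and> fst q = (a, b) \<and> snd (snd q) = (i, j, k, l).
            Poly_Mapping.lookup r q * (\<alpha> ^ fst (fst (snd q)) * \<beta> ^ snd (fst (snd q))))"
        by (simp add: sum.inter_filter)
      also have "\<dots> = (\<Sum>(m, n)\<in>K. Poly_Mapping.lookup r ((a, b), (m, n), (i, j, k, l)) * (\<alpha> ^ m * \<beta> ^ n))"
        by (rule sum.reindex_bij_witness[of _ "\<lambda>c. ((a, b), c, (i, j, k, l))" "\<lambda>q. fst (snd q)"]) (auto simp: K_def)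
      finally show ?thesis by simp
    qed
    moreover have "(m, n) \<in> K"
      using nz by (simp add: K_def q in_keys_iff)
    ultimately show False
      using two_variable_poly_zero[OF fin, of "\<lambda>c. Poly_Mapping.lookup r ((a, b), c, (i, j, k, l))" m n] nz q by simp
  qed
  then have "r = 0" by (simp add: poly_mapping_eqI)
  then show ?thesis by (simp add: r lincomb_def)
qed

subsection \<open>Functions that are polynomial in each variable\<close>

definition poly_fun :: "('k::field_char_0 \<Rightarrow> 'k) \<Rightarrow> bool"
  where "poly_fun g \<longleftrightarrow> (\<exists>p. \<forall>\<alpha>. g \<alpha> = poly p \<alpha>)"

text \<open>The arguments below vary one variable at a time, so that polynomiality in each variable separately is enough.\<close>

definition sep_poly :: "('k::field_char_0 \<Rightarrow> 'k \<Rightarrow> 'k) \<Rightarrow> bool"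
  where "sep_poly g \<longleftrightarrow> (\<forall>\<beta>. poly_fun (\<lambda>\<alpha>. g \<alpha> \<beta>)) \<and> (\<forall>\<alpha>. poly_fun (g \<alpha>))"

lemma poly_fun_add: "poly_fun g \<Longrightarrow> poly_fun g' \<Longrightarrow> poly_fun (\<lambda>\<alpha>. g \<alpha> + g' \<alpha>)"
  unfolding poly_fun_def by (metis poly_add)

lemma poly_fun_diff: "poly_fun g \<Longrightarrow> poly_fun g' \<Longrightarrow> poly_fun (\<lambda>\<alpha>. g \<alpha> - g' \<alpha>)"
  unfolding poly_fun_def by (metis poly_diff)

lemma poly_fun_mult: "poly_fun g \<Longrightarrow> poly_fun g' \<Longrightarrow> poly_fun (\<lambda>\<alpha>. g \<alpha> * g' \<alpha>)"
  unfolding poly_fun_def by (metis poly_mult)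

lemma poly_fun_const: "poly_fun (\<lambda>\<alpha>. r)"
  unfolding poly_fun_def by (rule exI[of _ "[:r:]"]) simp

lemma poly_fun_id: "poly_fun (\<lambda>\<alpha>. \<alpha>)"
  unfolding poly_fun_def by (rule exI[of _ "[:0, 1:]"]) simp

lemma poly_fun_power: "poly_fun (\<lambda>\<alpha>. \<alpha> ^ n)"
  by (induction n) (simp_all add: poly_fun_const poly_fun_mult poly_fun_id)

lemma poly_fun_eq_zero:
  assumes "poly_fun g" "infinite {\<alpha>. g \<alpha> = 0}"
  shows "g \<alpha> = 0"
proof -
  obtain p where p: "\<forall>\<alpha>. g \<alpha> = poly p \<alpha>" using assms(1) by (auto simp: poly_fun_def)
  then have "infinite {\<alpha>. poly p \<alpha> = 0}" using assms(2) by simp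
  then have "p = 0" using poly_roots_finite by blast
  then show ?thesis by (simp add: p)
qed

text \<open>In characteristic zero, \<open>g\<close> takes the value \<open>g \<beta>\<close> at the infinitely many points \<open>\<beta> + n\<close>.\<close>

lemma poly_fun_periodic:
  fixes g :: "'k::field_char_0 \<Rightarrow> 'k"
  assumes "poly_fun g" "\<And>\<alpha>. g (\<alpha> + 1) = g \<alpha>"
  shows "g \<alpha> = g \<beta>"
proof -
  have n: "g (\<beta> + of_nat n) = g \<beta>" for n
    by (induction n) (simp_all add: assms(2) add.assoc[symmetric] add.commute[of 1])
  have "infinite {\<alpha>. g \<alpha> - g \<beta> = 0}"
  proof (rule infinite_super)
    show "range (\<lambda>n::nat. \<beta> + of_nat n) \<subseteq> {\<alpha>. g \<alpha> - g \<beta> = 0}"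
      using n by auto
    show "infinite (range (\<lambda>n::nat. \<beta> + of_nat n))"
      by (rule range_inj_infinite) (simp add: inj_def)
  qed
  then have "g \<alpha> - g \<beta> = 0"
    by (rule poly_fun_eq_zero[rotated]) (intro poly_fun_diff assms(1) poly_fun_const)
  then show ?thesis by simp
qed

lemma sep_poly_act_vacuum: "sep_poly (actA z vacuum a b i j k l)"
proof -
  obtain r where r: "z = lincomb sclA U.pbw r" using pbw_spanning by blast
  have "sep_poly (\<lambda>\<alpha> \<beta>. \<Sum>q\<in>A. Poly_Mapping.lookup r q * actA (U.pbw q) vacuum a b i j k l \<alpha> \<beta>)" for A
  proof (induction A rule: infinite_finite_induct)
    case (insert q A)
    obtain a' b' m n i' j' k' l' where q: "q = ((a', b'), (m, n), (i', j', k', l'))"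
      by (metis surj_pair)
    have "sep_poly (\<lambda>\<alpha> \<beta>. Poly_Mapping.lookup r q * actA (U.pbw q) vacuum a b i j k l \<alpha> \<beta>)"
      unfolding q act_pbw_apply sep_poly_def
      by (cases "a = a' \<and> b = b' \<and> i = i' \<and> j = j' \<and> k = k' \<and> l = l'")
        (auto intro!: poly_fun_mult poly_fun_const poly_fun_power)
    with insert show ?case
      by (simp add: sep_poly_def poly_fun_add)
  qed (simp_all add: sep_poly_def poly_fun_const)
  moreover have "actA z vacuum a b i j k l = (\<lambda>\<alpha> \<beta>. \<Sum>q\<in>Poly_Mapping.keys r. Poly_Mapping.lookup r q * actA (U.pbw q) vacuum a b i j k l \<alpha> \<beta>)"
    by (intro ext) (simp add: r act_lincomb_pbw sum_state_apply smul_def)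
  ultimately show ?thesis by simp
qed

text \<open>An element is a finite combination of normal forms, which bounds the exponents of \<open>f\<close> and \<open>x\<close> in its state.\<close>

lemma bounded_act_vacuum: "\<exists>B. \<forall>a b i j k l. (B \<le> a \<or> B \<le> i) \<longrightarrow> actA z vacuum a b i j k l = (\<lambda>\<alpha> \<beta>. 0)"
proof -
  obtain r where r: "z = lincomb sclA U.pbw r" using pbw_spanning by blast
  have "finite ((\<lambda>q. fst (fst q) + fst (snd (snd q))) ` Poly_Mapping.keys r)" by simp
  then obtain B where B: "\<forall>q \<in> Poly_Mapping.keys r. fst (fst q) + fst (snd (snd q)) < B"
    using finite_nat_set_iff_bounded by (metis (no_types, lifting) image_eqI)
  have "actA z vacuum a b i j k l \<alpha> \<beta> = 0" if "B \<le> a \<or> B \<le> i" for a b i j k l \<alpha> \<beta>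
  proof -
    have "actA z vacuum a b i j k l \<alpha> \<beta> = (\<Sum>q\<in>Poly_Mapping.keys r. Poly_Mapping.lookup r q * actA (U.pbw q) vacuum a b i j k l \<alpha> \<beta>)"
      by (simp add: r act_lincomb_pbw sum_state_apply smul_def)
    also have "\<dots> = 0"
    proof (rule sum.neutral, rule ballI)
      fix q assume q: "q \<in> Poly_Mapping.keys r"
      obtain a' b' m n i' j' k' l' where "q = ((a', b'), (m, n), (i', j', k', l'))"
        by (metis surj_pair)
      then show "Poly_Mapping.lookup r q * actA (U.pbw q) vacuum a b i j k l \<alpha> \<beta> = 0"
        using B q that by (auto simp: act_pbw_apply dest!: bspec)
    qed
    finally show ?thesis .
  qed
  then show ?thesis by (intro exI[of _ B]) (auto simp: fun_eq_iff)
qed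

section \<open>The center of the enveloping algebra of \<open>gl\<^sub>2 \<ltimes> V\<close>\<close>

subsection \<open>The generators \<open>b\<close> and \<open>d\<close>\<close>

context smash_algebra
begin

definition bel :: 'r where "bel = y1 * x - x1 * y"

definition del :: 'r
  where "del = t * (y1 * x - x1 * y) - (2 * e * y1 * y + h * (y1 * x + x1 * y) - 2 * f * x1 * x)"

lemma del_commutes_g: "e * del = del * e" "f * del = del * f" "h * del = del * h" "t * del = del * t"
  by (simp_all add: del_def algebra_simps mult_2 order order_assoc)

lemma bel_commutes_g: "e * bel = bel * e" "f * bel = bel * f" "h * bel = bel * h" "t * bel = bel * t"
  by (simp_all add: bel_def algebra_simps order order_assoc)

end

context semidirect_algebra
begin

lemma V_commute_assoc: "y * (x * a) = x * (y * a)" "x1 * (x * a) = x * (x1 * a)" "x1 * (y * a) = y * (x1 * a)"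
    "y1 * (x * a) = x * (y1 * a)" "y1 * (y * a) = y * (y1 * a)" "y1 * (x1 * a) = x1 * (y1 * a)"
  by (simp_all only: mult.assoc[symmetric] V_commute)

lemma del_commutes_V: "x * del = del * x" "y * del = del * y" "x1 * del = del * x1" "y1 * del = del * y1"
  by (simp_all add: del_def algebra_simps mult_2 order order_assoc V_commute V_commute_assoc)

lemma bel_commutes_V: "x * bel = bel * x" "y * bel = bel * y" "x1 * bel = bel * x1" "y1 * bel = bel * y1"
  by (simp_all add: bel_def algebra_simps V_commute V_commute_assoc)

end

text \<open>The states of elements that commute with \<open>V\<close>. Comparing coefficients turns commuting into difference
  equations; polynomial solutions of such equations are rigid, whence the second condition.\<close>

definition V_central :: "'k::field_char_0 state \<Rightarrow> bool"
  where "V_central \<psi> \<longleftrightarrow> (\<forall>v. lop (Inr v) \<psi> = rop (Inr v) \<psi>) \<and> (\<forall>a b i j k l. sep_poly (\<psi> a b i j k l))"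

lemma V_centralD:
  assumes "V_central \<psi>"
  shows "(if i = 0 then 0 else \<psi> a b (i - 1) j k l (\<alpha> - 1) \<beta>) - (if j = 0 then 0 else of_nat (Suc a) * \<psi> (Suc a) b i (j - 1) k l \<alpha> (\<beta> - 1))
      = (if i = 0 then 0 else \<psi> a b (i - 1) j k l \<alpha> \<beta>)"
    and "(if j = 0 then 0 else \<psi> a b i (j - 1) k l \<alpha> (\<beta> - 1)) = (if j = 0 then 0 else \<psi> a b i (j - 1) k l \<alpha> \<beta>)
      + (if i = 0 then 0 else of_nat (Suc b) * \<psi> a (Suc b) (i - 1) j k l \<alpha> \<beta>)"
    and "(if k = 0 then 0 else \<psi> a b i j (k - 1) l \<alpha> (\<beta> + 1)) - (if l = 0 then 0 else of_nat (Suc a) * \<psi> (Suc a) b i j k (l - 1) (\<alpha> + 1) \<beta>)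
      = (if k = 0 then 0 else \<psi> a b i j (k - 1) l \<alpha> \<beta>)"
    and "(if l = 0 then 0 else \<psi> a b i j k (l - 1) (\<alpha> + 1) \<beta>) = (if l = 0 then 0 else \<psi> a b i j k (l - 1) \<alpha> \<beta>)
      + (if k = 0 then 0 else of_nat (Suc b) * \<psi> a (Suc b) i j (k - 1) l \<alpha> \<beta>)"
    and "sep_poly (\<psi> a b i j k l)"
proof -
  have "lop (Inr v) \<psi> a b i j k l \<alpha> \<beta> = rop (Inr v) \<psi> a b i j k l \<alpha> \<beta>" for v
    using assms by (simp add: V_central_def)
  from this[of Vx] this[of Vy] this[of Vx1] this[of Vy1] assms
  show "(if i = 0 then 0 else \<psi> a b (i - 1) j k l (\<alpha> - 1) \<beta>) - (if j = 0 then 0 else of_nat (Suc a) * \<psi> (Suc a) b i (j - 1) k l \<alpha> (\<beta> - 1))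
      = (if i = 0 then 0 else \<psi> a b (i - 1) j k l \<alpha> \<beta>)"
    and "(if j = 0 then 0 else \<psi> a b i (j - 1) k l \<alpha> (\<beta> - 1)) = (if j = 0 then 0 else \<psi> a b i (j - 1) k l \<alpha> \<beta>)
      + (if i = 0 then 0 else of_nat (Suc b) * \<psi> a (Suc b) (i - 1) j k l \<alpha> \<beta>)"
    and "(if k = 0 then 0 else \<psi> a b i j (k - 1) l \<alpha> (\<beta> + 1)) - (if l = 0 then 0 else of_nat (Suc a) * \<psi> (Suc a) b i j k (l - 1) (\<alpha> + 1) \<beta>)
      = (if k = 0 then 0 else \<psi> a b i j (k - 1) l \<alpha> \<beta>)"
    and "(if l = 0 then 0 else \<psi> a b i j k (l - 1) (\<alpha> + 1) \<beta>) = (if l = 0 then 0 else \<psi> a b i j k (l - 1) \<alpha> \<beta>)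
      + (if k = 0 then 0 else of_nat (Suc b) * \<psi> a (Suc b) i j (k - 1) l \<alpha> \<beta>)"
    and "sep_poly (\<psi> a b i j k l)"
    unfolding lop.simps rop.simps by (auto simp: V_central_def)
qed

lemma V_centralI:
  assumes "\<And>a b i j k l \<alpha> \<beta>. (if i = 0 then 0 else \<psi> a b (i - 1) j k l (\<alpha> - 1) \<beta>) - (if j = 0 then 0 else of_nat (Suc a) * \<psi> (Suc a) b i (j - 1) k l \<alpha> (\<beta> - 1))
      = (if i = 0 then 0 else \<psi> a b (i - 1) j k l \<alpha> \<beta>)"
    and "\<And>a b i j k l \<alpha> \<beta>. (if j = 0 then 0 else \<psi> a b i (j - 1) k l \<alpha> (\<beta> - 1)) = (if j = 0 then 0 else \<psi> a b i (j - 1) k l \<alpha> \<beta>)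
      + (if i = 0 then 0 else of_nat (Suc b) * \<psi> a (Suc b) (i - 1) j k l \<alpha> \<beta>)"
    and "\<And>a b i j k l \<alpha> \<beta>. (if k = 0 then 0 else \<psi> a b i j (k - 1) l \<alpha> (\<beta> + 1)) - (if l = 0 then 0 else of_nat (Suc a) * \<psi> (Suc a) b i j k (l - 1) (\<alpha> + 1) \<beta>)
      = (if k = 0 then 0 else \<psi> a b i j (k - 1) l \<alpha> \<beta>)"
    and "\<And>a b i j k l \<alpha> \<beta>. (if l = 0 then 0 else \<psi> a b i j k (l - 1) (\<alpha> + 1) \<beta>) = (if l = 0 then 0 else \<psi> a b i j k (l - 1) \<alpha> \<beta>)
      + (if k = 0 then 0 else of_nat (Suc b) * \<psi> a (Suc b) i j (k - 1) l \<alpha> \<beta>)"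
    and "\<And>a b i j k l. sep_poly (\<psi> a b i j k l)"
  shows "V_central \<psi>"
proof -
  have "lop (Inr v) \<psi> = rop (Inr v) \<psi>" for v
    by (cases v) (simp_all only: lop.simps rop.simps fun_eq_iff assms, simp_all)
  then show ?thesis using assms(5) by (simp add: V_central_def)
qed

definition f_degree_le :: "nat \<Rightarrow> 'k::field_char_0 state \<Rightarrow> bool"
  where "f_degree_le m \<psi> \<longleftrightarrow> (\<forall>a b i j k l \<alpha> \<beta>. m < a \<longrightarrow> \<psi> a b i j k l \<alpha> \<beta> = 0)"

text \<open>Without \<open>f\<close>, commuting with \<open>x\<close> and \<open>x\<^sub>1\<close> means that the coefficients have period \<open>1\<close> in \<open>\<alpha>\<close> and in \<open>\<beta>\<close>, so
  that they are constant. Commuting with \<open>y\<close> then excludes \<open>e\<close>.\<close>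

lemma V_central_f_degree_0:
  assumes V: "V_central \<psi>" and deg: "f_degree_le 0 \<psi>"
  shows "\<exists>s. \<forall>b i j k l \<alpha> \<beta>. \<psi> 0 b i j k l \<alpha> \<beta> = (if b = 0 then s i j k l else 0)"
proof -
  have z: "\<psi> (Suc a) b i j k l \<alpha> \<beta> = 0" for a b i j k l \<alpha> \<beta>
    using deg by (simp add: f_degree_le_def)
  have "\<psi> 0 b i j k l (\<alpha> - 1) \<beta> = \<psi> 0 b i j k l \<alpha> \<beta>" for b i j k l \<alpha> \<beta>
    using V_centralD(1)[OF V, of "Suc i" 0 b j k l \<alpha> \<beta>] by (simp add: z split: if_splits)
  from this[of _ _ _ _ _ "_ + 1"] have "\<psi> 0 b i j k l (\<alpha> + 1) \<beta> = \<psi> 0 b i j k l \<alpha> \<beta>" for b i j k l \<alpha> \<beta>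
    by simp
  then have c\<alpha>: "\<psi> 0 b i j k l \<alpha> \<beta> = \<psi> 0 b i j k l 0 \<beta>" for b i j k l \<alpha> \<beta>
    using poly_fun_periodic[of "\<lambda>\<alpha>. \<psi> 0 b i j k l \<alpha> \<beta>" \<alpha> 0] V_centralD(5)[OF V] by (simp add: sep_poly_def)
  have "\<psi> 0 b i j k l \<alpha> (\<beta> + 1) = \<psi> 0 b i j k l \<alpha> \<beta>" for b i j k l \<alpha> \<beta>
    using V_centralD(3)[OF V, of "Suc k" 0 b i j l \<alpha> \<beta>] by (simp add: z split: if_splits)
  then have c: "\<psi> 0 b i j k l \<alpha> \<beta> = \<psi> 0 b i j k l 0 0" for b i j k l \<alpha> \<beta>
    using poly_fun_periodic[of "\<lambda>\<beta>. \<psi> 0 b i j k l 0 \<beta>" \<beta> 0] V_centralD(5)[OF V] c\<alpha>[of b i j k l \<alpha> \<beta>]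
    by (simp add: sep_poly_def)
  have "\<psi> 0 (Suc b) i j k l 0 0 = 0" for b i j k l
  proof -
    have "of_nat (Suc b) * \<psi> 0 (Suc b) i j k l 0 0 = 0"
      using V_centralD(2)[OF V, of j 0 b "Suc i" k l 0 0] c[of b "Suc i" "j - 1" k l 0 "0 - 1"]
      by (simp split: if_splits del: of_nat_Suc)
    then show ?thesis by (simp del: of_nat_Suc)
  qed
  then have "\<psi> 0 b i j k l \<alpha> \<beta> = (if b = 0 then \<psi> 0 0 i j k l 0 0 else 0)" for b i j k l \<alpha> \<beta>
    using c[of b i j k l \<alpha> \<beta>] by (cases b) simp_all
  then show ?thesis by (intro exI[of _ "\<lambda>i j k l. \<psi> 0 0 i j k l 0 0"]) blast
qed

text \<open>The equations for \<open>x\<close> and \<open>x\<^sub>1\<close> show that the part of positive degree in \<open>f\<close> is divisible by \<open>x\<close> and by \<open>x\<^sub>1\<close>.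
  Differentiating with respect to \<open>f\<close> and dividing by \<open>x x\<^sub>1\<close> gives a state that satisfies the same equations
  and has lower degree in \<open>f\<close>.\<close>

lemma V_central_top:
  assumes "V_central \<psi>" "f_degree_le m \<psi>"
  shows "\<exists>s. \<forall>b i j k l \<alpha> \<beta>. \<psi> m b i j k l \<alpha> \<beta> = (if b = 0 \<and> m \<le> i \<and> m \<le> k then s (i - m) j (k - m) l else 0)"
  using assms
proof (induction m arbitrary: \<psi>)
  case 0
  then obtain s where "\<And>b i j k l \<alpha> \<beta>. \<psi> 0 b i j k l \<alpha> \<beta> = (if b = 0 then s i j k l else 0)"
    using V_central_f_degree_0 by blast
  then show ?case by (intro exI[of _ s]) simp
next
  case (Suc m)
  define \<phi> where "\<phi> = (\<lambda>a b i j k l \<alpha> \<beta>. of_nat (Suc a) * \<psi> (Suc a) b (Suc i) j (Suc k) l \<alpha> \<beta>)"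
  note V = V_centralD[OF Suc.prems(1)]
  have i0: "\<psi> (Suc a) b 0 j k l \<alpha> \<beta> = 0" for a b j k l \<alpha> \<beta>
    using V(1)[of 0 a b "Suc j" k l \<alpha> "\<beta> + 1"] by (simp del: of_nat_Suc)
  have k0: "\<psi> (Suc a) b i j 0 l \<alpha> \<beta> = 0" for a b i j l \<alpha> \<beta>
    using V(3)[of 0 a b i j "Suc l" "\<alpha> - 1" \<beta>] by (simp del: of_nat_Suc)
  have \<phi>: "V_central \<phi>"
  proof (rule V_centralI)
    fix a b i j k l \<alpha> \<beta>
    show "sep_poly (\<phi> a b i j k l)"
      unfolding \<phi>_def using V(5) by (simp add: sep_poly_def poly_fun_mult poly_fun_const)
    show "(if i = 0 then 0 else \<phi> a b (i - 1) j k l (\<alpha> - 1) \<beta>) - (if j = 0 then 0 else of_nat (Suc a) * \<phi> (Suc a) b i (j - 1) k l \<alpha> (\<beta> - 1))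
      = (if i = 0 then 0 else \<phi> a b (i - 1) j k l \<alpha> \<beta>)"
      using arg_cong[OF V(1)[of "Suc i" "Suc a" b j "Suc k" l \<alpha> \<beta>], of "\<lambda>u. of_nat (Suc a) * u"]
      by (cases i; cases j) (simp_all add: \<phi>_def i0 right_diff_distrib mult.assoc del: of_nat_Suc)
    show "(if j = 0 then 0 else \<phi> a b i (j - 1) k l \<alpha> (\<beta> - 1)) = (if j = 0 then 0 else \<phi> a b i (j - 1) k l \<alpha> \<beta>)
      + (if i = 0 then 0 else of_nat (Suc b) * \<phi> a (Suc b) (i - 1) j k l \<alpha> \<beta>)"
      using arg_cong[OF V(2)[of j "Suc a" b "Suc i" "Suc k" l \<alpha> \<beta>], of "\<lambda>u. of_nat (Suc a) * u"]
      by (cases i; cases j) (simp_all add: \<phi>_def i0 distrib_left mult.left_commute del: of_nat_Suc)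
    show "(if k = 0 then 0 else \<phi> a b i j (k - 1) l \<alpha> (\<beta> + 1)) - (if l = 0 then 0 else of_nat (Suc a) * \<phi> (Suc a) b i j k (l - 1) (\<alpha> + 1) \<beta>)
      = (if k = 0 then 0 else \<phi> a b i j (k - 1) l \<alpha> \<beta>)"
      using arg_cong[OF V(3)[of "Suc k" "Suc a" b "Suc i" j l \<alpha> \<beta>], of "\<lambda>u. of_nat (Suc a) * u"]
      by (cases k; cases l) (simp_all add: \<phi>_def k0 right_diff_distrib mult.assoc del: of_nat_Suc)
    show "(if l = 0 then 0 else \<phi> a b i j k (l - 1) (\<alpha> + 1) \<beta>) = (if l = 0 then 0 else \<phi> a b i j k (l - 1) \<alpha> \<beta>)
      + (if k = 0 then 0 else of_nat (Suc b) * \<phi> a (Suc b) i j (k - 1) l \<alpha> \<beta>)"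
      using arg_cong[OF V(4)[of l "Suc a" b "Suc i" j "Suc k" \<alpha> \<beta>], of "\<lambda>u. of_nat (Suc a) * u"]
      by (cases k; cases l) (simp_all add: \<phi>_def k0 distrib_left mult.left_commute del: of_nat_Suc)
  qed
  moreover have "f_degree_le m \<phi>"
    using Suc.prems(2) by (simp add: f_degree_le_def \<phi>_def)
  ultimately obtain s where s: "\<And>b i j k l \<alpha> \<beta>. \<phi> m b i j k l \<alpha> \<beta> = (if b = 0 \<and> m \<le> i \<and> m \<le> k then s (i - m) j (k - m) l else 0)"
    using Suc.IH by blast
  have "\<psi> (Suc m) b i j k l \<alpha> \<beta> = (if b = 0 \<and> Suc m \<le> i \<and> Suc m \<le> k then s (i - Suc m) j (k - Suc m) l / of_nat (Suc m) else 0)"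
    for b i j k l \<alpha> \<beta>
  proof (cases "i = 0 \<or> k = 0")
    case True
    then show ?thesis using i0 k0 by auto
  next
    case False
    then obtain i' k' where "i = Suc i'" "k = Suc k'" by (meson not0_implies_Suc)
    then show ?thesis
      using s[of b i' j k' l \<alpha> \<beta>] unfolding \<phi>_def by (auto simp: field_simps split: if_splits simp del: of_nat_Suc)
  qed
  then show ?case
    by (intro exI[of _ "\<lambda>i j k l. s i j k l / of_nat (Suc m)"]) blast
qed

lemma act_mult_gen:
  assumes "b \<noteq> Inl Gf"
  shows "actA (z * abs_uea (gen b)) vacuum = rop b (actA z vacuum)"
proof -
  obtain p where p: "z = abs_uea p" by (rule abs_uea_cases)
  have "actA (abs_uea (p * gen b)) vacuum = rop b (actA (abs_uea p) vacuum)"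
    using act_mult_gen_vacuum[OF assms] by (simp only: actA_abs)
  then show ?thesis by (simp only: p abs_uea_hom)
qed

definition uea_central :: "'k::field_char_0 uea \<Rightarrow> bool"
  where "uea_central z \<longleftrightarrow> (\<forall>b. z * abs_uea (gen b) = abs_uea (gen b) * z)"

lemma uea_central_state:
  assumes "uea_central z" "b \<noteq> Inl Gf"
  shows "lop b (actA z vacuum) = rop b (actA z vacuum)"
proof -
  have "actA (z * abs_uea (gen b)) vacuum = actA (abs_uea (gen b) * z) vacuum"
    using assms(1) by (simp add: uea_central_def)
  then show ?thesis unfolding act_mult_gen[OF assms(2)] by simp
qed

lemma uea_central_V_central: "uea_central z \<Longrightarrow> V_central (actA z vacuum)"
  by (simp add: V_central_def uea_central_state sep_poly_act_vacuum)

text \<open>The coefficient of \<open>f\<^sup>m\<close> is \<open>(x x\<^sub>1)\<^sup>m s\<close> by the preceding lemma. Commuting with \<open>h\<close> and \<open>t\<close> leaves in \<open>s\<close> only the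
  monomials \<open>x\<^sup>i y\<^sup>j x\<^sub>1\<^sup>j y\<^sub>1\<^sup>i\<close>, and commuting with \<open>e\<close> is a recursion that determines all their coefficients
  from those with \<open>j = 0\<close>. The latter are the values assumed to be zero.\<close>

lemma uea_central_top_zero:
  assumes z: "uea_central z" and deg: "f_degree_le m (actA z vacuum)"
    and zero: "\<And>n. actA z vacuum m 0 (n + m) 0 m n 0 0 = 0"
  shows "actA z vacuum m b i j k l \<alpha> \<beta> = 0"
proof -
  obtain s where s: "\<And>b i j k l \<alpha> \<beta>. actA z vacuum m b i j k l \<alpha> \<beta> = (if b = 0 \<and> m \<le> i \<and> m \<le> k then s (i - m) j (k - m) l else 0)"
    using V_central_top[OF uea_central_V_central[OF z] deg] by blast
  have s': "actA z vacuum m 0 (i + m) j (k + m) l \<alpha> \<beta> = s i j k l" for i j k l \<alpha> \<beta>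
    by (simp add: s)
  have h: "s i j k l = 0" if "i + k \<noteq> j + l" for i j k l
  proof -
    have "lop (Inl Gh) (actA z vacuum) m 0 (i + m) j (k + m) l 0 0 = rop (Inl Gh) (actA z vacuum) m 0 (i + m) j (k + m) l 0 0"
      by (simp add: uea_central_state[OF z])
    then have "(of_nat (i + k) - of_nat (j + l)) * s i j k l = 0"
      unfolding lop.simps rop.simps s' by (simp add: algebra_simps)
    moreover have "of_nat (i + k) \<noteq> (of_nat (j + l) :: 'a)"
      using that of_nat_eq_iff by blast
    ultimately show ?thesis by (simp del: of_nat_add)
  qed
  have t: "s i j k l = 0" if "i + j \<noteq> k + l" for i j k l
  proof -
    have "lop (Inl Gt) (actA z vacuum) m 0 (i + m) j (k + m) l 0 0 = rop (Inl Gt) (actA z vacuum) m 0 (i + m) j (k + m) l 0 0"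
      by (simp add: uea_central_state[OF z])
    then have "(of_nat (i + j) - of_nat (k + l)) * s i j k l = 0"
      unfolding lop.simps rop.simps s' by (simp add: algebra_simps)
    moreover have "of_nat (i + j) \<noteq> (of_nat (k + l) :: 'a)"
      using that of_nat_eq_iff by blast
    ultimately show ?thesis by (simp del: of_nat_add)
  qed
  have e: "of_nat (Suc j) * s i (Suc j) (Suc j) i + of_nat (Suc i) * s (Suc i) j j (Suc i) = 0" for i j
  proof -
    have top: "actA z vacuum (Suc m) b i j k l \<alpha> \<beta> = 0" for b i j k l \<alpha> \<beta>
      using deg by (simp add: f_degree_le_def)
    have "lop (Inl Ge) (actA z vacuum) m 0 (Suc i + m) j (Suc j + m) i 0 0 = rop (Inl Ge) (actA z vacuum) m 0 (Suc i + m) j (Suc j + m) i 0 0"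
      by (simp add: uea_central_state[OF z])
    then show ?thesis
      using s'[of i "Suc j" "Suc j" i "-1" 1] s'[of "Suc i" j j "Suc i" "-1" 1]
      unfolding lop.simps rop.simps by (simp add: top del: of_nat_Suc)
  qed
  have "s i j j i = 0" for i j
  proof (induction j arbitrary: i)
    case 0
    show ?case using zero[of i] s'[of i 0 0 i 0 0] by simp
  next
    case (Suc j)
    then show ?case using e[of j i] by (simp del: of_nat_Suc)
  qed
  moreover have "i = l \<and> j = k" if "i + k = j + l" "i + j = k + l" for i j k l :: nat
    using that by linarith
  ultimately have "s i j k l = 0" for i j k l
    using h[of i k j l] t[of i j k l] by metis
  then show ?thesis by (simp add: s)
qed

abbreviation bA :: "'k::field_char_0 uea" where "bA \<equiv> U.bel"
abbreviation dA :: "'k::field_char_0 uea" where "dA \<equiv> U.del"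

lemma uea_centralI:
  assumes "abs_uea (gen (Inl Ge)) * z = z * abs_uea (gen (Inl Ge))" "abs_uea (gen (Inl Gf)) * z = z * abs_uea (gen (Inl Gf))"
    "abs_uea (gen (Inl Gh)) * z = z * abs_uea (gen (Inl Gh))" "abs_uea (gen (Inl Gt)) * z = z * abs_uea (gen (Inl Gt))"
    "abs_uea (gen (Inr Vx)) * z = z * abs_uea (gen (Inr Vx))" "abs_uea (gen (Inr Vy)) * z = z * abs_uea (gen (Inr Vy))"
    "abs_uea (gen (Inr Vx1)) * z = z * abs_uea (gen (Inr Vx1))" "abs_uea (gen (Inr Vy1)) * z = z * abs_uea (gen (Inr Vy1))"
  shows "uea_central z"
  unfolding uea_central_def
proof
  fix b :: "gl2 + vb"
  show "z * abs_uea (gen b) = abs_uea (gen b) * z"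
  proof (cases b)
    case (Inl a)
    then show ?thesis using assms by (cases a) simp_all
  next
    case (Inr v)
    then show ?thesis using assms by (cases v) simp_all
  qed
qed

lemma uea_central_b: "uea_central bA"
  by (rule uea_centralI) (fact U.bel_commutes_g U.bel_commutes_V)+

lemma uea_central_d: "uea_central dA"
  by (rule uea_centralI) (fact U.del_commutes_g U.del_commutes_V)+

lemma uea_central_mult: "uea_central z \<Longrightarrow> uea_central w \<Longrightarrow> uea_central (z * w)"
  unfolding uea_central_def by (metis mult.assoc)

lemma uea_central_diff: "uea_central z \<Longrightarrow> uea_central w \<Longrightarrow> uea_central (z - w)"
  unfolding uea_central_def by (simp add: left_diff_distrib right_diff_distrib)

lemma uea_central_add: "uea_central z \<Longrightarrow> uea_central w \<Longrightarrow> uea_central (z + w)"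
  unfolding uea_central_def by (simp add: distrib_left distrib_right)

lemma uea_central_scl: "uea_central (sclA r)"
  unfolding uea_central_def sclA_def by (metis U.s_commute)

lemma uea_central_power: "uea_central z \<Longrightarrow> uea_central (z ^ n)"
  by (induction n) (simp_all add: uea_central_mult, simp add: uea_central_def)

lemma uea_central_sum: "(\<And>i. i \<in> A \<Longrightarrow> uea_central (F i)) \<Longrightarrow> uea_central (sum F A)"
  by (induction A rule: infinite_finite_induct) (simp_all add: uea_central_add, simp_all add: uea_central_def)

lemma act_b: "actA bA \<psi> = lop (Inr Vy1) (lop (Inr Vx) \<psi>) - lop (Inr Vx1) (lop (Inr Vy) \<psi>)"
  by (simp add: U.bel_def)

lemma actA_two [simp]: "actA 2 \<psi> = \<psi> + \<psi>"
  using actA_simps(1)[of 1 1 \<psi>] by simp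

lemma act_d: "actA dA \<psi> =
    lop (Inl Gt) (lop (Inr Vy1) (lop (Inr Vx) \<psi>) - lop (Inr Vx1) (lop (Inr Vy) \<psi>)) -
    (lop (Inl Ge) (lop (Inr Vy1) (lop (Inr Vy) \<psi>)) + lop (Inl Ge) (lop (Inr Vy1) (lop (Inr Vy) \<psi>)) +
     lop (Inl Gh) (lop (Inr Vy1) (lop (Inr Vx) \<psi>) + lop (Inr Vx1) (lop (Inr Vy) \<psi>)) -
     (lop (Inl Gf) (lop (Inr Vx1) (lop (Inr Vx) \<psi>)) + lop (Inl Gf) (lop (Inr Vx1) (lop (Inr Vx) \<psi>))))"
  by (simp add: U.del_def)

text \<open>The summand \<open>2 f x\<^sub>1 x\<close> of \<open>d\<close> is the only one that raises the degree in \<open>f\<close>. It multiplies the top coefficient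
  by \<open>2 x x\<^sub>1\<close>.\<close>

lemma f_degree_d:
  assumes "f_degree_le m \<psi>"
  shows "f_degree_le (Suc m) (actA dA \<psi>)"
    and "actA dA \<psi> (Suc m) b i j k l \<alpha> \<beta> = (if i = 0 \<or> k = 0 then 0 else 2 * \<psi> m b (i - 1) j (k - 1) l (\<alpha> - 1) (\<beta> + 1))"
  using assms by (auto simp: act_d f_degree_le_def lop.simps fun_arith)

lemma f_degree_b:
  assumes "f_degree_le 0 \<psi>"
  shows "f_degree_le 0 (actA bA \<psi>)"
    and "actA bA \<psi> 0 0 i 0 0 l \<alpha> \<beta> = (if i = 0 \<or> l = 0 then 0 else \<psi> 0 0 (i - 1) 0 0 (l - 1) \<alpha> \<beta>)"
  using assms by (auto simp: act_b f_degree_le_def lop.simps fun_arith)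

lemma state_b_power:
  "f_degree_le 0 (actA (bA ^ n :: 'k::field_char_0 uea) vacuum) \<and> (\<forall>i l \<alpha> \<beta>. actA (bA ^ n :: 'k uea) vacuum 0 0 i 0 0 l \<alpha> \<beta> = (if i = n \<and> l = n then 1 else 0))"
proof (induction n)
  case 0
  show ?case by (simp add: f_degree_le_def mono_state_def)
next
  case (Suc n)
  then show ?case by (auto simp: f_degree_b)
qed

text \<open>The coefficient of \<open>f\<^sup>m x\<^sup>n\<^sup>+\<^sup>m x\<^sub>1\<^sup>m y\<^sub>1\<^sup>n\<close> is the one that detects \<open>d\<^sup>m b\<^sup>n\<close>.\<close>

lemma state_d_power_b_power:
  "f_degree_le m (actA (dA ^ m * bA ^ n :: 'k::field_char_0 uea) vacuum) \<and>
   (\<forall>n' \<alpha> \<beta>. actA (dA ^ m * bA ^ n :: 'k uea) vacuum m 0 (n' + m) 0 m n' \<alpha> \<beta> = (if n' = n then 2 ^ m else 0))"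
proof (induction m)
  case 0
  then show ?case using state_b_power[of n] by auto
next
  case (Suc m)
  then show ?case by (auto simp: f_degree_d)
qed

lemmas state_top_zero = state_d_power_b_power[THEN conjunct1, unfolded f_degree_le_def, rule_format]
lemmas state_top_value = state_d_power_b_power[THEN conjunct2, rule_format]

lemma bd_commute: "bA ^ i * dA ^ j = dA ^ j * bA ^ i"
proof -
  have "z * (bA :: 'a uea) = bA * z" for z
  proof -
    obtain p where "z = abs_uea p" by (rule abs_uea_cases)
    moreover have "abs_uea p * (bA :: 'a uea) = bA * abs_uea p"
    proof (induction p rule: free_algebra_induct)
      case (scalar r)
      show ?case by (rule U.s_commute)
    next
      case (gen b p)
      have "abs_uea (gen b * p) * bA = abs_uea (gen b) * (abs_uea p * (bA :: 'a uea))"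
        by (simp add: mult.assoc)
      also have "\<dots> = (abs_uea (gen b) * bA) * abs_uea p"
        by (simp only: gen mult.assoc)
      also have "abs_uea (gen b) * bA = bA * (abs_uea (gen b) :: 'a uea)"
        by (rule uea_central_b[unfolded uea_central_def, THEN spec, symmetric])
      finally show ?case by (simp add: mult.assoc)
    qed (simp add: distrib_left distrib_right)
    ultimately show ?thesis by simp
  qed
  from this[of "dA ^ j"] show ?thesis
    by (intro power_commuting_commutes) simp
qed

definition bd :: "nat \<times> nat \<Rightarrow> 'k::field_char_0 uea"
  where "bd = (\<lambda>(i, j). bA ^ i * dA ^ j)"

text \<open>By induction on a bound of the degree in \<open>f\<close>: some combination \<open>w\<close> of the \<open>d\<^sup>m b\<^sup>n\<close> has the same coefficients as
  \<open>z\<close> at the monomials \<open>f\<^sup>m x\<^sup>n\<^sup>+\<^sup>m x\<^sub>1\<^sup>m y\<^sub>1\<^sup>n\<close>, and so \<open>z - w\<close> has lower degree by \<open>uea_central_top_zero\<close>.\<close>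

lemma center_uea_spanned:
  assumes "uea_central z"
  shows "z \<in> range (lincomb sclA bd)"
proof -
  have main: "z \<in> range (lincomb sclA bd)"
    if "uea_central z" "\<And>a b i j k l \<alpha> \<beta>. m \<le> a \<Longrightarrow> actA z vacuum a b i j k l \<alpha> \<beta> = 0" for m and z :: "'a uea"
    using that
  proof (induction m arbitrary: z)
    case 0
    then have "actA z vacuum = 0"
      by (simp add: fun_eq_iff fun_arith)
    then have "z = lincomb sclA bd 0"
      using vacuum_faithful by (simp add: lincomb_def)
    then show ?case by blast
  next
    case (Suc m)
    let ?\<psi> = "actA z vacuum"
    have deg: "f_degree_le m ?\<psi>"
      using Suc.prems(2) by (simp add: f_degree_le_def)
    obtain s where s: "\<And>b i j k l \<alpha> \<beta>. ?\<psi> m b i j k l \<alpha> \<beta> = (if b = 0 \<and> m \<le> i \<and> m \<le> k then s (i - m) j (k - m) l else 0)"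
      using V_central_top[OF uea_central_V_central[OF Suc.prems(1)] deg] by blast
    obtain B where B: "\<And>a b i j k l. B \<le> i \<Longrightarrow> ?\<psi> a b i j k l = (\<lambda>\<alpha> \<beta>. 0)"
      using bounded_act_vacuum[of z] by blast
    define w where "w = (\<Sum>n<B. sclA (?\<psi> m 0 (n + m) 0 m n 0 0 / 2 ^ m) * (dA ^ m * bA ^ n))"
    have w: "actA w vacuum a b i j k l \<alpha> \<beta> =
      (\<Sum>n<B. ?\<psi> m 0 (n + m) 0 m n 0 0 / 2 ^ m * actA (dA ^ m * bA ^ n) vacuum a b i j k l \<alpha> \<beta>)" for a b i j k l \<alpha> \<beta>
    proof -
      have "actA (\<Sum>n\<in>A. sclA (?\<psi> m 0 (n + m) 0 m n 0 0 / 2 ^ m) * (dA ^ m * bA ^ n)) vacuum =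
        (\<Sum>n\<in>A. smul (?\<psi> m 0 (n + m) 0 m n 0 0 / 2 ^ m) (actA (dA ^ m * bA ^ n) vacuum))" for A
        by (induction A rule: infinite_finite_induct) simp_all
      then show ?thesis by (simp add: w_def sum_state_apply smul_def)
    qed
    have wdeg: "f_degree_le m (actA w vacuum)"
      unfolding f_degree_le_def w by (auto simp: state_top_zero simp del: actA_simps(3) intro!: sum.neutral)
    have wval: "actA w vacuum m 0 (n + m) 0 m n 0 0 = ?\<psi> m 0 (n + m) 0 m n 0 0" for n
    proof -
      have "actA w vacuum m 0 (n + m) 0 m n 0 0 = (\<Sum>n'<B. if n = n' then ?\<psi> m 0 (n' + m) 0 m n' 0 0 else 0)"
        unfolding w by (rule sum.cong) (auto simp: state_top_value simp del: actA_simps(3))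
      also have "\<dots> = (if n < B then ?\<psi> m 0 (n + m) 0 m n 0 0 else 0)"
        by simp
      also have "\<dots> = ?\<psi> m 0 (n + m) 0 m n 0 0"
        using B[of "n + m" m 0 0 m n] by (auto simp: not_less)
      finally show ?thesis .
    qed
    have gw: "uea_central w"
      unfolding w_def by (intro uea_central_sum uea_central_mult uea_central_scl uea_central_power uea_central_b uea_central_d)
    have "actA (z - w) vacuum a b i j k l \<alpha> \<beta> = 0" if "m \<le> a" for a b i j k l \<alpha> \<beta>
    proof (cases "a = m")
      case True
      have "f_degree_le m (actA (z - w) vacuum)"
        using deg wdeg by (simp add: f_degree_le_def fun_arith)
      then show ?thesis
        unfolding True by (rule uea_central_top_zero[OF uea_central_diff[OF Suc.prems(1) gw]]) (simp add: fun_arith wval)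
    next
      case False
      then show ?thesis using that deg wdeg by (simp add: f_degree_le_def fun_arith)
    qed
    then have "z - w \<in> range (lincomb sclA bd)"
      by (intro Suc.IH uea_central_diff Suc.prems(1) gw)
    moreover have "w \<in> range (lincomb sclA bd)"
    proof -
      have "(\<Sum>n\<in>A. sclA (?\<psi> m 0 (n + m) 0 m n 0 0 / 2 ^ m) * (dA ^ m * bA ^ n)) =
        lincomb sclA bd (\<Sum>n\<in>A. Poly_Mapping.single (n, m) (?\<psi> m 0 (n + m) 0 m n 0 0 / 2 ^ m))" for A
      proof (induction A rule: infinite_finite_induct)
        case (insert n A)
        then show ?case
          unfolding sclA_def[abs_def] by (simp add: U.lincomb_add U.lincomb_single bd_def bd_commute)
      qed (simp_all add: lincomb_def)
      then show ?thesis unfolding w_def by blast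
    qed
    ultimately show ?case
    proof (elim rangeE)
      fix p q assume pq: "z - w = lincomb sclA bd p" "w = lincomb sclA bd q"
      have "z = (z - w) + w" by simp
      also have "\<dots> = lincomb sclA bd (p + q)"
        unfolding pq(1) unfolding pq(2) unfolding sclA_def[abs_def] by (rule U.lincomb_add[symmetric])
      finally show ?case by (rule range_eqI)
    qed
  qed
  obtain B where B: "\<And>a b i j k l. B \<le> a \<Longrightarrow> actA z vacuum a b i j k l = (\<lambda>\<alpha> \<beta>. 0)"
    using bounded_act_vacuum[of z] by blast
  show ?thesis by (rule main[OF assms, of B]) (simp add: B)
qed

text \<open>Let \<open>m\<close> be the largest exponent of \<open>d\<close> and \<open>b\<^sup>n d\<^sup>m\<close> one of the terms of that exponent. All the other terms
  have coefficient zero at \<open>f\<^sup>m x\<^sup>n\<^sup>+\<^sup>m x\<^sub>1\<^sup>m y\<^sub>1\<^sup>n\<close>.\<close>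

lemma bd_independent:
  assumes "lincomb sclA bd (r :: nat \<times> nat \<Rightarrow>\<^sub>0 'k::field_char_0) = 0"
  shows "r = 0"
proof (rule ccontr)
  assume "r \<noteq> 0"
  then have ne: "snd ` Poly_Mapping.keys r \<noteq> {}" by simp
  define m where "m = Max (snd ` Poly_Mapping.keys r)"
  have "m \<in> snd ` Poly_Mapping.keys r"
    unfolding m_def using ne by (intro Max_in) simp_all
  then obtain n where n: "(n, m) \<in> Poly_Mapping.keys r" by auto
  have le: "j \<le> m" if "(i, j) \<in> Poly_Mapping.keys r" for i j
    unfolding m_def using that by (intro Max_ge) force+
  have "actA (\<Sum>q\<in>A. sclA (Poly_Mapping.lookup r q) * bd q) vacuum =
      (\<Sum>q\<in>A. smul (Poly_Mapping.lookup r q) (actA (bd q) vacuum))" for A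
    by (induction A rule: infinite_finite_induct) simp_all
  then have "0 = (\<Sum>q\<in>Poly_Mapping.keys r. Poly_Mapping.lookup r q * actA (bd q) vacuum m 0 (n + m) 0 m n 0 0)"
    using arg_cong[OF assms, of "\<lambda>z. actA z vacuum m 0 (n + m) 0 m n 0 0"]
    by (simp add: lincomb_def sum_state_apply smul_def zero_fun_apply)
  also have "\<dots> = (\<Sum>q\<in>Poly_Mapping.keys r. if q = (n, m) then Poly_Mapping.lookup r q * 2 ^ m else 0)"
  proof (rule sum.cong)
    fix q assume q: "q \<in> Poly_Mapping.keys r"
    obtain i j where ij: "q = (i, j)" by (cases q)
    show "Poly_Mapping.lookup r q * actA (bd q) vacuum m 0 (n + m) 0 m n 0 0 = (if q = (n, m) then Poly_Mapping.lookup r q * 2 ^ m else 0)"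
    proof (cases "j = m")
      case True
      then show ?thesis by (auto simp: ij bd_def bd_commute state_top_value simp del: actA_simps(3))
    next
      case False
      then have "j < m" using le q ij by fastforce
      then have "actA (bd q :: 'k uea) vacuum m 0 (n + m) 0 m n 0 0 = 0"
        by (simp add: ij bd_def bd_commute state_top_zero del: actA_simps(3))
      then show ?thesis using False by (simp add: ij)
    qed
  qed simp
  also have "\<dots> = Poly_Mapping.lookup r (n, m) * 2 ^ m"
    using n by simp
  finally show False using n by (simp add: in_keys_iff)
qed

section \<open>A family of candidates for \<open>c\<close>\<close>

context smash_algebra
begin

text \<open>The Casimir element of \<open>sl\<^sub>2\<close>, normalized to have the Harish-Chandra projection \<open>(h + 1)\<^sup>2 - 1\<close>.\<close>

definition cas :: 'r where "cas = h * h + (e * f + e * f) + (f * e + f * e)"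

text \<open>The images of the basis of \<open>V\<close> under the operator \<open>M = h \<otimes> h + 2 e \<otimes> f + 2 f \<otimes> e\<close>, in which the second
  factors act on \<open>V\<close>. The values of \<open>\<gamma>\<close> lie in the span of \<open>1\<close>, \<open>e\<close>, \<open>f\<close>, \<open>h\<close> over the center, and therefore
  \<open>[c, v]\<close> is a combination of \<open>v\<close> and \<open>M v\<close>.\<close>

definition hat_x :: 'r where "hat_x = h * x + e * y + e * y"
definition hat_y :: 'r where "hat_y = f * x + f * x - h * y"
definition hat_x1 :: 'r where "hat_x1 = h * x1 + e * y1 + e * y1"
definition hat_y1 :: 'r where "hat_y1 = f * x1 + f * x1 - h * y1"

definition g_invariant :: "'r \<Rightarrow> bool"
  where "g_invariant z \<longleftrightarrow> e * z = z * e \<and> f * z = z * f \<and> h * z = z * h \<and> t * z = z * t"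

lemma g_invariantD:
  assumes "g_invariant z"
  shows "e * z = z * e" "f * z = z * f" "h * z = z * h" "t * z = z * t"
    "e * (z * a) = z * (e * a)" "f * (z * a) = z * (f * a)" "h * (z * a) = z * (h * a)" "t * (z * a) = z * (t * a)"
  using assms unfolding g_invariant_def by (simp_all flip: mult.assoc)

lemma g_invariant_cas: "g_invariant cas"
  unfolding g_invariant_def cas_def by (simp add: algebra_simps order order_assoc)

lemma g_invariant_t: "g_invariant t"
  unfolding g_invariant_def by (simp add: order)

lemma g_invariant_1: "g_invariant 1" and g_invariant_0: "g_invariant 0"
  unfolding g_invariant_def by simp_all

lemma g_invariant_s: "g_invariant (s r)"
  unfolding g_invariant_def by (simp add: s_commute)

lemma g_invariant_add: "g_invariant a \<Longrightarrow> g_invariant b \<Longrightarrow> g_invariant (a + b)" and g_invariant_diff: "g_invariant a \<Longrightarrow> g_invariant b \<Longrightarrow> g_invariant (a - b)"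
  and g_invariant_uminus: "g_invariant a \<Longrightarrow> g_invariant (- a)"
  unfolding g_invariant_def by (simp_all add: algebra_simps)

lemma g_invariant_mult: "g_invariant a \<Longrightarrow> g_invariant b \<Longrightarrow> g_invariant (a * b)"
  unfolding g_invariant_def by (metis mult.assoc)

text \<open>For \<open>v\<close> in the span of \<open>x\<close> and \<open>y\<close> this means \<open>[c, v] = (C + Z M) v\<close> and \<open>[w, v] = - (t + 2 - M) [c, v]\<close>.\<close>

definition good_X :: "'r \<Rightarrow> 'r \<Rightarrow> 'r \<Rightarrow> 'r \<Rightarrow> bool"
  where "good_X c w C Z \<longleftrightarrow> g_invariant c \<and> g_invariant w \<and> g_invariant C \<and> g_invariant Z \<and>
    x * c = c * x - C * x - Z * hat_x \<and> y * c = c * y - C * y - Z * hat_y \<and>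
    x * w = w * x + (t + 1 + 1) * (C * x + Z * hat_x) - h * (C * x + Z * hat_x) - e * (C * y + Z * hat_y) - e * (C * y + Z * hat_y) \<and>
    y * w = w * y + (t + 1 + 1) * (C * y + Z * hat_y) - f * (C * x + Z * hat_x) - f * (C * x + Z * hat_x) + h * (C * y + Z * hat_y)"

text \<open>For \<open>v\<close> in the span of \<open>x\<^sub>1\<close> and \<open>y\<^sub>1\<close> this means \<open>[c, v] = (C + Z M) v\<close> and \<open>[w, v] = - (t + M) [c, v]\<close>.\<close>

definition good_W :: "'r \<Rightarrow> 'r \<Rightarrow> 'r \<Rightarrow> 'r \<Rightarrow> bool"
  where "good_W c w C Z \<longleftrightarrow> g_invariant c \<and> g_invariant w \<and> g_invariant C \<and> g_invariant Z \<and>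
    x1 * c = c * x1 - C * x1 - Z * hat_x1 \<and> y1 * c = c * y1 - C * y1 - Z * hat_y1 \<and>
    x1 * w = w * x1 + t * (C * x1 + Z * hat_x1) + h * (C * x1 + Z * hat_x1) + e * (C * y1 + Z * hat_y1) + e * (C * y1 + Z * hat_y1) \<and>
    y1 * w = w * y1 + t * (C * y1 + Z * hat_y1) + f * (C * x1 + Z * hat_x1) + f * (C * x1 + Z * hat_x1) - h * (C * y1 + Z * hat_y1)"

text \<open>The constant term of the polynomial \<open>T\<^sup>2 - (2 t + 2) T + nrm\<close>.\<close>

definition nrm :: 'r where "nrm = t * t + t + t - cas"

text \<open>If \<open>c\<close> and \<open>w\<close> are the coefficients of \<open>c T + w\<close>, then the new pair consists of those of its product with \<open>T\<close> modulo
  \<open>T\<^sup>2 - (2 t + 2) T + nrm\<close>. Iterating produces the pairs for all powers of \<open>T\<close>, with constant coefficients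
  added in between for all polynomials. The new \<open>C\<close> and \<open>Z\<close> come from \<open>M\<^sup>2 = 2 M + \<Omega>\<close> and from the commutators
  of \<open>t\<close> and \<open>\<Omega>\<close> with \<open>V\<close>.\<close>

lemma good_X_step:
  assumes "good_X c w C Z"
  shows "good_X ((t + t + 1 + 1) * c + w) (- (nrm * c)) ((t - 1 - 1) * C + cas * Z + c + c) (C + t * Z)"
proof -
  have g: "g_invariant c" "g_invariant w" "g_invariant C" "g_invariant Z"
    and X: "x * c = c * x - C * x - Z * hat_x" "y * c = c * y - C * y - Z * hat_y"
    and S: "x * w = w * x + (t + 1 + 1) * (C * x + Z * hat_x) - h * (C * x + Z * hat_x) - e * (C * y + Z * hat_y) - e * (C * y + Z * hat_y)"
      "y * w = w * y + (t + 1 + 1) * (C * y + Z * hat_y) - f * (C * x + Z * hat_x) - f * (C * x + Z * hat_x) + h * (C * y + Z * hat_y)"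
    using assms by (simp_all add: good_X_def)
  have A: "x * (c * a) = c * (x * a) - C * (x * a) - Z * (hat_x * a)" "y * (c * a) = c * (y * a) - C * (y * a) - Z * (hat_y * a)" for a
    using X by (simp_all add: left_diff_distrib flip: mult.assoc)
  note G = g_invariantD[OF g(1)] g_invariantD[OF g(2)] g_invariantD[OF g(3)] g_invariantD[OF g(4)]
  show ?thesis
    unfolding good_X_def
  proof (intro conjI)
    show "g_invariant ((t + t + 1 + 1) * c + w)" "g_invariant (- (nrm * c))" "g_invariant ((t - 1 - 1) * C + cas * Z + c + c)" "g_invariant (C + t * Z)"
      unfolding nrm_def by (intro g_invariant_add g_invariant_mult g_invariant_diff g_invariant_uminus g_invariant_t g_invariant_1 g_invariant_cas g)+
  qed (simp add: hat_x_def hat_y_def nrm_def cas_def algebra_simps order order_assoc X A S G mult_2)+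
qed

lemma good_W_step:
  assumes "good_W c w C Z"
  shows "good_W ((t + t + 1 + 1) * c + w) (- (nrm * c)) ((t + 1 + 1 + 1 + 1) * C - cas * Z - c - c) ((t + 1 + 1) * Z - C)"
proof -
  have g: "g_invariant c" "g_invariant w" "g_invariant C" "g_invariant Z"
    and X: "x1 * c = c * x1 - C * x1 - Z * hat_x1" "y1 * c = c * y1 - C * y1 - Z * hat_y1"
    and S: "x1 * w = w * x1 + t * (C * x1 + Z * hat_x1) + h * (C * x1 + Z * hat_x1) + e * (C * y1 + Z * hat_y1) + e * (C * y1 + Z * hat_y1)"
      "y1 * w = w * y1 + t * (C * y1 + Z * hat_y1) + f * (C * x1 + Z * hat_x1) + f * (C * x1 + Z * hat_x1) - h * (C * y1 + Z * hat_y1)"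
    using assms by (simp_all add: good_W_def)
  have A: "x1 * (c * a) = c * (x1 * a) - C * (x1 * a) - Z * (hat_x1 * a)" "y1 * (c * a) = c * (y1 * a) - C * (y1 * a) - Z * (hat_y1 * a)" for a
    using X by (simp_all add: left_diff_distrib flip: mult.assoc)
  note G = g_invariantD[OF g(1)] g_invariantD[OF g(2)] g_invariantD[OF g(3)] g_invariantD[OF g(4)]
  show ?thesis
    unfolding good_W_def
  proof (intro conjI)
    show "g_invariant ((t + t + 1 + 1) * c + w)" "g_invariant (- (nrm * c))" "g_invariant ((t + 1 + 1 + 1 + 1) * C - cas * Z - c - c)" "g_invariant ((t + 1 + 1) * Z - C)"
      unfolding nrm_def by (intro g_invariant_add g_invariant_mult g_invariant_diff g_invariant_uminus g_invariant_t g_invariant_1 g_invariant_cas g)+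
  qed (simp add: hat_x1_def hat_y1_def nrm_def cas_def algebra_simps order order_assoc X A S G mult_2)+
qed

lemma good_X_base: "good_X 0 (s r) 0 0" and good_W_base: "good_W 0 (s r) 0 0"
  by (simp_all add: good_X_def good_W_def g_invariant_0 g_invariant_s s_commute)

lemma good_X_add:
  assumes "good_X c w C Z" "good_X c' w' C' Z'"
  shows "good_X (c + c') (w + w') (C + C') (Z + Z')"
proof -
  note A = assms[unfolded good_X_def]
  have g: "g_invariant (c + c')" "g_invariant (w + w')" "g_invariant (C + C')" "g_invariant (Z + Z')"
    using A by (blast intro: g_invariant_add)+
  note X = A[THEN conjunct2, THEN conjunct2, THEN conjunct2, THEN conjunct2]
  note X1 = X[THEN conjunct1] and X2 = X[THEN conjunct2, THEN conjunct1]
    and X3 = X[THEN conjunct2, THEN conjunct2, THEN conjunct1] and X4 = X[THEN conjunct2, THEN conjunct2, THEN conjunct2]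
  show ?thesis
    unfolding good_X_def
    apply (intro conjI g)
       apply (subst distrib_left, subst X1(1), subst X1(2), simp add: algebra_simps)
      apply (subst distrib_left, subst X2(1), subst X2(2), simp add: algebra_simps)
     apply (subst distrib_left, subst X3(1), subst X3(2), simp add: algebra_simps)
    apply (subst distrib_left, subst X4(1), subst X4(2), simp add: algebra_simps)
    done
qed

lemma good_W_add:
  assumes "good_W c w C Z" "good_W c' w' C' Z'"
  shows "good_W (c + c') (w + w') (C + C') (Z + Z')"
proof -
  note A = assms[unfolded good_W_def]
  have g: "g_invariant (c + c')" "g_invariant (w + w')" "g_invariant (C + C')" "g_invariant (Z + Z')"
    using A by (blast intro: g_invariant_add)+
  note X = A[THEN conjunct2, THEN conjunct2, THEN conjunct2, THEN conjunct2]
  note X1 = X[THEN conjunct1] and X2 = X[THEN conjunct2, THEN conjunct1]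
    and X3 = X[THEN conjunct2, THEN conjunct2, THEN conjunct1] and X4 = X[THEN conjunct2, THEN conjunct2, THEN conjunct2]
  show ?thesis
    unfolding good_W_def
    apply (intro conjI g)
       apply (subst distrib_left, subst X1(1), subst X1(2), simp add: algebra_simps)
      apply (subst distrib_left, subst X2(1), subst X2(2), simp add: algebra_simps)
     apply (subst distrib_left, subst X3(1), subst X3(2), simp add: algebra_simps)
    apply (subst distrib_left, subst X4(1), subst X4(2), simp add: algebra_simps)
    done
qed

subsection \<open>Commutators with \<open>d\<close>\<close>

text \<open>In these identities of the smash product the commutators within \<open>V\<close> are left unevaluated. In \<open>H\<^sub>c\<close> they become the
  values of \<open>\<gamma>\<close>.\<close>

lemma bel_commutator:
  "bel * x - x * bel = (y1 * x - x * y1) * x - (x1 * x - x * x1) * y + x1 * (x * y - y * x)"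
  "bel * y - y * bel = (y1 * y - y * y1) * x - (x1 * y - y * x1) * y + y1 * (x * y - y * x)"
  "bel * x1 - x1 * bel = x1 * (x1 * y - y * x1) - y1 * (x1 * x - x * x1) - (x1 * y1 - y1 * x1) * x"
  "bel * y1 - y1 * bel = x1 * (y1 * y - y * y1) - y1 * (y1 * x - x * y1) - (x1 * y1 - y1 * x1) * y"
  by (simp_all add: bel_def algebra_simps)

lemma del_commutator_x:
  "del * x - x * del = t * ((y1 * x - x * y1) * x - (x1 * x - x * x1) * y) - (e + e) * ((y1 * x - x * y1) * y)
     - h * ((y1 * x - x * y1) * x + (x1 * x - x * x1) * y) + (f + f) * ((x1 * x - x * x1) * x)
     + ((x1 * x - x * x1) * y + (x1 * x - x * x1) * y) - ((x1 * y - y * x1) * x + (x1 * y - y * x1) * x)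
     + (t * x1 + e * y1 + e * y1 + h * x1 - x1 - x1) * (x * y - y * x)"
  by (simp add: del_def algebra_simps order order_assoc mult_2)

lemma del_commutator_x1:
  "del * x1 - x1 * del = t * (x1 * (x1 * y - y * x1) - y1 * (x1 * x - x * x1)) + (e + e) * (y1 * (x1 * y - y * x1))
     + h * (y1 * (x1 * x - x * x1) + x1 * (x1 * y - y * x1)) - (f + f) * (x1 * (x1 * x - x * x1))
     + (h * (x1 * y1 - y1 * x1) * x + (e + e) * (x1 * y1 - y1 * x1) * y - t * (x1 * y1 - y1 * x1) * x
       - (x1 * y1 - y1 * x1) * x - (x1 * y1 - y1 * x1) * x)"
  by (simp add: del_def algebra_simps order order_assoc mult_2)

end

abbreviation aS :: "(gl2 word \<Rightarrow>\<^sub>0 'k::field_char_0) \<Rightarrow> 'k smash" where "aS p \<equiv> abs_smash (incl p)"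
abbreviation aU :: "(gl2 word \<Rightarrow>\<^sub>0 'k::field_char_0) \<Rightarrow> 'k uea" where "aU p \<equiv> abs_uea (incl p)"

text \<open>The Harish-Chandra projection: the part of the normal form that contains neither \<open>f\<close> nor \<open>e\<close> nor elements of \<open>V\<close>.\<close>

definition hc :: "'k::field_char_0 uea \<Rightarrow> 'k \<Rightarrow> 'k \<Rightarrow> 'k"
  where "hc z \<alpha> \<beta> = actA z vacuum 0 0 0 0 0 0 \<alpha> \<beta>"

lemma hc_add: "hc (z + w) \<alpha> \<beta> = hc z \<alpha> \<beta> + hc w \<alpha> \<beta>"
  and hc_diff: "hc (z - w) \<alpha> \<beta> = hc z \<alpha> \<beta> - hc w \<alpha> \<beta>"
  and hc_zero: "hc 0 \<alpha> \<beta> = 0"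
  and hc_sclA: "hc (sclA r) \<alpha> \<beta> = r"
  by (simp_all add: hc_def fun_arith smul_def mono_state_def)

lemma hc_uminus: "hc (- z) \<alpha> \<beta> = - hc z \<alpha> \<beta>"
  using hc_diff[of 0 z] by (simp add: hc_zero)

lemma hc_t: "hc (abs_uea (gen (Inl Gt)) * z) \<alpha> \<beta> = (\<alpha> + \<beta>) * hc z \<alpha> \<beta>"
  by (simp add: hc_def lop.simps)

lemma hc_cas: "hc (U.cas * z) \<alpha> \<beta> = ((\<alpha> - \<beta>) * (\<alpha> - \<beta>) + 2 * (\<alpha> - \<beta>)) * hc z \<alpha> \<beta>"
  by (simp add: hc_def U.cas_def lop.simps fun_arith algebra_simps)

lemma hc_nrm: "hc (U.nrm * z) \<alpha> \<beta> = (2 * \<alpha> + 2) * (2 * \<beta>) * hc z \<alpha> \<beta>"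
  by (simp add: U.nrm_def left_diff_distrib distrib_right mult.assoc hc_add hc_diff hc_t hc_cas) (simp add: algebra_simps)

text \<open>By the Horner scheme, \<open>q(T)\<close> is reduced to \<open>c T + w\<close> modulo \<open>T\<^sup>2 - (2 t + 2) T + nrm\<close>. The projection of this
  polynomial has the roots \<open>2 \<alpha> + 2\<close> and \<open>2 \<beta>\<close>, at which \<open>q(T)\<close> and \<open>c T + w\<close> agree.\<close>

lemma interpolation:
  fixes q :: "'k::field_char_0 poly"
  shows "\<exists>c w C Z C' Z'. S.good_X (aS c) (aS w) (aS C) (aS Z) \<and> S.good_W (aS c) (aS w) (aS C') (aS Z') \<and>
     (\<forall>\<alpha> \<beta>. (2 * \<alpha> + 2) * hc (aU c) \<alpha> \<beta> + hc (aU w) \<alpha> \<beta> = poly q (2 * \<alpha> + 2)) \<and>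
     (\<forall>\<alpha> \<beta>. (2 * \<beta>) * hc (aU c) \<alpha> \<beta> + hc (aU w) \<alpha> \<beta> = poly q (2 * \<beta>))"
proof (induction q)
  case 0
  have "S.good_X (aS 0) (aS 0) (aS 0) (aS 0 :: 'k smash)" "S.good_W (aS 0) (aS 0) (aS 0) (aS 0 :: 'k smash)"
    using S.good_X_base[of 0] S.good_W_base[of 0] by simp_all
  then show ?case
    by (intro exI[of _ 0]) (simp add: hc_zero)
next
  case (pCons a q)
  then obtain c w C Z C' Z' where X: "S.good_X (aS c) (aS w) (aS C) (aS Z)" and W: "S.good_W (aS c) (aS w) (aS C') (aS Z')"
    and h1: "\<And>\<alpha> \<beta>. (2 * \<alpha> + 2) * hc (aU c) \<alpha> \<beta> + hc (aU w) \<alpha> \<beta> = poly q (2 * \<alpha> + 2)"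
    and h2: "\<And>\<alpha> \<beta>. (2 * \<beta>) * hc (aU c) \<alpha> \<beta> + hc (aU w) \<alpha> \<beta> = poly q (2 * \<beta>)" by blast
  let ?t = "gen Gt :: gl2 word \<Rightarrow>\<^sub>0 'k"
  let ?cas = "gen Gh * gen Gh + (gen Ge * gen Gf + gen Ge * gen Gf) + (gen Gf * gen Ge + gen Gf * gen Ge) :: gl2 word \<Rightarrow>\<^sub>0 'k"
  let ?nrm = "?t * ?t + ?t + ?t - ?cas"
  let ?c = "(?t + ?t + 1 + 1) * c + w" and ?w = "- (?nrm * c) + Poly_Mapping.single 0 a"
  have one: "incl 1 = 1" using incl_scalar[of 1] by simp
  note I = incl_add incl_diff incl_mult incl_gen incl_uminus one incl_scalar
  have "S.good_X (aS ?c) (aS ?w) (aS ((?t - 1 - 1) * C + ?cas * Z + c + c)) (aS (C + ?t * Z))"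
    using S.good_X_add[OF S.good_X_step[OF X] S.good_X_base[of a]] by (simp add: I S.cas_def S.nrm_def)
  moreover have "S.good_W (aS ?c) (aS ?w) (aS ((?t + 1 + 1 + 1 + 1) * C' - ?cas * Z' - c - c)) (aS ((?t + 1 + 1) * Z' - C'))"
    using S.good_W_add[OF S.good_W_step[OF W] S.good_W_base[of a]] by (simp add: I S.cas_def S.nrm_def)
  moreover have hcc: "hc (aU ?c) \<alpha> \<beta> = (2 * \<alpha> + 2 * \<beta> + 2) * hc (aU c) \<alpha> \<beta> + hc (aU w) \<alpha> \<beta>" for \<alpha> \<beta>
    by (simp add: I distrib_right hc_add hc_t)
  moreover have "aU ?w = - (U.nrm * aU c) + sclA a"
    by (simp add: I U.nrm_def U.cas_def sclA_def)
  then have hcw: "hc (aU ?w) \<alpha> \<beta> = - ((2 * \<alpha> + 2) * (2 * \<beta>) * hc (aU c) \<alpha> \<beta>) + a" for \<alpha> \<beta>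
    by (simp only: hc_add hc_uminus hc_nrm hc_sclA)
  have "(2 * \<alpha> + 2) * hc (aU ?c) \<alpha> \<beta> + hc (aU ?w) \<alpha> \<beta> = poly (pCons a q) (2 * \<alpha> + 2)" for \<alpha> \<beta>
    unfolding hcc hcw by (simp add: h1[of \<alpha> \<beta>, symmetric]) (simp add: algebra_simps)
  moreover have "(2 * \<beta>) * hc (aU ?c) \<alpha> \<beta> + hc (aU ?w) \<alpha> \<beta> = poly (pCons a q) (2 * \<beta>)" for \<alpha> \<beta>
    unfolding hcc hcw by (simp add: h2[of \<beta> \<alpha>, symmetric]) (simp add: algebra_simps)
  ultimately show ?case by blast
qed

section \<open>The relations of \<open>H\<^sub>c\<close> modulo lower degree\<close>

definition homog :: "nat \<Rightarrow> ((gl2 + vb) word \<Rightarrow>\<^sub>0 'k::comm_ring_1) \<Rightarrow> bool"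
  where "homog n p \<longleftrightarrow> hpart n p = p"

lemma homog_add: "homog n p \<Longrightarrow> homog n q \<Longrightarrow> homog n (p + q)"
  and homog_diff: "homog n p \<Longrightarrow> homog n q \<Longrightarrow> homog n (p - q)"
  by (simp_all add: homog_def hpart_add hpart_diff)

lemma homog_mult: "homog m p \<Longrightarrow> homog n q \<Longrightarrow> homog (m + n) (p * q)"
proof -
  assume p: "homog m p" and q: "homog n q"
  have "hpart i p = (if i = m then p else 0)" for i
    using p hpart_hpart[of i m p] by (simp add: homog_def)
  moreover have "hpart i q = (if i = n then q else 0)" for i
    using q hpart_hpart[of i n q] by (simp add: homog_def)
  ultimately have "hpart (m + n) (p * q) = (\<Sum>i\<le>m + n. if i = m then p * q else 0)"
    unfolding hpart_mult by (intro sum.cong) auto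
  then show ?thesis by (simp add: homog_def)
qed

lemma homog_incl: "homog 0 (incl p)" and homog_V: "homog 1 (gen (Inr v))" and homog_g: "homog 0 (gen (Inl a))"
  by (simp_all add: homog_def hpart_incl hpart_gen)

text \<open>The parameters \<open>G\<close>, \<open>K\<close>, \<open>L\<close>, \<open>K'\<close> represent the values of \<open>\<gamma>\<close> at the pairs \<open>x\<^sub>1, x\<close> and \<open>y\<^sub>1, x\<close> and \<open>y\<^sub>1, y\<close> and
  \<open>x\<^sub>1, y\<close>. Working with representatives keeps all calculations in the free algebra and its quotients.\<close>

locale cherednik =
  fixes \<gamma> :: "(vb \<Rightarrow>\<^sub>0 'k) \<Rightarrow> (vb \<Rightarrow>\<^sub>0 'k) \<Rightarrow> (gl2 word \<Rightarrow>\<^sub>0 'k::field_char_0) set"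
    and c G K L K' :: "gl2 word \<Rightarrow>\<^sub>0 'k"
  assumes cherednik: "infinitesimal_cherednik \<gamma>"
    and G: "G \<in> \<gamma> (Poly_Mapping.single Vx1 1) (Poly_Mapping.single Vx 1)"
    and K: "K \<in> \<gamma> (Poly_Mapping.single Vy1 1) (Poly_Mapping.single Vx 1)"
    and L: "L \<in> \<gamma> (Poly_Mapping.single Vy1 1) (Poly_Mapping.single Vy 1)"
    and K': "K' \<in> \<gamma> (Poly_Mapping.single Vx1 1) (Poly_Mapping.single Vy 1)"
    and c_central: "\<And>a. c * a - a * c \<in> idl U_rels"
    and bc_central: "\<And>q. (b_expr - incl c) * q - q * (b_expr - incl c) \<in> idl (H_rels \<gamma>)"
begin

text \<open>The kernel of the map from the smash product to \<open>H\<^sub>c\<close>.\<close>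

definition J :: "'k smash set" where "J = abs_smash ` idl (H_rels \<gamma>)"

lemma J_iff: "abs_smash p \<in> J \<longleftrightarrow> p \<in> idl (H_rels \<gamma>)"
proof
  assume "abs_smash p \<in> J"
  then obtain q where "q \<in> idl (H_rels \<gamma>)" "p - q \<in> idl smash_rels"
    by (auto simp: J_def abs_smash_eq_iff)
  then show "p \<in> idl (H_rels \<gamma>)"
    using idl_add[of "p - q" "H_rels \<gamma>" q] idl_smash_subset_idl_H[of \<gamma>] by auto
qed (simp add: J_def)

lemma J_zero: "0 \<in> J" and J_add: "u \<in> J \<Longrightarrow> v \<in> J \<Longrightarrow> u + v \<in> J"
  and J_diff: "u \<in> J \<Longrightarrow> v \<in> J \<Longrightarrow> u - v \<in> J" and J_uminus: "u \<in> J \<Longrightarrow> - u \<in> J"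
  unfolding J_def using idl_zero[of "H_rels \<gamma>"]
  by (auto simp flip: abs_smash_hom intro!: imageI intro: idl_add idl_diff idl_uminus)

lemma J_mult: "u \<in> J \<Longrightarrow> v * u \<in> J" "u \<in> J \<Longrightarrow> u * v \<in> J"
proof -
  obtain p where p: "v = abs_smash p"
    by (induct v rule: smash.abs_induct) blast
  show "u \<in> J \<Longrightarrow> v * u \<in> J" "u \<in> J \<Longrightarrow> u * v \<in> J"
    unfolding p J_def by (auto simp flip: abs_smash_hom intro!: imageI intro: idl_lmult idl_rmult)
qed

text \<open>By the Poincare-Birkhoff-Witt property of \<open>H\<^sub>c\<close>, homogeneous relations in \<open>H\<^sub>c\<close> hold in its associated graded algebra.
  In degree \<open>0\<close> the converse holds as well.\<close>

lemma J_homog: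
  assumes "abs_smash p \<in> J" "homog n p"
  shows "abs_uea p = 0"
proof -
  have "p \<in> low (H_rels \<gamma>) n"
    using assms(1) by (simp add: J_iff idl_in_low)
  then have "p \<in> idl UV_rels"
    using homogeneous_idl_UV_iff[OF cherednik, of n p] assms(2) by (simp add: homog_def)
  then show ?thesis
    using abs_uea_eq_iff[of p 0] by simp
qed

lemma uea_zero_J:
  assumes "abs_uea p = 0" "homog 0 p"
  shows "abs_smash p \<in> J"
proof -
  have "p \<in> idl UV_rels"
    using abs_uea_eq_iff[of p 0] assms(1) by simp
  then have "p \<in> low (H_rels \<gamma>) 0"
    using homogeneous_idl_UV_iff[OF cherednik, of 0 p] assms(2) by (simp add: homog_def)
  then show ?thesis by (simp add: J_iff low_0)
qed

abbreviation "x \<equiv> abs_smash (gen (Inr Vx)) :: 'k smash"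
abbreviation "y \<equiv> abs_smash (gen (Inr Vy)) :: 'k smash"
abbreviation "x1 \<equiv> abs_smash (gen (Inr Vx1)) :: 'k smash"
abbreviation "y1 \<equiv> abs_smash (gen (Inr Vy1)) :: 'k smash"
abbreviation "e \<equiv> abs_smash (gen (Inl Ge)) :: 'k smash"
abbreviation "f \<equiv> abs_smash (gen (Inl Gf)) :: 'k smash"
abbreviation "h \<equiv> abs_smash (gen (Inl Gh)) :: 'k smash"
abbreviation "t \<equiv> abs_smash (gen (Inl Gt)) :: 'k smash"

lemma pairing_J: "g \<in> \<gamma> (Poly_Mapping.single v 1) (Poly_Mapping.single w 1) \<Longrightarrow>
    (abs_smash (gen (Inr v)) * abs_smash (gen (Inr w)) - abs_smash (gen (Inr w)) * abs_smash (gen (Inr v))) - aS g \<in> J"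
  using H_basis_relation[of g \<gamma> v w] J_iff by (simp flip: abs_smash_hom)

lemma V_J: "x * y - y * x \<in> J" "x1 * y1 - y1 * x1 \<in> J"
proof -
  have inv: "invariant_pairing \<gamma>"
    using cherednik by (simp add: infinitesimal_cherednik_def)
  have z: "0 \<in> \<zero>\<^bsub>U_gl2\<^esub>"
    by (simp add: U_gl2_def presented_zero self_in_cls)
  have "\<forall>v w. Poly_Mapping.keys v \<subseteq> {Vx, Vy} \<and> Poly_Mapping.keys w \<subseteq> {Vx, Vy} \<longrightarrow> \<gamma> v w = \<zero>\<^bsub>U_gl2\<^esub>"
    using inv unfolding invariant_pairing_def by (elim conjE)
  then have "0 \<in> \<gamma> (Poly_Mapping.single Vx 1) (Poly_Mapping.single Vy 1)"
    using z by simp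
  from pairing_J[OF this] show "x * y - y * x \<in> J" by simp
  have "\<forall>v w. Poly_Mapping.keys v \<subseteq> {Vx1, Vy1} \<and> Poly_Mapping.keys w \<subseteq> {Vx1, Vy1} \<longrightarrow> \<gamma> v w = \<zero>\<^bsub>U_gl2\<^esub>"
    using inv unfolding invariant_pairing_def by (elim conjE)
  then have "0 \<in> \<gamma> (Poly_Mapping.single Vx1 1) (Poly_Mapping.single Vy1 1)"
    using z by simp
  from pairing_J[OF this] show "x1 * y1 - y1 * x1 \<in> J" by simp
qed

lemmas GJ = pairing_J[OF G] and KJ = pairing_J[OF K] and LJ = pairing_J[OF L] and K'J = pairing_J[OF K']

lemma bc_J: "(S.bel * z - z * S.bel) - (aS c * z - z * aS c) \<in> J"
proof -
  obtain q where q: "z = abs_smash q"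
    by (induct z rule: smash.abs_induct) blast
  have "abs_smash ((b_expr - incl c) * q - q * (b_expr - incl c)) \<in> J"
    by (simp only: J_iff bc_central)
  moreover have "abs_smash (b_expr :: (gl2 + vb) word \<Rightarrow>\<^sub>0 'k) = S.bel"
    by (simp add: b_expr_def S.bel_def)
  ultimately show ?thesis
    by (simp add: q algebra_simps)
qed

lemma J_trans: "u - v \<in> J \<Longrightarrow> v - w \<in> J \<Longrightarrow> u - w \<in> J"
  using J_add[of "u - v" "v - w"] by simp

text \<open>Because \<open>b - c\<close> is central in \<open>H\<^sub>c\<close>, the commutators of \<open>c\<close> with \<open>V\<close> are those of \<open>b\<close>, which are given by \<open>\<gamma>\<close>.\<close>

lemma c_x: "(aS c * x - x * aS c) - (aS K * x - aS G * y) \<in> J"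
proof -
  have "(aS c * x - x * aS c) - (aS K * x - aS G * y) =
     - ((S.bel * x - x * S.bel) - (aS c * x - x * aS c)) + ((y1 * x - x * y1) - aS K) * x
     - ((x1 * x - x * x1) - aS G) * y + x1 * (x * y - y * x)"
    unfolding S.bel_commutator by (simp add: algebra_simps)
  then show ?thesis
    by (simp only:) (intro J_add J_diff J_uminus bc_J J_mult KJ GJ V_J)
qed

lemma c_y: "(aS c * y - y * aS c) - (aS L * x - aS K' * y) \<in> J"
proof -
  have "(aS c * y - y * aS c) - (aS L * x - aS K' * y) =
     - ((S.bel * y - y * S.bel) - (aS c * y - y * aS c)) + ((y1 * y - y * y1) - aS L) * x
     - ((x1 * y - y * x1) - aS K') * y + y1 * (x * y - y * x)"
    unfolding S.bel_commutator by (simp add: algebra_simps)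
  then show ?thesis
    by (simp only:) (intro J_add J_diff J_uminus bc_J J_mult LJ K'J V_J)
qed

lemma c_x1: "(aS c * x1 - x1 * aS c) - (x1 * aS K' - y1 * aS G) \<in> J"
proof -
  have "(aS c * x1 - x1 * aS c) - (x1 * aS K' - y1 * aS G) =
     - ((S.bel * x1 - x1 * S.bel) - (aS c * x1 - x1 * aS c)) + x1 * ((x1 * y - y * x1) - aS K')
     - y1 * ((x1 * x - x * x1) - aS G) - (x1 * y1 - y1 * x1) * x"
    unfolding S.bel_commutator by (simp add: algebra_simps)
  then show ?thesis
    by (simp only:) (intro J_add J_diff J_uminus bc_J J_mult GJ K'J V_J)
qed

lemma c_y1: "(aS c * y1 - y1 * aS c) - (x1 * aS L - y1 * aS K) \<in> J"
proof -
  have "(aS c * y1 - y1 * aS c) - (x1 * aS L - y1 * aS K) =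
     - ((S.bel * y1 - y1 * S.bel) - (aS c * y1 - y1 * aS c)) + x1 * ((y1 * y - y * y1) - aS L)
     - y1 * ((y1 * x - x * y1) - aS K) - (x1 * y1 - y1 * x1) * y"
    unfolding S.bel_commutator by (simp add: algebra_simps)
  then show ?thesis
    by (simp only:) (intro J_add J_diff J_uminus bc_J J_mult LJ KJ V_J)
qed

text \<open>The invariance of the pairing under \<open>f\<close> at \<open>x\<^sub>1\<close> and \<open>x\<close>, here a consequence of the relations of \<open>H\<^sub>c\<close>.\<close>

lemma f_G: "(f * aS G - aS G * f) - (aS K + aS K') \<in> J"
proof -
  have "(f * aS G - aS G * f) - (aS K + aS K') =
     - (f * ((x1 * x - x * x1) - aS G) - ((x1 * x - x * x1) - aS G) * f)
     + ((y1 * x - x * y1) - aS K) + ((x1 * y - y * x1) - aS K')"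
    by (simp add: algebra_simps S.order S.order_assoc)
  then show ?thesis
    by (simp only:) (intro J_add J_diff J_uminus J_mult GJ KJ K'J)
qed

text \<open>The Jacobi identity for \<open>x\<close>, \<open>y\<close> and \<open>x\<^sub>1\<close>.\<close>

lemma jacobi: "(x * aS K' - aS K' * x) - (y * aS G - aS G * y) \<in> J"
proof -
  have "(x * aS K' - aS K' * x) - (y * aS G - aS G * y) =
     - (x * ((x1 * y - y * x1) - aS K') - ((x1 * y - y * x1) - aS K') * x)
     + (y * ((x1 * x - x * x1) - aS G) - ((x1 * x - x * x1) - aS G) * y)
     + (x1 * (x * y - y * x) - (x * y - y * x) * x1)"
    by (simp add: algebra_simps)
  then show ?thesis
    by (simp only:) (intro J_add J_diff J_uminus J_mult GJ K'J V_J)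
qed

end

lemma commutator_shift:
  fixes a :: "'r::ring"
  assumes "a * v - v * a = F + (v * w - w * v) + U"
  shows "(a + w) * v - v * (a + w) = F + U"
proof -
  have "(a + w) * v - v * (a + w) = (a * v - v * a) - (v * w - w * v)"
    by (simp add: algebra_simps)
  then show ?thesis unfolding assms by simp
qed

lemma commutator_bracket:
  fixes D :: "'r::ring"
  assumes "D * g = g * D"
  shows "D * (g * v - v * g) - (g * v - v * g) * D = g * (D * v - v * D) - (D * v - v * D) * g"
proof -
  have "D * (g * v - v * g) = g * (D * v) - (D * v) * g"
    by (simp only: right_diff_distrib mult.assoc[symmetric] assms)
  moreover have "(g * v - v * g) * D = g * (v * D) - (v * D) * g"
    by (simp only: left_diff_distrib mult.assoc assms)
  ultimately show ?thesis
    by (simp add: algebra_simps)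
qed

section \<open>The shape of \<open>c\<close> and the lift of \<open>d\<close>\<close>

text \<open>The difference of \<open>\<Phi>\<close> in \<open>\<alpha>\<close> has period \<open>1\<close> in \<open>\<beta>\<close> and is therefore independent of \<open>\<beta>\<close>. Hence \<open>\<Phi>\<close> is the sum of a
  function of \<open>\<alpha>\<close> and one of \<open>\<beta>\<close>, and the zeros on the line \<open>\<alpha> = \<beta> - 1\<close> relate the two.\<close>

lemma mixed_difference_zero:
  fixes \<Phi> :: "'k::field_char_0 \<Rightarrow> 'k \<Rightarrow> 'k"
  assumes poly: "sep_poly \<Phi>"
    and mixed: "\<And>\<alpha> \<beta>. \<Phi> \<alpha> \<beta> + \<Phi> (\<alpha> - 1) (\<beta> - 1) = \<Phi> (\<alpha> - 1) \<beta> + \<Phi> \<alpha> (\<beta> - 1)"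
    and diag: "\<And>\<beta>. \<Phi> (\<beta> - 1) \<beta> = 0"
  shows "\<Phi> \<alpha> \<beta> = \<Phi> \<alpha> 0 - \<Phi> (\<beta> - 1) 0"
proof -
  have p1: "poly_fun (\<lambda>\<alpha>. \<Phi> \<alpha> \<beta>)" and p2: "poly_fun (\<Phi> \<alpha>)" for \<alpha> \<beta>
    using poly by (simp_all add: sep_poly_def)
  have A: "\<Phi> (\<alpha> + 1) \<beta> - \<Phi> \<alpha> \<beta> = \<Phi> (\<alpha> + 1) 0 - \<Phi> \<alpha> 0" for \<alpha> \<beta>
    by (rule poly_fun_periodic[of "\<lambda>\<beta>. \<Phi> (\<alpha> + 1) \<beta> - \<Phi> \<alpha> \<beta>" \<beta> 0], intro poly_fun_diff p2)
      (use mixed[of "\<alpha> + 1" "_ + 1"] in \<open>simp add: algebra_simps\<close>)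
  have B: "\<Phi> \<alpha> \<beta> - \<Phi> \<alpha> 0 = \<Phi> 0 \<beta> - \<Phi> 0 0" for \<alpha> \<beta>
    by (rule poly_fun_periodic[of "\<lambda>\<alpha>. \<Phi> \<alpha> \<beta> - \<Phi> \<alpha> 0" \<alpha> 0], intro poly_fun_diff p1)
      (use A[of _ \<beta>] in \<open>simp add: algebra_simps\<close>)
  show ?thesis
    using B[of \<alpha> \<beta>] B[of "\<beta> - 1" \<beta>] diag[of \<beta>] by (simp add: algebra_simps)
qed

lemma smash_uea: "abs_smash p = abs_smash q \<Longrightarrow> abs_uea p = abs_uea q"
  using idl_smash_subset_idl_UV by (auto simp: abs_smash_eq_iff abs_uea_eq_iff)

lemma V_free_state:
  assumes "i \<noteq> 0 \<or> j \<noteq> 0 \<or> k \<noteq> 0 \<or> l \<noteq> 0"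
  shows "actA (aU p) vacuum a b i j k l \<alpha> \<beta> = 0"
proof -
  have "\<forall>a b i j k l \<alpha> \<beta>. (i \<noteq> 0 \<or> j \<noteq> 0 \<or> k \<noteq> 0 \<or> l \<noteq> 0) \<longrightarrow> act (incl p) vacuum a b i j k l \<alpha> \<beta> = 0"
  proof (induction p rule: free_algebra_induct)
    case (scalar r)
    show ?case by (simp add: incl_scalar act_scalar smul_def mono_state_def)
  next
    case (gen g p)
    then show ?case
      by (cases g) (simp_all add: incl_mult incl_gen act_gen_mult lop.simps)
  qed (simp add: incl_add act_add fun_arith)
  then show ?thesis using assms unfolding actA_abs by blast
qed

text \<open>Commuting with \<open>h\<close> leaves only the terms \<open>f\<^sup>a p(\<alpha>, \<beta>) e\<^sup>a\<close>. Commuting with \<open>e\<close> gives a recursion in \<open>a\<close>, in which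
  the next coefficient is multiplied by a nonzero polynomial, so that all of them vanish with the first one.\<close>

lemma hc_injective:
  assumes e: "abs_uea (gen (Inl Ge)) * aU p = aU p * abs_uea (gen (Inl Ge))"
    and h: "abs_uea (gen (Inl Gh)) * aU p = aU p * abs_uea (gen (Inl Gh))"
    and zero: "\<And>\<alpha> \<beta>. hc (aU p) \<alpha> \<beta> = 0"
  shows "aU p = (0 :: 'k::field_char_0 uea)"
proof (rule vacuum_faithful)
  let ?\<psi> = "actA (aU p :: 'k uea) vacuum"
  have R: "lop (Inl g) ?\<psi> = rop (Inl g) ?\<psi>" if "abs_uea (gen (Inl g)) * aU p = aU p * (abs_uea (gen (Inl g)) :: 'k uea)" "g \<noteq> Gf" for g
    using arg_cong[OF that(1), of "\<lambda>z. actA z vacuum"] that(2) by (subst (asm) act_mult_gen) simp_all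
  have offdiag: "?\<psi> a b 0 0 0 0 \<alpha> \<beta> = 0" if "a \<noteq> b" for a b \<alpha> \<beta>
  proof -
    have "lop (Inl Gh) ?\<psi> a b 0 0 0 0 \<alpha> \<beta> = rop (Inl Gh) ?\<psi> a b 0 0 0 0 \<alpha> \<beta>"
      by (simp only: R[OF h] gl2.distinct not_False_eq_True)
    then have "?\<psi> a b 0 0 0 0 \<alpha> \<beta> = 0 \<or> b = a"
      by (simp add: lop.simps rop.simps algebra_simps)
    then show ?thesis using that by auto
  qed
  have diag: "?\<psi> a a 0 0 0 0 \<alpha> \<beta> = 0" for a \<alpha> \<beta>
  proof (induction a arbitrary: \<alpha> \<beta>)
    case 0
    show ?case using zero by (simp add: hc_def)
  next
    case (Suc a)
    have eq: "of_nat (Suc a) * (\<alpha> - \<beta> - of_nat a) * ?\<psi> (Suc a) (Suc a) 0 0 0 0 \<alpha> \<beta> = 0" for \<alpha> \<beta>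
    proof -
      have "lop (Inl Ge) ?\<psi> a (Suc a) 0 0 0 0 \<alpha> \<beta> = rop (Inl Ge) ?\<psi> a (Suc a) 0 0 0 0 \<alpha> \<beta>"
        by (simp only: R[OF e] gl2.distinct not_False_eq_True)
      then show ?thesis by (simp add: lop.simps rop.simps Suc.IH)
    qed
    have "?\<psi> (Suc a) (Suc a) 0 0 0 0 \<alpha> \<beta> = 0"
    proof (rule poly_fun_eq_zero[of "\<lambda>\<alpha>. ?\<psi> (Suc a) (Suc a) 0 0 0 0 \<alpha> \<beta>"])
      show "poly_fun (\<lambda>\<alpha>. ?\<psi> (Suc a) (Suc a) 0 0 0 0 \<alpha> \<beta>)"
        using sep_poly_act_vacuum[of "aU p"] by (simp add: sep_poly_def)
      have "- {\<beta> + of_nat a} \<subseteq> {\<alpha>. ?\<psi> (Suc a) (Suc a) 0 0 0 0 \<alpha> \<beta> = 0}"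
      proof
        fix \<alpha> assume "\<alpha> \<in> - {\<beta> + of_nat a}"
        then have "\<alpha> - \<beta> - of_nat a \<noteq> 0" by (auto simp: algebra_simps)
        then show "\<alpha> \<in> {\<alpha>. ?\<psi> (Suc a) (Suc a) 0 0 0 0 \<alpha> \<beta> = 0}"
          using eq[of \<alpha> \<beta>] by (simp del: of_nat_Suc)
      qed
      moreover have "infinite (- {\<beta> + of_nat a :: 'k})"
        using infinite_UNIV_char_0 by (simp add: Compl_eq_Diff_UNIV)
      ultimately show "infinite {\<alpha>. ?\<psi> (Suc a) (Suc a) 0 0 0 0 \<alpha> \<beta> = 0}"
        using infinite_super by blast
    qed
    then show ?case .
  qed
  show "?\<psi> = 0"
  proof (intro ext)
    fix a b i j k l \<alpha> \<beta>
    show "?\<psi> a b i j k l \<alpha> \<beta> = 0 a b i j k l \<alpha> \<beta>"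
      using offdiag[of a b] diag[of a] V_free_state[of i j k l p a b \<alpha> \<beta>]
      by (cases "i \<noteq> 0 \<or> j \<noteq> 0 \<or> k \<noteq> 0 \<or> l \<noteq> 0"; cases "a = b") (simp_all add: fun_arith)
  qed
qed

text \<open>The coefficients of \<open>x\<close> and \<open>y\<close> from the enveloping algebra of \<open>gl\<^sub>2\<close> can be read off from normal forms. This
  allows the values of \<open>\<gamma>\<close> to be recovered from the commutators of \<open>c\<close>.\<close>

lemma V_independent:
  assumes "aU p * abs_uea (gen (Inr Vx)) = aU q * (abs_uea (gen (Inr Vy)) :: 'k::field_char_0 uea)"
  shows "aU p = (0 :: 'k uea) \<and> aU q = (0 :: 'k uea)"
proof -
  have "rop (Inr Vx) (actA (aU p) vacuum) = rop (Inr Vy) (actA (aU q :: 'k uea) vacuum)"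
    using arg_cong[OF assms, of "\<lambda>z. actA z vacuum"] by (subst (asm) (1 2) act_mult_gen) simp_all
  then have E: "rop (Inr Vx) (actA (aU p) vacuum) a b i j 0 0 \<alpha> \<beta> = rop (Inr Vy) (actA (aU q :: 'k uea) vacuum) a b i j 0 0 \<alpha> \<beta>" for a b i j \<alpha> \<beta>
    by simp
  have q: "actA (aU q :: 'k uea) vacuum a b 0 0 0 0 \<alpha> \<beta> = 0" for a b \<alpha> \<beta>
    using E[of a b 0 1 \<alpha> \<beta>] by (simp add: rop.simps)
  have p: "actA (aU p :: 'k uea) vacuum a b 0 0 0 0 \<alpha> \<beta> = 0" for a b \<alpha> \<beta>
    using E[of a b 1 0 \<alpha> \<beta>] by (simp add: rop.simps q)
  have "actA (aU q :: 'k uea) vacuum = 0"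
  proof (intro ext)
    show "actA (aU q :: 'k uea) vacuum a b i j k l \<alpha> \<beta> = 0 a b i j k l \<alpha> \<beta>" for a b i j k l \<alpha> \<beta>
      using q V_free_state[of i j k l q a b \<alpha> \<beta>]
      by (cases "i \<noteq> 0 \<or> j \<noteq> 0 \<or> k \<noteq> 0 \<or> l \<noteq> 0") (simp_all add: fun_arith)
  qed
  moreover have "actA (aU p :: 'k uea) vacuum = 0"
  proof (intro ext)
    show "actA (aU p :: 'k uea) vacuum a b i j k l \<alpha> \<beta> = 0 a b i j k l \<alpha> \<beta>" for a b i j k l \<alpha> \<beta>
      using p V_free_state[of i j k l p a b \<alpha> \<beta>]
      by (cases "i \<noteq> 0 \<or> j \<noteq> 0 \<or> k \<noteq> 0 \<or> l \<noteq> 0") (simp_all add: fun_arith)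
  qed
  ultimately show ?thesis using vacuum_faithful by blast
qed

context cherednik
begin

abbreviation "xU \<equiv> abs_uea (gen (Inr Vx)) :: 'k uea"
abbreviation "yU \<equiv> abs_uea (gen (Inr Vy)) :: 'k uea"
abbreviation "x1U \<equiv> abs_uea (gen (Inr Vx1)) :: 'k uea"
abbreviation "y1U \<equiv> abs_uea (gen (Inr Vy1)) :: 'k uea"

lemma homog_01: "homog 0 p \<Longrightarrow> homog 1 q \<Longrightarrow> homog 1 (p * q)" and homog_10: "homog 1 p \<Longrightarrow> homog 0 q \<Longrightarrow> homog 1 (p * q)"
  and homog_00: "homog 0 p \<Longrightarrow> homog 0 q \<Longrightarrow> homog 0 (p * q)"
  using homog_mult[of 0 p 1 q] homog_mult[of 1 p 0 q] homog_mult[of 0 p 0 q] by simp_all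

lemma U_c_x: "aU c * xU - xU * aU c = aU K * xU - aU G * yU"
proof -
  have "abs_uea ((incl c * gen (Inr Vx) - gen (Inr Vx) * incl c) - (incl K * gen (Inr Vx) - incl G * gen (Inr Vy))) = 0"
    using c_x by (intro J_homog[where n = 1] homog_diff homog_01 homog_10 homog_incl homog_V) simp
  then show ?thesis by (simp add: algebra_simps)
qed

lemma U_c_y: "aU c * yU - yU * aU c = aU L * xU - aU K' * yU"
proof -
  have "abs_uea ((incl c * gen (Inr Vy) - gen (Inr Vy) * incl c) - (incl L * gen (Inr Vx) - incl K' * gen (Inr Vy))) = 0"
    using c_y by (intro J_homog[where n = 1] homog_diff homog_01 homog_10 homog_incl homog_V) simp
  then show ?thesis by (simp add: algebra_simps)
qed

lemma U_c_x1: "aU c * x1U - x1U * aU c = x1U * aU K' - y1U * aU G"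
proof -
  have "abs_uea ((incl c * gen (Inr Vx1) - gen (Inr Vx1) * incl c) - (gen (Inr Vx1) * incl K' - gen (Inr Vy1) * incl G)) = 0"
    using c_x1 by (intro J_homog[where n = 1] homog_diff homog_01 homog_10 homog_incl homog_V) simp
  then show ?thesis by (simp add: algebra_simps)
qed

lemma U_f_G: "abs_uea (gen (Inl Gf)) * aU G - aU G * abs_uea (gen (Inl Gf)) = aU K + aU K'"
proof -
  have "abs_uea ((gen (Inl Gf) * incl G - incl G * gen (Inl Gf)) - (incl K + incl K')) = 0"
    using f_G by (intro J_homog[where n = 0] homog_diff homog_add homog_00 homog_incl homog_g) simp
  then show ?thesis by (simp add: algebra_simps)
qed

lemma U_jacobi: "xU * aU K' - aU K' * xU = yU * aU G - aU G * yU"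
proof -
  have "abs_uea ((gen (Inr Vx) * incl K' - incl K' * gen (Inr Vx)) - (gen (Inr Vy) * incl G - incl G * gen (Inr Vy))) = 0"
    using jacobi by (intro J_homog[where n = 1] homog_diff homog_01 homog_10 homog_incl homog_V) simp
  then show ?thesis by (simp add: algebra_simps)
qed

text \<open>Four relations are compared in one coefficient each: \<open>[c, x]\<close> and the Jacobi identity in that of \<open>x\<close>,
  \<open>[c, x\<^sub>1]\<close> in that of \<open>x\<^sub>1\<close> and the invariance under \<open>f\<close> in that of \<open>1\<close>. They involve the projections of \<open>c\<close>,
  \<open>K\<close>, \<open>K'\<close> and the coefficient \<open>g\<close> of \<open>e\<close> in \<open>G\<close>, and the equation for \<open>c\<close> results by eliminating the others.\<close>

lemma functional_equation:
  fixes \<alpha> \<beta> :: 'k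
  defines "\<Phi> \<equiv> \<lambda>\<alpha> \<beta>. (\<alpha> - \<beta> + 1) * hc (aU c) \<alpha> \<beta>"
  shows "\<Phi> \<alpha> \<beta> + \<Phi> (\<alpha> - 1) (\<beta> - 1) = \<Phi> (\<alpha> - 1) \<beta> + \<Phi> \<alpha> (\<beta> - 1)"
proof -
  let ?g = "\<lambda>\<alpha> \<beta>. actA (aU G) vacuum 0 1 0 0 0 0 \<alpha> \<beta>"
  have E1: "hc (aU c) \<alpha> \<beta> - hc (aU c) (\<alpha> - 1) \<beta> = hc (aU K) \<alpha> \<beta> - ?g \<alpha> \<beta>" for \<alpha> \<beta>
  proof -
    have "rop (Inr Vx) (actA (aU c) vacuum) - lop (Inr Vx) (actA (aU c) vacuum) =
        rop (Inr Vx) (actA (aU K) vacuum) - rop (Inr Vy) (actA (aU G) vacuum)"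
      using arg_cong[OF U_c_x, of "\<lambda>z. actA z vacuum"] by (simp add: act_mult_gen[symmetric])
    then have "(rop (Inr Vx) (actA (aU c) vacuum) - lop (Inr Vx) (actA (aU c) vacuum)) 0 0 1 0 0 0 \<alpha> \<beta> =
        (rop (Inr Vx) (actA (aU K) vacuum) - rop (Inr Vy) (actA (aU G) vacuum)) 0 0 1 0 0 0 \<alpha> \<beta>"
      by simp
    then show ?thesis by (simp add: fun_arith hc_def lop.simps rop.simps)
  qed
  have E2: "hc (aU c) \<alpha> \<beta> - hc (aU c) \<alpha> (\<beta> + 1) = hc (aU K') \<alpha> (\<beta> + 1)" for \<alpha> \<beta>
  proof -
    have "rop (Inr Vx1) (actA (aU c) vacuum) - lop (Inr Vx1) (actA (aU c) vacuum) =
        lop (Inr Vx1) (actA (aU K') vacuum) - lop (Inr Vy1) (actA (aU G) vacuum)"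
      using arg_cong[OF U_c_x1, of "\<lambda>z. actA z vacuum"] by (simp add: act_mult_gen[symmetric])
    then have "(rop (Inr Vx1) (actA (aU c) vacuum) - lop (Inr Vx1) (actA (aU c) vacuum)) 0 0 0 0 1 0 \<alpha> \<beta> =
        (lop (Inr Vx1) (actA (aU K') vacuum) - lop (Inr Vy1) (actA (aU G) vacuum)) 0 0 0 0 1 0 \<alpha> \<beta>"
      by simp
    then show ?thesis by (simp add: fun_arith hc_def lop.simps rop.simps)
  qed
  have E3: "- ((\<alpha> - \<beta>) * ?g \<alpha> \<beta>) = hc (aU K) \<alpha> \<beta> + hc (aU K') \<alpha> \<beta>" for \<alpha> \<beta>
  proof -
    have "actA (aU G * abs_uea (gen (Inl Gf))) vacuum = rop (Inl Gf) (actA (aU G) vacuum)"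
      using act_incl_mult_gen_vacuum[of G Gf] by (simp add: act_gen actA_abs act_mult)
    then have "lop (Inl Gf) (actA (aU G) vacuum) - rop (Inl Gf) (actA (aU G) vacuum) = actA (aU K) vacuum + actA (aU K') vacuum"
      using arg_cong[OF U_f_G, of "\<lambda>z. actA z vacuum"] by simp
    then have "(lop (Inl Gf) (actA (aU G) vacuum) - rop (Inl Gf) (actA (aU G) vacuum)) 0 0 0 0 0 0 \<alpha> \<beta> =
        (actA (aU K) vacuum + actA (aU K') vacuum) 0 0 0 0 0 0 \<alpha> \<beta>"
      by simp
    then show ?thesis by (simp add: fun_arith hc_def lop.simps rop.simps)
  qed
  have E4: "hc (aU K') (\<alpha> - 1) \<beta> - hc (aU K') \<alpha> \<beta> = - ?g \<alpha> \<beta>" for \<alpha> \<beta>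
  proof -
    have "lop (Inr Vx) (actA (aU K') vacuum) - rop (Inr Vx) (actA (aU K') vacuum) =
        lop (Inr Vy) (actA (aU G) vacuum) - rop (Inr Vy) (actA (aU G) vacuum)"
      using arg_cong[OF U_jacobi, of "\<lambda>z. actA z vacuum"] by (simp add: act_mult_gen[symmetric])
    then have "(lop (Inr Vx) (actA (aU K') vacuum) - rop (Inr Vx) (actA (aU K') vacuum)) 0 0 1 0 0 0 \<alpha> \<beta> =
        (lop (Inr Vy) (actA (aU G) vacuum) - rop (Inr Vy) (actA (aU G) vacuum)) 0 0 1 0 0 0 \<alpha> \<beta>"
      by simp
    then show ?thesis by (simp add: fun_arith hc_def lop.simps rop.simps)
  qed
  have k': "hc (aU K') \<alpha> \<beta> = hc (aU c) \<alpha> (\<beta> - 1) - hc (aU c) \<alpha> \<beta>" for \<alpha> \<beta>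
    using E2[of \<alpha> "\<beta> - 1"] by simp
  have g: "?g \<alpha> \<beta> = hc (aU K') \<alpha> \<beta> - hc (aU K') (\<alpha> - 1) \<beta>"
    using E4[of \<alpha> \<beta>] by (simp add: algebra_simps)
  have "(\<alpha> - \<beta> + 1) * ?g \<alpha> \<beta> = hc (aU c) (\<alpha> - 1) \<beta> - hc (aU c) \<alpha> \<beta> - hc (aU K') \<alpha> \<beta>"
    using E1[of \<alpha> \<beta>] E3[of \<alpha> \<beta>] by (simp add: algebra_simps)
  then show ?thesis
    unfolding \<Phi>_def g k' by (simp add: algebra_simps)
qed

text \<open>By the functional equation \<open>(\<alpha> - \<beta> + 1) c(\<alpha>, \<beta>) = p(\<alpha>) - p(\<beta> - 1)\<close> for a polynomial \<open>p\<close>. For the polynomial \<open>q\<close> with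
  \<open>q(2 \<alpha> + 2) = 2 p(\<alpha>)\<close>, interpolation yields a \<open>c'\<close> with the same projection as \<open>c\<close>, and the projection determines
  elements that commute with \<open>e\<close> and \<open>h\<close>.\<close>

lemma c_interpolates:
  obtains c' w C Z C' Z' where "S.good_X (aS c') (aS w) (aS C) (aS Z)" "S.good_W (aS c') (aS w) (aS C') (aS Z')"
    "aU c = aU c'"
proof -
  define \<Phi> where "\<Phi> = (\<lambda>\<alpha> \<beta>. (\<alpha> - \<beta> + 1) * hc (aU c) \<alpha> \<beta>)"
  have hcpoly: "sep_poly (hc (aU p))" for p :: "gl2 word \<Rightarrow>\<^sub>0 'k"
    using sep_poly_act_vacuum[of "aU p" 0 0 0 0 0 0] by (simp add: hc_def[abs_def])
  have poly: "sep_poly \<Phi>"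
    using hcpoly[of c] unfolding sep_poly_def \<Phi>_def
    by (auto intro!: poly_fun_mult poly_fun_add poly_fun_diff poly_fun_const poly_fun_id)
  have mixed: "\<Phi> \<alpha> \<beta> + \<Phi> (\<alpha> - 1) (\<beta> - 1) = \<Phi> (\<alpha> - 1) \<beta> + \<Phi> \<alpha> (\<beta> - 1)" for \<alpha> \<beta>
    using functional_equation[of \<alpha> \<beta>] by (simp only: \<Phi>_def)
  have \<Phi>: "\<Phi> \<alpha> \<beta> = \<Phi> \<alpha> 0 - \<Phi> (\<beta> - 1) 0" for \<alpha> \<beta>
    by (rule mixed_difference_zero[OF poly mixed]) (simp add: \<Phi>_def)
  have "poly_fun (\<lambda>\<alpha>. \<Phi> \<alpha> 0)"
    using poly by (simp add: sep_poly_def)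
  then obtain p where p: "\<And>\<alpha>. \<Phi> \<alpha> 0 = poly p \<alpha>"
    unfolding poly_fun_def by blast
  define q where "q = smult 2 (pcompose p [:-1, 1/2:])"
  have q: "poly q (2 * \<alpha> + 2) = 2 * \<Phi> \<alpha> 0" "poly q (2 * \<alpha>) = 2 * \<Phi> (\<alpha> - 1) 0" for \<alpha>
    by (simp_all add: q_def poly_pcompose p algebra_simps)
  obtain c' w C Z C' Z' where good: "S.good_X (aS c') (aS w) (aS C) (aS Z)" "S.good_W (aS c') (aS w) (aS C') (aS Z')"
    and h: "\<And>\<alpha> \<beta>. (2 * \<alpha> + 2) * hc (aU c') \<alpha> \<beta> + hc (aU w) \<alpha> \<beta> = poly q (2 * \<alpha> + 2)"
     "\<And>\<alpha> \<beta>. (2 * \<beta>) * hc (aU c') \<alpha> \<beta> + hc (aU w) \<alpha> \<beta> = poly q (2 * \<beta>)"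
    using interpolation[of q] by blast
  have eq: "(\<alpha> - \<beta> + 1) * hc (aU c') \<alpha> \<beta> = (\<alpha> - \<beta> + 1) * hc (aU c) \<alpha> \<beta>" for \<alpha> \<beta>
  proof -
    have "2 * ((\<alpha> - \<beta> + 1) * hc (aU c') \<alpha> \<beta>) = 2 * \<Phi> \<alpha> \<beta>"
    proof -
      have "((2 * \<alpha> + 2) * hc (aU c') \<alpha> \<beta> + hc (aU w) \<alpha> \<beta>) - ((2 * \<beta>) * hc (aU c') \<alpha> \<beta> + hc (aU w) \<alpha> \<beta>) =
          2 * \<Phi> \<alpha> 0 - 2 * \<Phi> (\<beta> - 1) 0"
        by (simp only: h q)
      then show ?thesis unfolding \<Phi>[of \<alpha> \<beta>] by (simp add: algebra_simps)
    qed
    then show ?thesis by (simp add: \<Phi>_def)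
  qed
  have hc0: "hc (aU (c - c')) \<alpha> \<beta> = 0" for \<alpha> \<beta>
  proof (rule poly_fun_eq_zero[of "\<lambda>\<alpha>. hc (aU (c - c')) \<alpha> \<beta>"])
    show "poly_fun (\<lambda>\<alpha>. hc (aU (c - c')) \<alpha> \<beta>)"
      using hcpoly[of "c - c'"] by (simp add: sep_poly_def)
    have "- {\<beta> - 1} \<subseteq> {\<alpha>. hc (aU (c - c')) \<alpha> \<beta> = 0}"
    proof
      fix \<alpha> assume "\<alpha> \<in> - {\<beta> - 1}"
      then have "\<alpha> - \<beta> + 1 \<noteq> 0" by (auto simp: algebra_simps)
      then show "\<alpha> \<in> {\<alpha>. hc (aU (c - c')) \<alpha> \<beta> = 0}"
        using eq[of \<alpha> \<beta>] by (simp add: incl_diff hc_diff)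
    qed
    moreover have "infinite (- {\<beta> - 1 :: 'k})"
      using infinite_UNIV_char_0 by (simp add: Compl_eq_Diff_UNIV)
    ultimately show "infinite {\<alpha>. hc (aU (c - c')) \<alpha> \<beta> = 0}"
      using infinite_super by blast
  qed
  have comm: "abs_uea (gen (Inl a)) * aU c = aU c * abs_uea (gen (Inl a))" for a
  proof -
    have "incl (c * gen a - gen a * c) \<in> idl UV_rels"
      using incl_idl_U[OF c_central] idl_smash_subset_idl_UV by blast
    then have "abs_uea (incl (c * gen a - gen a * c)) = abs_uea 0"
      unfolding abs_uea_eq_iff by simp
    then show ?thesis by (simp add: incl_diff incl_mult incl_gen)
  qed
  have comm': "abs_uea (gen (Inl Ge)) * aU c' = aU c' * abs_uea (gen (Inl Ge))" "abs_uea (gen (Inl Gh)) * aU c' = aU c' * abs_uea (gen (Inl Gh))"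
    using good(1) smash_uea[of "gen (Inl Ge) * incl c'" "incl c' * gen (Inl Ge)"] smash_uea[of "gen (Inl Gh) * incl c'" "incl c' * gen (Inl Gh)"]
    by (simp_all add: S.good_X_def S.g_invariant_def)
  have "aU (c - c') = (0 :: 'k uea)"
    by (rule hc_injective[OF _ _ hc0]) (simp_all add: incl_diff left_diff_distrib right_diff_distrib comm comm')
  then have "aU c = aU c'" by (simp add: incl_diff)
  with good show thesis by (rule that)
qed

text \<open>The commutators \<open>[c, x]\<close> and \<open>[c, y]\<close> are known from \<open>good_X\<close> and, on the other hand, expressed by \<open>\<gamma>\<close>.
  Comparing the coefficients of \<open>x\<close> and \<open>y\<close> gives the values of \<open>\<gamma>\<close>.\<close>

lemma pairing_values:
  assumes X: "S.good_X (aS c') (aS w) (aS C) (aS Z)" and c: "aU c = aU c'"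
  shows "(y1 * x - x * y1) - (aS C + aS Z * h) \<in> J" "(x1 * x - x * x1) - (- (aS Z * e) - aS Z * e) \<in> J"
    "(y1 * y - y * y1) - (aS Z * f + aS Z * f) \<in> J" "(x1 * y - y * x1) - (aS Z * h - aS C) \<in> J"
proof -
  let ?K = "C + Z * gen Gh" and ?G = "- (Z * gen Ge) - Z * gen Ge" and ?L = "Z * gen Gf + Z * gen Gf" and ?K' = "Z * gen Gh - C"
  note I = incl_add incl_diff incl_mult incl_gen incl_uminus
  have "abs_smash (gen (Inr Vx) * incl c') = abs_smash (incl c' * gen (Inr Vx) - incl C * gen (Inr Vx) -
      incl Z * (gen (Inl Gh) * gen (Inr Vx) + gen (Inl Ge) * gen (Inr Vy) + gen (Inl Ge) * gen (Inr Vy)))"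
    using X by (simp add: S.good_X_def S.hat_x_def)
  from smash_uea[OF this] have "aU c * xU - xU * aU c = aU C * xU + aU Z * (abs_uea (gen (Inl Gh)) * xU + abs_uea (gen (Inl Ge)) * yU + abs_uea (gen (Inl Ge)) * yU)"
    by (simp add: c)
  with U_c_x have "aU (K - ?K) * xU = aU (G - ?G) * yU"
    by (simp add: I algebra_simps)
  then have KG: "aU (K - ?K) = (0 :: 'k uea)" "aU (G - ?G) = (0 :: 'k uea)"
    using V_independent by blast+
  have "abs_smash (gen (Inr Vy) * incl c') = abs_smash (incl c' * gen (Inr Vy) - incl C * gen (Inr Vy) -
      incl Z * (gen (Inl Gf) * gen (Inr Vx) + gen (Inl Gf) * gen (Inr Vx) - gen (Inl Gh) * gen (Inr Vy)))"
    using X by (simp add: S.good_X_def S.hat_y_def)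
  from smash_uea[OF this] have "aU c * yU - yU * aU c = aU C * yU + aU Z * (abs_uea (gen (Inl Gf)) * xU + abs_uea (gen (Inl Gf)) * xU - abs_uea (gen (Inl Gh)) * yU)"
    by (simp add: c)
  with U_c_y have "aU (L - ?L) * xU = aU (K' - ?K') * yU"
    by (simp add: I algebra_simps)
  then have LK: "aU (L - ?L) = (0 :: 'k uea)" "aU (K' - ?K') = (0 :: 'k uea)"
    using V_independent by blast+
  have *: "aS p - aS q \<in> J" if "aU (p - q) = (0 :: 'k uea)" for p q
    using uea_zero_J[OF that homog_incl] by (simp add: incl_diff)
  show "(y1 * x - x * y1) - (aS C + aS Z * h) \<in> J"
    using J_trans[OF KJ *[OF KG(1)]] by (simp add: I)
  show "(x1 * x - x * x1) - (- (aS Z * e) - aS Z * e) \<in> J"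
    using J_trans[OF GJ *[OF KG(2)]] by (simp add: I)
  show "(y1 * y - y * y1) - (aS Z * f + aS Z * f) \<in> J"
    using J_trans[OF LJ *[OF LK(1)]] by (simp add: I)
  show "(x1 * y - y * x1) - (aS Z * h - aS C) \<in> J"
    using J_trans[OF K'J *[OF LK(2)]] by (simp add: I)
qed

text \<open>Substituting the values of \<open>\<gamma>\<close> into the formula for \<open>[d, x]\<close> gives \<open>(t + 2 - M) [c, x]\<close>, which is \<open>- [w, x]\<close>.\<close>

lemma d_lift_x:
  assumes X: "S.good_X (aS c') (aS w) (aS C) (aS Z)" and c: "aU c = aU c'"
  shows "(S.del + aS w) * x - x * (S.del + aS w) \<in> J"
proof -
  note P = pairing_values[OF X c]
  have g: "S.g_invariant (aS C)" "S.g_invariant (aS Z)"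
    and S: "x * aS w = aS w * x + (t + 1 + 1) * (aS C * x + aS Z * S.hat_x) - h * (aS C * x + aS Z * S.hat_x)
      - e * (aS C * y + aS Z * S.hat_y) - e * (aS C * y + aS Z * S.hat_y)"
    using X by (simp_all add: S.good_X_def)
  let ?K = "aS C + aS Z * h" and ?G = "- (aS Z * e) - aS Z * e" and ?K' = "aS Z * h - aS C"
  \<comment> \<open>The formula for \<open>[d, x]\<close> is linear in the commutators \<open>k\<close>, \<open>g\<close>, \<open>k'\<close> and may be expanded around their values.\<close>
  let ?F = "\<lambda>k g k'. t * (k * x - g * y) - (e + e) * (k * y) - h * (k * x + g * y) + (f + f) * (g * x)
     + (g * y + g * y) - (k' * x + k' * x)"
  let ?k = "y1 * x - x * y1" and ?g = "x1 * x - x * x1" and ?k' = "x1 * y - y * x1"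
  note com = S.g_invariantD[OF g(1)] S.g_invariantD[OF g(2)]
  have R: "?F ?K ?G ?K' = x * aS w - aS w * x"
    unfolding S by (simp add: S.hat_x_def S.hat_y_def algebra_simps S.order S.order_assoc com mult_2)
  have F: "?F k g k' = ?F (k - l) (g - m) (k' - n) + ?F l m n" for k g k' l m n
    by (simp add: algebra_simps)
  have "S.del * x - x * S.del = ?F ?k ?g ?k' + (t * x1 + e * y1 + e * y1 + h * x1 - x1 - x1) * (x * y - y * x)"
    by (rule S.del_commutator_x)
  also have "?F ?k ?g ?k' = ?F (?k - ?K) (?g - ?G) (?k' - ?K') + (x * aS w - aS w * x)"
    by (subst F[of ?k ?g ?k' ?K ?G ?K']) (simp only: R)
  finally have "(S.del + aS w) * x - x * (S.del + aS w) =
      ?F (?k - ?K) (?g - ?G) (?k' - ?K') + (t * x1 + e * y1 + e * y1 + h * x1 - x1 - x1) * (x * y - y * x)"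
    by (rule commutator_shift)
  then show ?thesis
    by (simp only:) (intro J_add J_diff J_mult(2)[OF P(1)] J_mult(2)[OF P(2)] J_mult(2)[OF P(4)] J_mult(1) P V_J)
qed

text \<open>Here \<open>[d, x\<^sub>1]\<close> is \<open>(t + M) [c, x\<^sub>1]\<close> by the formulas for \<open>[c, x\<^sub>1]\<close> and \<open>[c, y\<^sub>1]\<close> in terms of \<open>\<gamma>\<close>.\<close>

lemma d_lift_x1:
  assumes X: "S.good_X (aS c') (aS w) (aS C) (aS Z)" and W: "S.good_W (aS c') (aS w) (aS C') (aS Z')" and c: "aU c = aU c'"
  shows "(S.del + aS w) * x1 - x1 * (S.del + aS w) \<in> J"
proof -
  note P = pairing_values[OF X c]
  have g: "S.g_invariant (aS Z)"
    using X by (simp add: S.good_X_def)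
  note com = S.g_invariantD[OF g, symmetric]
  let ?K = "aS C + aS Z * h" and ?G = "- (aS Z * e) - aS Z * e" and ?L = "aS Z * f + aS Z * f" and ?K' = "aS Z * h - aS C"
  let ?F = "\<lambda>k' g. t * (x1 * k' - y1 * g) + (e + e) * (y1 * k') + h * (y1 * g + x1 * k') - (f + f) * (x1 * g)"
  \<comment> \<open>The component of \<open>t + M\<close> at \<open>x\<^sub>1\<close>, for \<open>p\<close> and \<open>q\<close> in the places of \<open>x\<^sub>1\<close> and \<open>y\<^sub>1\<close>.\<close>
  let ?M = "\<lambda>p q. t * p + h * p + e * q + e * q"
  let ?k' = "x1 * y - y * x1" and ?g = "x1 * x - x * x1" and ?u = "x1 * y1 - y1 * x1"
  let ?p = "aS c' * x1 - x1 * aS c'" and ?q = "aS c' * y1 - y1 * aS c'"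
  let ?U = "h * ?u * x + (e + e) * ?u * y - t * ?u * x - ?u * x - ?u * x"
  have R: "?F ?K' ?G = ?M (x1 * ?K' - y1 * ?G) (x1 * ?L - y1 * ?K)"
    by (simp add: algebra_simps S.order S.order_assoc com mult_2)
  have pq: "?p = aS C' * x1 + aS Z' * S.hat_x1" "?q = aS C' * y1 + aS Z' * S.hat_y1"
    and S: "x1 * aS w = aS w * x1 + t * (aS C' * x1 + aS Z' * S.hat_x1) + h * (aS C' * x1 + aS Z' * S.hat_x1)
      + e * (aS C' * y1 + aS Z' * S.hat_y1) + e * (aS C' * y1 + aS Z' * S.hat_y1)"
    using W by (simp_all add: S.good_W_def)
  have Mpq: "?M ?p ?q = x1 * aS w - aS w * x1"
    unfolding S pq by simp
  have F: "?F k' g = ?F (k' - n) (g - m) + ?F n m" for k' g n m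
    by (simp add: algebra_simps)
  have M: "?M p q = ?M (p - p') (q - q') + ?M p' q'" for p q p' q'
    by (simp add: algebra_simps)
  have cc: "aS c - aS c' \<in> J"
    using uea_zero_J[OF _ homog_incl, of "c - c'"] c by (simp add: incl_diff)
  have "(x1 * ?K' - y1 * ?G) - ?p = - ((aS c * x1 - x1 * aS c) - (x1 * aS K' - y1 * aS G))
       + ((aS c - aS c') * x1 - x1 * (aS c - aS c')) - x1 * (- (?k' - aS K') + (?k' - ?K')) + y1 * (- (?g - aS G) + (?g - ?G))"
    by (simp add: algebra_simps)
  also have "\<dots> \<in> J"
    by (intro J_add J_diff J_uminus c_x1 J_mult(2)[OF cc] J_mult(1) cc K'J GJ P)
  finally have p: "(x1 * ?K' - y1 * ?G) - ?p \<in> J" .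
  have "(x1 * ?L - y1 * ?K) - ?q = - ((aS c * y1 - y1 * aS c) - (x1 * aS L - y1 * aS K))
       + ((aS c - aS c') * y1 - y1 * (aS c - aS c')) - x1 * (- ((y1 * y - y * y1) - aS L) + ((y1 * y - y * y1) - ?L))
       + y1 * (- ((y1 * x - x * y1) - aS K) + ((y1 * x - x * y1) - ?K))"
    by (simp add: algebra_simps)
  also have "\<dots> \<in> J"
    by (intro J_add J_diff J_uminus c_y1 J_mult(2)[OF cc] J_mult(1) cc LJ KJ P)
  finally have q: "(x1 * ?L - y1 * ?K) - ?q \<in> J" .
  have "S.del * x1 - x1 * S.del = ?F ?k' ?g + ?U"
    by (rule S.del_commutator_x1)
  also have "?F ?k' ?g = (?F (?k' - ?K') (?g - ?G) + ?M ((x1 * ?K' - y1 * ?G) - ?p) ((x1 * ?L - y1 * ?K) - ?q)) + (x1 * aS w - aS w * x1)"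
  proof -
    have "?F ?k' ?g = ?F (?k' - ?K') (?g - ?G) + ?F ?K' ?G"
      by (rule F)
    also have "?F ?K' ?G = ?M ((x1 * ?K' - y1 * ?G) - ?p) ((x1 * ?L - y1 * ?K) - ?q) + ?M ?p ?q"
      unfolding R by (rule M)
    also have "?M ?p ?q = x1 * aS w - aS w * x1"
      by (rule Mpq)
    finally show ?thesis by (simp only: add.assoc)
  qed
  finally have "(S.del + aS w) * x1 - x1 * (S.del + aS w) =
      (?F (?k' - ?K') (?g - ?G) + ?M ((x1 * ?K' - y1 * ?G) - ?p) ((x1 * ?L - y1 * ?K) - ?q)) + ?U"
    by (rule commutator_shift)
  then show ?thesis
    by (simp only:) (intro J_add J_diff J_mult(2)[OF J_mult(1)[OF V_J(2)]] J_mult(2)[OF V_J(2)] J_mult(1) P V_J p q)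
qed

text \<open>It remains to treat \<open>y\<close> and \<open>y\<^sub>1\<close>. They are commutators of \<open>f\<close> with \<open>x\<close> and \<open>x\<^sub>1\<close>, and \<open>d + w\<close> commutes with \<open>f\<close>.\<close>

lemma d_lifts: "\<exists>w. \<forall>q. (d_expr + incl w) * q - q * (d_expr + incl w) \<in> idl (H_rels \<gamma>)"
proof -
  obtain c' w C Z C' Z' where X: "S.good_X (aS c') (aS w) (aS C) (aS Z)" and W: "S.good_W (aS c') (aS w) (aS C') (aS Z')"
    and c: "aU c = aU c'" by (rule c_interpolates)
  let ?D = "S.del + aS w"
  have D: "abs_smash (d_expr + incl w) = ?D"
  proof -
    have two: "abs_smash (2 :: (gl2 + vb) word \<Rightarrow>\<^sub>0 'k) = 2"
      using abs_smash_hom(1)[of "1 :: (gl2 + vb) word \<Rightarrow>\<^sub>0 'k" 1] by simp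
    show ?thesis by (simp add: d_expr_def S.del_def two)
  qed
  have gw: "S.g_invariant (aS w)"
    using X by (simp add: S.good_X_def)
  have g: "?D * e = e * ?D" "?D * f = f * ?D" "?D * h = h * ?D" "?D * t = t * ?D"
    using gw by (simp_all add: S.g_invariant_def distrib_left distrib_right S.del_commutes_g)
  have lower: "?D * v' - v' * ?D \<in> J" if "?D * v - v * ?D \<in> J" "v' = f * v - v * f" for v v'
  proof -
    have "?D * v' - v' * ?D = f * (?D * v - v * ?D) - (?D * v - v * ?D) * f"
      unfolding that(2) by (rule commutator_bracket[OF g(2)])
    then show ?thesis by (simp only:) (intro J_diff J_mult(2)[OF that(1)] J_mult(1)[OF that(1)])
  qed
  note Dx = d_lift_x[OF X c] and Dx1 = d_lift_x1[OF X W c]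
  have Dy: "?D * y - y * ?D \<in> J"
    by (rule lower[OF Dx]) (simp add: S.order)
  have Dy1: "?D * y1 - y1 * ?D \<in> J"
    by (rule lower[OF Dx1]) (simp add: S.order)
  have "abs_smash ((d_expr + incl w) * gen b - gen b * (d_expr + incl w)) \<in> J" for b
  proof -
    have "?D * abs_smash (gen b) - abs_smash (gen b) * ?D \<in> J"
    proof (cases b)
      case (Inl a)
      then show ?thesis by (cases a) (simp_all add: g J_zero)
    next
      case (Inr v)
      then show ?thesis using Dx Dy Dx1 Dy1 by (cases v) simp_all
    qed
    then show ?thesis by (simp only: abs_smash_hom D[symmetric])
  qed
  then have "(d_expr + incl w) * gen b - gen b * (d_expr + incl w) \<in> idl (H_rels \<gamma>)" for b
    by (simp only: J_iff)
  then show ?thesis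
    using commutes_if_commutes_gen by blast
qed

end

section \<open>Comparing the center of \<open>H\<^sub>c\<close> with that of its associated graded algebra\<close>

abbreviation scF :: "'k::field_char_0 \<Rightarrow> ((gl2 + vb) word \<Rightarrow>\<^sub>0 'k)"
  where "scF \<equiv> Poly_Mapping.single 0"

lemma lincF_add: "lincomb scF M (p + q) = lincomb scF M p + lincomb scF M q"
  unfolding lincomb_def by (rule setsum_keys_plus_distrib) (simp_all add: single_add distrib_right)

lemma lincF_single: "lincomb scF M (Poly_Mapping.single q r) = scF r * M q"
  by (simp add: lincomb_def)

lemma lincF_zero: "lincomb scF M 0 = 0"
  by (simp add: lincomb_def)

text \<open>The degree of \<open>b\<^sup>i d\<^sup>j\<close>, as \<open>b\<close> and \<open>d\<close> are both homogeneous of degree \<open>2\<close>.\<close>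

definition deg2 :: "nat \<times> nat \<Rightarrow> nat" where "deg2 q = 2 * (fst q + snd q)"

text \<open>The homogeneous part of a commutative polynomial in \<open>b\<close> and \<open>d\<close> for this degree.\<close>

definition rpart :: "nat \<Rightarrow> (nat \<times> nat \<Rightarrow>\<^sub>0 'k::field_char_0) \<Rightarrow> (nat \<times> nat \<Rightarrow>\<^sub>0 'k)"
  where "rpart n r = (\<Sum>q\<in>Poly_Mapping.keys r. if deg2 q = n then Poly_Mapping.single q (Poly_Mapping.lookup r q) else 0)"

lemma rpart_add: "rpart n (p + q) = rpart n p + rpart n q"
  unfolding rpart_def by (rule setsum_keys_plus_distrib) (simp_all add: single_add)

lemma rpart_single: "rpart n (Poly_Mapping.single q r) = (if deg2 q = n then Poly_Mapping.single q r else 0)"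
  by (simp add: rpart_def)

lemma lookup_rpart: "Poly_Mapping.lookup (rpart n r) q = (if deg2 q = n then Poly_Mapping.lookup r q else 0)"
  by (induction r rule: poly_mapping_additive_induct)
    (auto simp: rpart_single rpart_add lookup_add lookup_single when_def)

definition bdF :: "((gl2 + vb) word \<Rightarrow>\<^sub>0 'k::field_char_0) \<Rightarrow> ((gl2 + vb) word \<Rightarrow>\<^sub>0 'k) \<Rightarrow> nat \<times> nat \<Rightarrow> ((gl2 + vb) word \<Rightarrow>\<^sub>0 'k)"
  where "bdF B D q = B ^ fst q * D ^ snd q"

lemma abs_uea_b: "abs_uea b_expr = bA"
  by (simp add: b_expr_def U.bel_def)

lemma abs_uea_d: "abs_uea d_expr = (dA :: 'k::field_char_0 uea)"
proof -
  have "abs_uea (2 :: (gl2 + vb) word \<Rightarrow>\<^sub>0 'k) = 2"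
    using abs_uea_hom(1)[of "1 :: (gl2 + vb) word \<Rightarrow>\<^sub>0 'k" 1] by simp
  then show ?thesis by (simp add: d_expr_def U.del_def)
qed

lemma abs_uea_power: "abs_uea (p ^ n) = abs_uea p ^ n"
  by (induction n) simp_all

lemma abs_uea_lincomb: "abs_uea (lincomb scF (bdF b_expr d_expr) r) = lincomb sclA bd r"
proof (induction r rule: poly_mapping_additive_induct)
  case (single q r)
  show ?case
    by (simp add: lincF_single lincomb_def sclA_def bdF_def bd_def split_def abs_uea_power abs_uea_b abs_uea_d)
next
  case (add p q)
  have "lincomb sclA bd (p + q) = lincomb sclA bd p + lincomb sclA bd q"
    unfolding sclA_def[abs_def] by (rule U.lincomb_add)
  then show ?case by (simp only: add lincF_add abs_uea_hom)
qed

lemma graded_center_spanned: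
  assumes "\<And>b. p * gen b - gen b * p \<in> idl UV_rels"
  shows "\<exists>r. p - lincomb scF (bdF b_expr d_expr) r \<in> idl UV_rels"
proof -
  have "abs_uea p * abs_uea (gen b) = abs_uea (gen b) * abs_uea p" for b
    using assms[of b] by (simp flip: abs_uea_hom add: abs_uea_eq_iff)
  then have "uea_central (abs_uea p)" by (simp add: uea_central_def)
  then obtain r where "abs_uea p = lincomb sclA bd r"
    using center_uea_spanned by blast
  then show ?thesis
    unfolding abs_uea_lincomb[symmetric] abs_uea_eq_iff by blast
qed

lemma graded_center_independent:
  assumes "lincomb scF (bdF b_expr d_expr) r \<in> idl UV_rels"
  shows "r = 0"
proof (rule bd_independent)
  have "abs_uea (lincomb scF (bdF b_expr d_expr) r) = abs_uea 0"
    unfolding abs_uea_eq_iff using assms by simp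
  then show "lincomb sclA bd r = 0"
    by (simp only: abs_uea_lincomb abs_uea_hom)
qed

lemma homog_scF: "homog 0 (scF r)" and homog_one: "homog 0 1"
  by (simp_all add: homog_def hpart_single hpart_one)

lemma homog_b: "homog 2 b_expr"
  unfolding b_expr_def using homog_mult[OF homog_V homog_V]
  by (intro homog_diff) (simp_all only: one_add_one)

lemma homog_d: "homog 2 d_expr"
proof -
  have two: "homog 0 2"
    using homog_add[OF homog_one homog_one] by simp
  have V: "homog 2 (gen (Inr v) * gen (Inr v'))" for v v'
    using homog_mult[OF homog_V homog_V] by (simp only: one_add_one)
  have 1: "homog 2 (p * q)" if "homog 0 p" "homog 2 q" for p q
    using homog_mult[OF that] by (simp only: add_0)
  show ?thesis
    unfolding d_expr_def mult.assoc by (intro homog_diff homog_add 1 V two homog_g)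
qed

lemma homog_power: "homog n p \<Longrightarrow> homog (n * i) (p ^ i)"
  by (induction i) (use homog_mult[of n p] in \<open>simp_all add: homog_one\<close>)

lemma homog_bdF: "homog (deg2 q) (bdF b_expr d_expr q)"
  using homog_mult[OF homog_power[OF homog_b] homog_power[OF homog_d], of "fst q" "snd q"]
  by (simp add: bdF_def deg2_def)

lemma hpart_homog: "homog m p \<Longrightarrow> hpart n p = (if m = n then p else 0)"
  using hpart_hpart[of n m p] by (cases "m = n") (simp_all add: homog_def)

lemma hpart_lincomb: "hpart n (lincomb scF (bdF b_expr d_expr) r) = lincomb scF (bdF b_expr d_expr) (rpart n r)"
proof (induction r rule: poly_mapping_additive_induct)
  case (single q r)
  have "homog (deg2 q) (scF r * bdF b_expr d_expr q)"
    using homog_mult[OF homog_scF homog_bdF] by simp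
  then have "hpart n (scF r * bdF b_expr d_expr q) = (if deg2 q = n then scF r * bdF b_expr d_expr q else 0)"
    by (rule hpart_homog)
  then show ?case by (simp add: lincF_single rpart_single lincF_zero)
qed (simp add: lincF_add hpart_add rpart_add)

lemma homog_filt: "homog n p \<Longrightarrow> p \<in> filt_lt (Suc n)"
  using hpart_in_filt[of n p] by (simp add: homog_def)

context cherednik
begin

abbreviation "lowH \<equiv> low (H_rels \<gamma>)"

lemma homog_idl_iff: "homog n p \<Longrightarrow> p \<in> idl UV_rels \<longleftrightarrow> p \<in> lowH n"
  unfolding homog_def by (rule homogeneous_idl_UV_iff[OF cherednik])

definition zcentral :: "((gl2 + vb) word \<Rightarrow>\<^sub>0 'k) \<Rightarrow> bool"
  where "zcentral p \<longleftrightarrow> (\<forall>q. p * q - q * p \<in> idl (H_rels \<gamma>))"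

lemma zcentral_one: "zcentral 1"
  by (simp add: zcentral_def)

lemma zcentral_scF: "zcentral (scF r)"
  by (simp add: zcentral_def scalar_commute)

lemma zcentral_add: "zcentral p \<Longrightarrow> zcentral q \<Longrightarrow> zcentral (p + q)"
  unfolding zcentral_def
proof
  fix a assume "\<forall>a. p * a - a * p \<in> idl (H_rels \<gamma>)" "\<forall>a. q * a - a * q \<in> idl (H_rels \<gamma>)"
  then have "(p * a - a * p) + (q * a - a * q) \<in> idl (H_rels \<gamma>)"
    by (intro idl_add) simp_all
  then show "(p + q) * a - a * (p + q) \<in> idl (H_rels \<gamma>)"
    by (simp add: algebra_simps)
qed

lemma zcentral_mult: "zcentral p \<Longrightarrow> zcentral q \<Longrightarrow> zcentral (p * q)"
  unfolding zcentral_def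
proof
  fix a assume "\<forall>a. p * a - a * p \<in> idl (H_rels \<gamma>)" "\<forall>a. q * a - a * q \<in> idl (H_rels \<gamma>)"
  then have "p * (q * a - a * q) + (p * a - a * p) * q \<in> idl (H_rels \<gamma>)"
    by (intro idl_add idl_lmult idl_rmult) simp_all
  then show "(p * q) * a - a * (p * q) \<in> idl (H_rels \<gamma>)"
    by (simp add: algebra_simps)
qed

lemma zcentral_power: "zcentral p \<Longrightarrow> zcentral (p ^ n)"
  by (induction n) (simp_all add: zcentral_one zcentral_mult)

lemma zcentral_idl: "p - q \<in> idl (H_rels \<gamma>) \<Longrightarrow> zcentral p \<Longrightarrow> zcentral q"
  unfolding zcentral_def
proof
  fix a assume pq: "p - q \<in> idl (H_rels \<gamma>)" and "\<forall>a. p * a - a * p \<in> idl (H_rels \<gamma>)"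
  then have "(p * a - a * p) - ((p - q) * a - a * (p - q)) \<in> idl (H_rels \<gamma>)"
    using idl_lmult[OF pq, of a] idl_rmult[OF pq, of a] by (intro idl_diff[of "p * a - a * p"] idl_diff[of "(p - q) * a"]) simp_all
  then show "q * a - a * q \<in> idl (H_rels \<gamma>)"
    by (simp add: algebra_simps)
qed

lemma zcentral_lincomb: "zcentral B \<Longrightarrow> zcentral D \<Longrightarrow> zcentral (lincomb scF (bdF B D) r)"
  by (induction r rule: poly_mapping_additive_induct)
    (simp_all add: lincF_single lincF_add bdF_def zcentral_add zcentral_mult zcentral_scF zcentral_power)

text \<open>The leading part of a central element is central in the associated graded algebra, because its commutator with a
  generator is homogeneous and equal to zero up to lower degree.\<close>

lemma hpart_central:
  assumes p: "p \<in> filt_lt (Suc n)" "zcentral p"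
  shows "hpart n p * gen b - gen b * hpart n p \<in> idl UV_rels"
proof -
  let ?d = "if isl b then 0 else 1 :: nat"
  have g: "homog ?d (gen b)"
    by (simp add: homog_def hpart_gen)
  have h: "homog n (hpart n p)"
    by (simp add: homog_def hpart_hpart)
  have hom: "homog (n + ?d) (hpart n p * gen b - gen b * hpart n p)"
    using homog_mult[OF h g] homog_mult[OF g h] by (intro homog_diff) (simp_all only: add.commute)
  have "p - hpart n p \<in> filt_lt n"
    by (rule diff_hpart_in_filt[OF p(1)])
  then have lt: "(p - hpart n p) * gen b \<in> filt_lt (n + ?d)" "gen b * (p - hpart n p) \<in> filt_lt (n + ?d)"
    by (simp_all only: filt_lt_mult homog_filt[OF g])
  have "p * gen b - gen b * p \<in> lowH (n + ?d)"
    using p(2) unfolding zcentral_def by (intro idl_in_low) blast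
  from low_diff[OF this low_diff[OF filt_lt_in_low[OF lt(1)] filt_lt_in_low[OF lt(2)]]]
  have "hpart n p * gen b - gen b * hpart n p \<in> lowH (n + ?d)"
    by (simp add: algebra_simps)
  then show ?thesis using homog_idl_iff[OF hom] by simp
qed

end

locale cherednik_center = cherednik \<gamma> c G K L K'
  for \<gamma> :: "(vb \<Rightarrow>\<^sub>0 'k) \<Rightarrow> (vb \<Rightarrow>\<^sub>0 'k) \<Rightarrow> (gl2 word \<Rightarrow>\<^sub>0 'k::field_char_0) set"
    and c G K L K' :: "gl2 word \<Rightarrow>\<^sub>0 'k" +
  fixes w :: "gl2 word \<Rightarrow>\<^sub>0 'k"
  assumes w: "\<And>q. (d_expr + incl w) * q - q * (d_expr + incl w) \<in> idl (H_rels \<gamma>)"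
begin

abbreviation "zb \<equiv> b_expr - incl c"
abbreviation "zd \<equiv> d_expr + incl w"

lemma zcentral_zb: "zcentral zb" and zcentral_zd: "zcentral zd"
  unfolding zcentral_def using bc_central w by blast+

lemma filt_zb: "zb - b_expr \<in> filt_lt 2" and filt_zd: "zd - d_expr \<in> filt_lt 2"
proof -
  have "incl p \<in> (filt_lt 2 :: ((gl2 + vb) word \<Rightarrow>\<^sub>0 'k) set)" for p :: "gl2 word \<Rightarrow>\<^sub>0 'k"
    using filt_lt_mono[OF homog_filt[OF homog_incl[of p]], of 2] by simp
  from this[of c] this[of w] show "zb - b_expr \<in> filt_lt 2" "zd - d_expr \<in> filt_lt 2"
    using filt_lt_uminus[of "incl c"] by simp_all
qed

lemma low_power:
  assumes "p - p' \<in> lowH n" "homog n p'"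
  shows "p ^ i - p' ^ i \<in> lowH (n * i)"
proof (induction i)
  case (Suc i)
  have "p * p ^ i - p' * p' ^ i \<in> lowH (n + n * i)"
    by (rule low_cong_mult[OF assms(1) Suc]) (intro homog_filt homog_power assms(2))+
  then show ?case by simp
qed simp

lemma bdF_low: "bdF zb zd q - bdF b_expr d_expr q \<in> lowH (deg2 q)"
proof -
  have "zb ^ fst q * zd ^ snd q - b_expr ^ fst q * d_expr ^ snd q \<in> lowH (2 * fst q + 2 * snd q)"
    by (rule low_cong_mult)
      (intro low_power filt_lt_in_low filt_zb filt_zd homog_b homog_d homog_filt homog_power)+
  then show ?thesis by (simp add: bdF_def deg2_def)
qed

text \<open>The leading part of a polynomial in the lifts is given by its part of highest degree, evaluated at \<open>b\<close> and \<open>d\<close>.\<close>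

lemma lincomb_low:
  assumes "\<And>q. q \<in> Poly_Mapping.keys r \<Longrightarrow> deg2 q \<le> n"
  shows "lincomb scF (bdF zb zd) r - lincomb scF (bdF b_expr d_expr) (rpart n r) \<in> lowH n"
proof -
  have "lincomb scF (bdF b_expr d_expr) (rpart n r) =
      (\<Sum>q\<in>Poly_Mapping.keys r. if deg2 q = n then scF (Poly_Mapping.lookup r q) * bdF b_expr d_expr q else 0)"
  proof -
    have "lincomb scF (bdF b_expr d_expr) (\<Sum>q\<in>A. if deg2 q = n then Poly_Mapping.single q (Poly_Mapping.lookup r q) else 0) =
      (\<Sum>q\<in>A. if deg2 q = n then scF (Poly_Mapping.lookup r q) * bdF b_expr d_expr q else 0)" for A
      by (induction A rule: infinite_finite_induct) (simp_all add: lincF_zero lincF_add lincF_single)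
    then show ?thesis by (simp add: rpart_def)
  qed
  then have "lincomb scF (bdF zb zd) r - lincomb scF (bdF b_expr d_expr) (rpart n r) =
      (\<Sum>q\<in>Poly_Mapping.keys r. scF (Poly_Mapping.lookup r q) * bdF zb zd q -
        (if deg2 q = n then scF (Poly_Mapping.lookup r q) * bdF b_expr d_expr q else 0))"
    by (simp add: lincomb_def sum_subtractf)
  also have "\<dots> \<in> lowH n"
  proof (rule low_sum)
    fix q assume q: "q \<in> Poly_Mapping.keys r"
    have d: "scF a * (bdF zb zd q - bdF b_expr d_expr q) \<in> lowH (deg2 q)" for a
      using low_mult(2)[OF bdF_low homog_filt[OF homog_scF[of a]], of q] by simp
    show "scF (Poly_Mapping.lookup r q) * bdF zb zd q -
        (if deg2 q = n then scF (Poly_Mapping.lookup r q) * bdF b_expr d_expr q else 0) \<in> lowH n"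
    proof (cases "deg2 q = n")
      case True
      then show ?thesis using d[of "Poly_Mapping.lookup r q"] by (simp add: right_diff_distrib)
    next
      case False
      then have less: "Suc (deg2 q) \<le> n" using assms[OF q] by simp
      have "scF a * bdF b_expr d_expr q \<in> lowH n" for a
        using filt_lt_mono[OF homog_filt[OF homog_mult[OF homog_scF homog_bdF]] , of q n] less
        by (intro filt_lt_in_low) simp
      moreover have "scF a * (bdF zb zd q - bdF b_expr d_expr q) \<in> lowH n" for a
        using low_mono[OF d] less by simp
      ultimately have "scF a * (bdF zb zd q - bdF b_expr d_expr q) + scF a * bdF b_expr d_expr q \<in> lowH n" for a
        by (intro low_add)
      then show ?thesis using False by (simp add: right_diff_distrib)
    qed
  qed
  finally show ?thesis .
qed

text \<open>If a polynomial in the lifts vanishes, then so does its leading part, against the independence of \<open>b\<close> and \<open>d\<close>.\<close>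

lemma center_independent:
  assumes "lincomb scF (bdF zb zd) r \<in> idl (H_rels \<gamma>)"
  shows "r = 0"
proof (rule ccontr)
  assume "r \<noteq> 0"
  then have ne: "deg2 ` Poly_Mapping.keys r \<noteq> {}" by simp
  define n where "n = Max (deg2 ` Poly_Mapping.keys r)"
  have "n \<in> deg2 ` Poly_Mapping.keys r"
    unfolding n_def using ne by (intro Max_in) simp_all
  then obtain q where q: "q \<in> Poly_Mapping.keys r" "deg2 q = n" by auto
  have le: "deg2 q \<le> n" if "q \<in> Poly_Mapping.keys r" for q
    unfolding n_def using that by (intro Max_ge) auto
  have "lincomb scF (bdF zb zd) r - (lincomb scF (bdF zb zd) r - lincomb scF (bdF b_expr d_expr) (rpart n r)) \<in> lowH n"
    by (intro low_diff idl_in_low assms lincomb_low le)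
  moreover have "homog n (lincomb scF (bdF b_expr d_expr) (rpart n r))"
    unfolding hpart_lincomb[symmetric] by (simp add: homog_def hpart_hpart)
  ultimately have "lincomb scF (bdF b_expr d_expr) (rpart n r) \<in> idl UV_rels"
    by (simp add: homog_idl_iff)
  then have "rpart n r = 0"
    by (rule graded_center_independent)
  then have "Poly_Mapping.lookup (rpart n r) q = 0" by simp
  then show False using q by (simp add: lookup_rpart in_keys_iff)
qed

lemma rpart_low: "lincomb scF (bdF zb zd) (rpart n r) - hpart n (lincomb scF (bdF b_expr d_expr) r) \<in> lowH n"
proof -
  have "deg2 q \<le> n" if "q \<in> Poly_Mapping.keys (rpart n r)" for q
    using that by (simp add: in_keys_iff lookup_rpart split: if_splits)
  moreover have "rpart n (rpart n r) = rpart n r"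
    by (rule poly_mapping_eqI) (simp add: lookup_rpart)
  ultimately show ?thesis
    using lincomb_low[of "rpart n r" n] by (simp add: hpart_lincomb)
qed

text \<open>By induction on the degree: the leading part of a central element is a polynomial in \<open>b\<close> and \<open>d\<close>, and subtracting
  the same polynomial in the lifts lowers the degree.\<close>

lemma center_spanned:
  assumes "zcentral p"
  shows "\<exists>r. p - lincomb scF (bdF zb zd) r \<in> idl (H_rels \<gamma>)"
proof -
  have "\<exists>r. p - lincomb scF (bdF zb zd) r \<in> idl (H_rels \<gamma>)" if "p \<in> filt_lt n" "zcentral p" for n p
    using that
  proof (induction n arbitrary: p)
    case 0
    then show ?case by (intro exI[of _ 0]) (simp add: lincF_zero)
  next
    case (Suc n)
    obtain r where r: "hpart n p - lincomb scF (bdF b_expr d_expr) r \<in> idl UV_rels"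
      using graded_center_spanned[OF hpart_central[OF Suc.prems]] by blast
    let ?T = "lincomb scF (bdF zb zd) (rpart n r)"
    have "hpart n (hpart n p - lincomb scF (bdF b_expr d_expr) r) \<in> lowH n"
      using r idl_UV_iff_low[OF cherednik] by blast
    then have "hpart n p - hpart n (lincomb scF (bdF b_expr d_expr) r) \<in> lowH n"
      by (simp add: hpart_diff hpart_hpart)
    moreover have "p - hpart n p \<in> lowH n"
      by (intro filt_lt_in_low diff_hpart_in_filt Suc.prems)
    ultimately have "p - ?T \<in> lowH n"
      using rpart_low[of n r] by (meson low_diff_commute low_trans)
    then obtain p' where p': "p' \<in> filt_lt n" "(p - ?T) - p' \<in> idl (H_rels \<gamma>)"
      by (auto simp: low_def)
    have "zcentral (p + scF (-1) * ?T)"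
      by (intro zcentral_add zcentral_mult zcentral_scF zcentral_lincomb zcentral_zb zcentral_zd Suc.prems)
    then have "zcentral (p - ?T)"
      by (simp add: single_uminus)
    then have "zcentral p'"
      using zcentral_idl p'(2) by blast
    with Suc.IH p'(1) obtain r' where r': "p' - lincomb scF (bdF zb zd) r' \<in> idl (H_rels \<gamma>)" by blast
    have "p - lincomb scF (bdF zb zd) (rpart n r + r') = ((p - ?T) - p') + (p' - lincomb scF (bdF zb zd) r')"
      by (simp add: lincF_add)
    then show ?case using idl_add[OF p'(2) r'] by metis
  qed
  then show ?thesis using filt_lt_bounded assms by blast
qed

lemma lincomb_mult_cong:
  "lincomb scF (bdF zb zd) (p * q) - lincomb scF (bdF zb zd) p * lincomb scF (bdF zb zd) q \<in> idl (H_rels \<gamma>)"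
proof (induction p rule: poly_mapping_additive_induct)
  case (single u r)
  show ?case
  proof (induction q rule: poly_mapping_additive_induct)
    case (single v r')
    let ?s = "scF r * scF r'"
    have "Z * (scF r' * W) = scF r' * (Z * W)" for Z W
      by (simp only: mult.assoc[symmetric] scalar_commute[of r' Z])
    then have "scF r * (zb ^ fst u * zd ^ snd u) * (scF r' * (zb ^ fst v * zd ^ snd v)) =
        ?s * (zb ^ fst u * (zd ^ snd u * zb ^ fst v) * zd ^ snd v)"
      by (simp only: mult.assoc)
    moreover have "?s * (zb ^ fst u * (zb ^ fst v * zd ^ snd u) * zd ^ snd v) = scF (r * r') * bdF zb zd (u + v)"
      by (simp add: bdF_def mult_single power_add mult.assoc)
    ultimately have "scF (r * r') * bdF zb zd (u + v) - scF r * bdF zb zd u * (scF r' * bdF zb zd v) =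
        ?s * (zb ^ fst u * (zb ^ fst v * zd ^ snd u - zd ^ snd u * zb ^ fst v) * zd ^ snd v)"
      by (simp add: bdF_def left_diff_distrib right_diff_distrib)
    moreover have "zb ^ fst v * zd ^ snd u - zd ^ snd u * zb ^ fst v \<in> idl (H_rels \<gamma>)"
      using zcentral_power[OF zcentral_zb] by (simp add: zcentral_def)
    ultimately show ?case
      by (simp add: mult_single lincF_single idl_lmult idl_rmult)
  next
    case (add q q')
    have "lincomb scF (bdF zb zd) (Poly_Mapping.single u r * (q + q')) - lincomb scF (bdF zb zd) (Poly_Mapping.single u r) * lincomb scF (bdF zb zd) (q + q') =
      (lincomb scF (bdF zb zd) (Poly_Mapping.single u r * q) - lincomb scF (bdF zb zd) (Poly_Mapping.single u r) * lincomb scF (bdF zb zd) q) +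
      (lincomb scF (bdF zb zd) (Poly_Mapping.single u r * q') - lincomb scF (bdF zb zd) (Poly_Mapping.single u r) * lincomb scF (bdF zb zd) q')"
      by (simp add: distrib_left lincF_add)
    then show ?case using idl_add[OF add] by simp
  qed
next
  case (add p p')
  have "lincomb scF (bdF zb zd) ((p + p') * q) - lincomb scF (bdF zb zd) (p + p') * lincomb scF (bdF zb zd) q =
    (lincomb scF (bdF zb zd) (p * q) - lincomb scF (bdF zb zd) p * lincomb scF (bdF zb zd) q) +
    (lincomb scF (bdF zb zd) (p' * q) - lincomb scF (bdF zb zd) p' * lincomb scF (bdF zb zd) q)"
    by (simp add: distrib_right lincF_add)
  then show ?case using idl_add[OF add] by simp
qed

abbreviation "clH \<equiv> cls (H_rels \<gamma>)"

lemma clH_power: "clH p [^]\<^bsub>H_alg \<gamma>\<^esub> (n :: nat) = clH (p ^ n)"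
proof -
  interpret ring "H_alg \<gamma>" unfolding H_alg_def by (rule presented_ring)
  show ?thesis
    by (induction n) (simp_all add: H_alg_def presented_one power_Suc2 del: power_Suc)
qed

lemma poly2_eval_eq: "poly2_eval (H_alg \<gamma>) (scal (H_rels \<gamma>)) (clH zb) (clH zd) r = clH (lincomb scF (bdF zb zd) r)"
proof -
  have "(\<lambda>(i, j). scal (H_rels \<gamma>) (Poly_Mapping.lookup r (i, j)) \<otimes>\<^bsub>H_alg \<gamma>\<^esub>
       (clH zb [^]\<^bsub>H_alg \<gamma>\<^esub> (i::nat) \<otimes>\<^bsub>H_alg \<gamma>\<^esub> clH zd [^]\<^bsub>H_alg \<gamma>\<^esub> (j::nat))) =
     (\<lambda>q. clH (scF (Poly_Mapping.lookup r q) * bdF zb zd q))"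
    by (rule ext) (simp add: clH_power scal_def bdF_def split_def, simp add: H_alg_def)
  then show ?thesis
    by (simp add: poly2_eval_def H_alg_def finsum_cls lincomb_def)
qed

lemma clH_center: "clH p \<in> center (H_alg \<gamma>) \<longleftrightarrow> zcentral p"
  by (simp add: H_alg_def cls_in_center_iff zcentral_def)

lemma center_clH: "z \<in> center (H_alg \<gamma>) \<Longrightarrow> \<exists>p. z = clH p \<and> zcentral p"
  by (auto simp: H_alg_def center_presented zcentral_def)

lemma poly2_iso:
  "poly2_eval (H_alg \<gamma>) (scal (H_rels \<gamma>)) (clH zb) (clH zd) \<in> ring_iso poly2_ring (center_ring (H_alg \<gamma>))"
proof -
  let ?\<phi> = "poly2_eval (H_alg \<gamma>) (scal (H_rels \<gamma>)) (clH zb) (clH zd)"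
  have \<phi>: "?\<phi> = (\<lambda>r. clH (lincomb scF (bdF zb zd) r))"
    by (rule ext) (rule poly2_eval_eq)
  have cen: "clH (lincomb scF (bdF zb zd) r) \<in> center (H_alg \<gamma>)" for r
    by (simp add: clH_center zcentral_lincomb zcentral_zb zcentral_zd)
  have "?\<phi> \<in> ring_hom poly2_ring (center_ring (H_alg \<gamma>))"
  proof (rule ring_hom_memI)
    fix p q :: "nat \<times> nat \<Rightarrow>\<^sub>0 'k"
    show "?\<phi> p \<in> carrier (center_ring (H_alg \<gamma>))"
      by (simp add: \<phi> center_ring_def cen)
    show "?\<phi> (p \<otimes>\<^bsub>poly2_ring\<^esub> q) = ?\<phi> p \<otimes>\<^bsub>center_ring (H_alg \<gamma>)\<^esub> ?\<phi> q"
      unfolding \<phi> using lincomb_mult_cong[of p q] by (simp add: center_ring_def H_alg_def cls_eq_iff)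
    show "?\<phi> (p \<oplus>\<^bsub>poly2_ring\<^esub> q) = ?\<phi> p \<oplus>\<^bsub>center_ring (H_alg \<gamma>)\<^esub> ?\<phi> q"
      unfolding \<phi> by (simp add: center_ring_def H_alg_def lincF_add)
    have "lincomb scF (bdF zb zd) 1 = 1"
      using lincF_single[of "bdF zb zd" 0 1] by (simp add: bdF_def)
    then show "?\<phi> \<one>\<^bsub>poly2_ring\<^esub> = \<one>\<^bsub>center_ring (H_alg \<gamma>)\<^esub>"
      unfolding \<phi> by (simp add: center_ring_def H_alg_def presented_one)
  qed
  moreover have "bij_betw ?\<phi> (carrier poly2_ring) (carrier (center_ring (H_alg \<gamma>)))"
    unfolding bij_betw_def
  proof
    show "inj_on ?\<phi> (carrier poly2_ring)"
    proof (rule inj_onI)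
      fix p q assume "?\<phi> p = ?\<phi> q"
      then have "lincomb scF (bdF zb zd) p - lincomb scF (bdF zb zd) q \<in> idl (H_rels \<gamma>)"
        by (simp add: \<phi> cls_eq_iff)
      then have "lincomb scF (bdF zb zd) (p - q) \<in> idl (H_rels \<gamma>)"
        using lincF_add[of "bdF zb zd" "p - q" q] by (simp add: algebra_simps)
      then show "p = q" using center_independent by force
    qed
    show "?\<phi> ` carrier poly2_ring = carrier (center_ring (H_alg \<gamma>))"
    proof (intro equalityI subsetI)
      fix z assume "z \<in> carrier (center_ring (H_alg \<gamma>))"
      then obtain p where p: "z = clH p" "zcentral p"
        using center_clH by (auto simp: center_ring_def)
      then obtain r where "p - lincomb scF (bdF zb zd) r \<in> idl (H_rels \<gamma>)"
        using center_spanned by blast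
      then have "z = ?\<phi> r" by (simp add: \<phi> p cls_eq_iff)
      then show "z \<in> ?\<phi> ` carrier poly2_ring" by simp
    qed (auto simp: \<phi> center_ring_def cen)
  qed
  ultimately show ?thesis by (simp add: ring_iso_def)
qed

text \<open>A nonzero homogeneous element of the graded algebra stays nonzero modulo lower degree in \<open>H\<^sub>c\<close>, so that the class of
  \<open>z\<close> has degree exactly \<open>2\<close>.\<close>

lemma leading_term_eq:
  assumes z: "z - p \<in> filt_lt 2" and p: "homog 2 p" "p \<notin> idl UV_rels"
  shows "leading_term (H_alg \<gamma>) (H_filt \<gamma>) (clH z) = natural_map \<gamma> (cls UV_rels p)"
proof -
  have "z = (z - p) + p" by simp
  then have "z \<in> filt_lt 3"
    using filt_lt_add[OF filt_lt_mono[OF z, of 3] homog_filt[OF p(1), simplified]] by (simp add: numeral_3_eq_3)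
  then have in2: "clH z \<in> cfilt (H_rels \<gamma>) 2"
    by (simp add: cfilt_def numeral_3_eq_3 numeral_2_eq_2)
  have ge: "2 \<le> n" if n: "clH z \<in> cfilt (H_rels \<gamma>) n" for n
  proof (rule ccontr)
    assume "\<not> 2 \<le> n"
    from n obtain q where q: "q \<in> filt_lt (Suc n)" "z - q \<in> idl (H_rels \<gamma>)"
      by (auto simp: cfilt_def cls_eq_iff)
    have "q \<in> filt_lt 2" using q(1) \<open>\<not> 2 \<le> n\<close> by (auto elim: filt_lt_mono)
    then have "z \<in> lowH 2" using q(2) by (rule lowI)
    from low_diff[OF this filt_lt_in_low[OF z]] have "p \<in> lowH 2" by simp
    then show False using p by (simp add: homog_idl_iff)
  qed
  have least: "(LEAST n. clH z \<in> cfilt (H_rels \<gamma>) n) = 2"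
    by (rule Least_equality) (use in2 ge in auto)
  have "gcos (H_rels \<gamma>) 2 z = gcos (H_rels \<gamma>) 2 p"
    using z by (simp add: gcos_eq_iff filt_lt_in_low)
  then have "gr_class (presented (H_rels \<gamma>)) (cfilt (H_rels \<gamma>)) 2 (clH z) = gr_class (presented (H_rels \<gamma>)) (cfilt (H_rels \<gamma>)) 2 (clH p)"
    unfolding gr_class_def prev_coset by (rule arg_cong)
  also have "\<dots> = gproj (H_rels \<gamma>) p"
    by (rule gr_class_gproj) (use p(1) in \<open>simp add: homog_def\<close>)
  also have "\<dots> = natural_map \<gamma> (cls UV_rels p)"
    by (rule natural_map_cls[symmetric]) (use cherednik in \<open>simp add: infinitesimal_cherednik_def\<close>)
  finally show ?thesis
    by (simp add: leading_term_def H_filt_eq_cfilt H_alg_def least)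
qed

lemma b_nonzero: "b_expr \<notin> idl (UV_rels :: (_ \<Rightarrow>\<^sub>0 'k) set)"
  and d_nonzero: "d_expr \<notin> idl (UV_rels :: (_ \<Rightarrow>\<^sub>0 'k) set)"
proof -
  have "Poly_Mapping.single q (1::'k) \<noteq> 0" for q :: "nat \<times> nat"
    by (metis lookup_single_eq lookup_zero one_neq_zero)
  then have n: "lincomb scF (bdF b_expr d_expr) (Poly_Mapping.single q (1::'k)) \<notin> idl UV_rels" for q
    using graded_center_independent by blast
  show "b_expr \<notin> idl (UV_rels :: (_ \<Rightarrow>\<^sub>0 'k) set)"
    using n[of "(1, 0)"] by (simp add: lincF_single bdF_def)
  show "d_expr \<notin> idl (UV_rels :: (_ \<Rightarrow>\<^sub>0 'k) set)"
    using n[of "(0, 1)"] by (simp add: lincF_single bdF_def)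
qed

lemma gproj_central_iff: "gproj (H_rels \<gamma>) p \<in> center (gr_H \<gamma>) \<longleftrightarrow> (\<forall>q. p * q - q * p \<in> idl UV_rels)"
proof -
  have "gproj (H_rels \<gamma>) p \<in> center (gr_H \<gamma>) \<longleftrightarrow> (\<forall>q. gproj (H_rels \<gamma>) (p * q) = gproj (H_rels \<gamma>) (q * p))"
    by (simp add: center_def H_alg_def H_filt_eq_cfilt carrier_gr gproj_mult)
  also have "\<dots> \<longleftrightarrow> (\<forall>q. p * q - q * p \<in> idl UV_rels)"
    using idl_UV_iff_low[OF cherednik] by (simp add: gproj_eq_iff)
  finally show ?thesis .
qed

text \<open>One inclusion holds because leading parts of central elements are central. For the other one, a central element of
  the graded algebra is a polynomial in \<open>b\<close> and \<open>d\<close>, and its homogeneous parts are the leading parts of the same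
  polynomials in the lifts.\<close>

lemma gr_center:
  "gr_sub (H_alg \<gamma>) (H_filt \<gamma>) (center (H_alg \<gamma>)) = center (gr_H \<gamma>)"
proof (intro equalityI subsetI)
  fix u assume u: "u \<in> gr_sub (H_alg \<gamma>) (H_filt \<gamma>) (center (H_alg \<gamma>))"
  then have "u \<in> carrier (grp (H_rels \<gamma>))"
    by (simp add: gr_sub_def H_alg_def H_filt_eq_cfilt)
  then obtain p where p: "u = gproj (H_rels \<gamma>) p"
    by (auto simp: carrier_gr)
  have "hpart n p * gen b - gen b * hpart n p \<in> idl UV_rels" for n b
  proof -
    have "\<exists>a \<in> center (H_alg \<gamma>) \<inter> H_filt \<gamma> n. u n = prev (H_alg \<gamma>) (H_filt \<gamma>) n +>\<^bsub>H_alg \<gamma>\<^esub> a"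
      using u by (simp add: gr_sub_def)
    then obtain a where a: "a \<in> center (H_alg \<gamma>)" "a \<in> cfilt (H_rels \<gamma>) n"
        "u n = prev (presented (H_rels \<gamma>)) (cfilt (H_rels \<gamma>)) n +>\<^bsub>presented (H_rels \<gamma>)\<^esub> a"
      by (auto simp: H_filt_eq_cfilt H_alg_def)
    then obtain q where q: "q \<in> filt_lt (Suc n)" "a = clH q"
      by (auto simp: cfilt_def)
    then have "zcentral q" using a(1) by (simp add: clH_center)
    note qc = hpart_central[OF q(1) this]
    have "hpart n p - q \<in> lowH n"
      using a(3) by (simp add: q(2) prev_coset p gproj_def gcos_eq_iff)
    moreover have "q - hpart n q \<in> lowH n"
      by (intro filt_lt_in_low diff_hpart_in_filt q)
    ultimately have "hpart n p - hpart n q \<in> lowH n"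
      by (rule low_trans)
    moreover have "homog n (hpart n p - hpart n q)"
      by (simp add: homog_def hpart_diff hpart_hpart)
    ultimately have "hpart n p - hpart n q \<in> idl UV_rels"
      by (simp add: homog_idl_iff)
    from idl_add[OF qc[of b] idl_diff[OF idl_rmult[OF this, of "gen b"] idl_lmult[OF this, of "gen b"]]]
    show ?thesis by (simp add: algebra_simps)
  qed
  moreover obtain N where "p \<in> filt_lt N" using filt_lt_bounded by blast
  then have "p = (\<Sum>n<N. hpart n p)" by (rule sum_hpart)
  moreover have "(\<Sum>n<N. hpart n p) * gen b - gen b * (\<Sum>n<N. hpart n p) = (\<Sum>n<N. hpart n p * gen b - gen b * hpart n p)" for b
    by (simp add: sum_distrib_left sum_distrib_right sum_subtractf)
  moreover have "(\<Sum>n<N. hpart n p * gen b - gen b * hpart n p) \<in> idl UV_rels" for b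
    by (rule idl_sum) (rule calculation(1))
  ultimately have "p * gen b - gen b * p \<in> idl UV_rels" for b
    by simp
  then show "u \<in> center (gr_H \<gamma>)"
    unfolding p gproj_central_iff using commutes_if_commutes_gen by blast
next
  fix u assume u: "u \<in> center (gr_H \<gamma>)"
  then have carr: "u \<in> carrier (gr_H \<gamma>)"
    by (simp add: center_def)
  then obtain p where p: "u = gproj (H_rels \<gamma>) p"
    by (auto simp: H_alg_def H_filt_eq_cfilt carrier_gr)
  then have "\<forall>q. p * q - q * p \<in> idl UV_rels"
    using u gproj_central_iff by simp
  then obtain r where r: "p - lincomb scF (bdF b_expr d_expr) r \<in> idl UV_rels"
    using graded_center_spanned by blast
  have "\<exists>a \<in> center (H_alg \<gamma>) \<inter> H_filt \<gamma> n. u n = prev (H_alg \<gamma>) (H_filt \<gamma>) n +>\<^bsub>H_alg \<gamma>\<^esub> a" for n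
  proof -
    let ?T = "lincomb scF (bdF zb zd) (rpart n r)" and ?P = "lincomb scF (bdF b_expr d_expr) r"
    have "hpart n (p - ?P) \<in> lowH n"
      using r idl_UV_iff_low[OF cherednik] by blast
    then have pT: "hpart n p - ?T \<in> lowH n"
      using rpart_low[of n r] by (metis hpart_diff low_diff_commute low_trans)
    have "?T - hpart n ?P \<in> lowH n" by (rule rpart_low)
    then obtain q where q: "q \<in> filt_lt n" "?T - hpart n ?P - q \<in> idl (H_rels \<gamma>)"
      by (auto simp: low_def)
    have "clH ?T = clH (hpart n ?P + q)"
      using q(2) by (simp add: cls_eq_iff algebra_simps)
    moreover have "hpart n ?P + q \<in> filt_lt (Suc n)"
      by (intro filt_lt_add hpart_in_filt filt_lt_mono[OF q(1)]) simp
    ultimately have "clH ?T \<in> H_filt \<gamma> n"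
      by (simp add: H_filt_eq_cfilt cfilt_def)
    moreover have "clH ?T \<in> center (H_alg \<gamma>)"
      by (simp add: clH_center zcentral_lincomb zcentral_zb zcentral_zd)
    moreover have "u n = prev (H_alg \<gamma>) (H_filt \<gamma>) n +>\<^bsub>H_alg \<gamma>\<^esub> clH ?T"
      using pT by (simp add: p H_alg_def H_filt_eq_cfilt prev_coset gproj_def gcos_eq_iff)
    ultimately show ?thesis by blast
  qed
  then show "u \<in> gr_sub (H_alg \<gamma>) (H_filt \<gamma>) (center (H_alg \<gamma>))"
    using carr by (simp add: gr_sub_def)
qed

end

theorem theorem2p1:
  fixes \<gamma> :: "(vb \<Rightarrow>\<^sub>0 'k) \<Rightarrow> (vb \<Rightarrow>\<^sub>0 'k) \<Rightarrow> (gl2 word \<Rightarrow>\<^sub>0 'k::field_char_0) set"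
    and c :: "(gl2 word \<Rightarrow>\<^sub>0 'k) set"
  assumes "is_H_c \<gamma> c"
  shows "(\<exists>z\<^sub>1 \<in> center (H_alg \<gamma>). \<exists>z\<^sub>2 \<in> center (H_alg \<gamma>).
            poly2_eval (H_alg \<gamma>) (scal (H_rels \<gamma>)) z\<^sub>1 z\<^sub>2
              \<in> ring_iso poly2_ring (center_ring (H_alg \<gamma>)) \<and>
            leading_term (H_alg \<gamma>) (H_filt \<gamma>) z\<^sub>1 = natural_map \<gamma> (cls UV_rels b_expr) \<and>
            leading_term (H_alg \<gamma>) (H_filt \<gamma>) z\<^sub>2 = natural_map \<gamma> (cls UV_rels d_expr)) \<and>
         gr_sub (H_alg \<gamma>) (H_filt \<gamma>) (center (H_alg \<gamma>)) = center (gr_H \<gamma>)"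
proof -
  from assms have ic: "infinitesimal_cherednik \<gamma>" and c: "c \<in> center U_gl2"
    and bc: "cls (H_rels \<gamma>) b_expr \<ominus>\<^bsub>H_alg \<gamma>\<^esub> U_to_H \<gamma> c \<in> center (H_alg \<gamma>)"
    by (simp_all only: is_H_c_def)
  then have inv: "invariant_pairing \<gamma>"
    by (simp only: infinitesimal_cherednik_def)
  obtain G K L K' where reps: "G \<in> \<gamma> (Poly_Mapping.single Vx1 1) (Poly_Mapping.single Vx 1)"
    "K \<in> \<gamma> (Poly_Mapping.single Vy1 1) (Poly_Mapping.single Vx 1)"
    "L \<in> \<gamma> (Poly_Mapping.single Vy1 1) (Poly_Mapping.single Vy 1)"
    "K' \<in> \<gamma> (Poly_Mapping.single Vx1 1) (Poly_Mapping.single Vy 1)"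
    using pairing_representative[OF inv] by metis
  obtain c0 where c0: "c = cls U_rels c0" "\<And>a. c0 * a - a * c0 \<in> idl U_rels"
    using c by (auto simp: U_gl2_def center_presented)
  \<comment> \<open>All representatives of \<open>c\<close> have the same image in \<open>H\<^sub>c\<close>.\<close>
  have "cls (H_rels \<gamma>) (incl p) = cls (H_rels \<gamma>) (incl c0)" if "p \<in> c" for p
    using that incl_idl_U[of "p - c0"] idl_smash_subset_idl_H[of \<gamma>]
    by (auto simp: c0(1) cls_alt[of U_rels] cls_eq_iff incl_diff)
  moreover have "c0 \<in> c" by (simp add: c0(1) self_in_cls)
  ultimately have "(\<lambda>p. cls (H_rels \<gamma>) (incl p)) ` c = {cls (H_rels \<gamma>) (incl c0)}" by blast
  then have "U_to_H \<gamma> c = cls (H_rels \<gamma>) (incl c0)" by (simp add: U_to_H_def)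
  with bc have "cls (H_rels \<gamma>) (b_expr - incl c0) \<in> center (presented (H_rels \<gamma>))"
    by (simp add: H_alg_def)
  then have "(b_expr - incl c0) * q - q * (b_expr - incl c0) \<in> idl (H_rels \<gamma>)" for q
    by (simp only: cls_in_center_iff)
  with ic reps c0(2) interpret cherednik \<gamma> c0 G K L K'
    by unfold_locales
  obtain w where "\<And>q. (d_expr + incl w) * q - q * (d_expr + incl w) \<in> idl (H_rels \<gamma>)"
    using d_lifts by blast
  then interpret cherednik_center \<gamma> c0 G K L K' w
    by unfold_locales
  have "clH zb \<in> center (H_alg \<gamma>)" "clH zd \<in> center (H_alg \<gamma>)"
    by (simp_all only: clH_center zcentral_zb zcentral_zd)
  then show ?thesis
    using poly2_iso leading_term_eq[OF filt_zb homog_b b_nonzero] leading_term_eq[OF filt_zd homog_d d_nonzero] gr_center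
    by blast
qed

end
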